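(* Let $F\colon\mathcal{H}\to\mathcal{N}$ be a finite-limit-preserving functor between toposes. Then the diagram consisting of $\pi_{1*}\colon\mathcal{N}\to\mathrm{Gl}(F)$, $\pi_2\colon\mathrm{Gl}(F)\to\mathcal{H}$ and $\pi_{2*}\colon\mathcal{H}\to\mathrm{Gl}(F)$ is an adjoint split extension in $\mathrm{Top}_{\mathrm{lex}}$.
   Context: "Topos" means elementary topos, with a distinguished terminal object $1$ and initial object $0$. $\mathrm{Top}_{\mathrm{lex}}$ is the 2-category of toposes, finite-limit-preserving functors and natural transformations. Zero morphisms in $\mathrm{Top}_{\mathrm{lex}}$ are the functors sending every object to a terminal object. A 2-cokernel of $f\colon A\to B$ is $c\colon B\to C$ with $cf$ zero such that (1) if $t\colon B\to X$ and $tf$ is zero then $t\cong hc$ for some $h\colon C\to X$; (2) for $h,h'\colon C\to X$ and $\alpha\colon hc\to h'c$ there is a unique $\gamma\colon h\to h'$ with $\gamma c=\alpha$. 2-kernels are defined dually (reversing 1-morphisms). An adjoint split extension consists of $K\colon\mathcal{N}\to\mathcal{G}$, $E\colon\mathcal{G}\to\mathcal{H}$, $E_*\colon\mathcal{H}\to\mathcal{G}$ in $\mathrm{Top}_{\mathrm{lex}}$ and a natural isomorphism $\epsilon\colon EE_*\to\mathrm{Id}_{\mathcal{H}}$ such that $K$ is the 2-kernel of $E$, $E$ is the 2-cokernel of $K$, and $E_*$ is right adjoint to $E$ with counit $\epsilon$. $\mathrm{Gl}(F)$ is the category with objects $(N,H,\ell)$, where $N\in\mathcal{N}$, $H\in\mathcal{H}$,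 $\ell\colon N\to F(H)$, and morphisms $(N,H,\ell)\to(N',H',\ell')$ the pairs $(f\colon N\to N',g\colon H\to H')$ with $\ell' f=F(g)\ell$. It is a (known) fact that $\mathrm{Gl}(F)$ is a topos. The functors are $\pi_2(N,H,\ell)=H$, $\pi_{1*}(N)=(N,1,!)$ with $!\colon N\to F(1)$ the unique map, and $\pi_{2*}(H)=(F(H),H,\mathrm{id}_{F(H)})$, with the evident actions on morphisms; the counit $\epsilon$ is the identity of $\pi_2\pi_{2*}=\mathrm{Id}_{\mathcal{H}}$. *)

theory Defs
  imports Main "HOL-Library.FuncSet"
begin

section \<open>Categories, functors and natural transformations\<close>

record ('o, 'a) category =
  Ob :: "'o set"
  Ar :: "'a set"
  Dom :: "'a \<Rightarrow> 'o"
  Cod :: "'a \<Rightarrow> 'o"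
  Ident :: "'o \<Rightarrow> 'a"
  Comp :: "'a \<Rightarrow> 'a \<Rightarrow> 'a"  (infixr "\<cdot>\<index>" 70)

definition hom :: "('o, 'a, 'z) category_scheme \<Rightarrow> 'o \<Rightarrow> 'o \<Rightarrow> 'a set" where
  "hom C x y = {f \<in> Ar C. Dom C f = x \<and> Cod C f = y}"

locale category =
  fixes C :: "('o, 'a, 'z) category_scheme" (structure)
  assumes Dom_closed: "f \<in> Ar C \<Longrightarrow> Dom C f \<in> Ob C"
    and Cod_closed: "f \<in> Ar C \<Longrightarrow> Cod C f \<in> Ob C"
    and Ident_hom: "x \<in> Ob C \<Longrightarrow> Ident C x \<in> hom C x x"
    and Comp_hom: "f \<in> hom C x y \<Longrightarrow> g \<in> hom C y z \<Longrightarrow> g \<cdot> f \<in> hom C x z"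
    and Comp_Ident: "f \<in> hom C x y \<Longrightarrow> f \<cdot> Ident C x = f"
    and Ident_Comp: "f \<in> hom C x y \<Longrightarrow> Ident C y \<cdot> f = f"
    and Comp_assoc: "f \<in> hom C w x \<Longrightarrow> g \<in> hom C x y \<Longrightarrow> h \<in> hom C y z
                       \<Longrightarrow> (h \<cdot> g) \<cdot> f = h \<cdot> (g \<cdot> f)"

text \<open>Only the values of a functor on the objects and arrows of its source category are
  meaningful.\<close>

record ('o, 'a, 'p, 'b) functor_data =
  fob :: "'o \<Rightarrow> 'p"
  far :: "'a \<Rightarrow> 'b"

definition is_functor ::
  "('o, 'a, 'y) category_scheme \<Rightarrow> ('p, 'b, 'z) category_scheme \<Rightarrow> ('o, 'a, 'p, 'b) functor_data \<Rightarrow> bool"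
  where
  "is_functor C D F \<longleftrightarrow> category C \<and> category D
     \<and> (\<forall>x \<in> Ob C. fob F x \<in> Ob D)
     \<and> (\<forall>x y. \<forall>f \<in> hom C x y. far F f \<in> hom D (fob F x) (fob F y))
     \<and> (\<forall>x \<in> Ob C. far F (Ident C x) = Ident D (fob F x))
     \<and> (\<forall>x y z. \<forall>f \<in> hom C x y. \<forall>g \<in> hom C y z. far F (g \<cdot>\<^bsub>C\<^esub> f) = far F g \<cdot>\<^bsub>D\<^esub> far F f)"

definition id_functor :: "('o, 'a, 'o, 'a) functor_data" where
  "id_functor = \<lparr> fob = (\<lambda>x. x), far = (\<lambda>f. f) \<rparr>"

definition comp_functor ::
  "('p, 'b, 'q, 'c) functor_data \<Rightarrow> ('o, 'a, 'p, 'b) functor_data \<Rightarrow> ('o, 'a, 'q, 'c) functor_data"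
  (infixr "\<odot>" 70) where
  "G \<odot> F = \<lparr> fob = (\<lambda>x. fob G (fob F x)), far = (\<lambda>f. far G (far F f)) \<rparr>"

text \<open>Families of components are taken to be \<^const>\<open>extensional\<close>, so that equality of functions is
  equality of natural transformations.\<close>

definition nat_trans ::
  "('o, 'a, 'y) category_scheme \<Rightarrow> ('p, 'b, 'z) category_scheme
    \<Rightarrow> ('o, 'a, 'p, 'b) functor_data \<Rightarrow> ('o, 'a, 'p, 'b) functor_data \<Rightarrow> ('o \<Rightarrow> 'b) \<Rightarrow> bool" where
  "nat_trans C D F G \<alpha> \<longleftrightarrow> is_functor C D F \<and> is_functor C D G
     \<and> \<alpha> \<in> extensional (Ob C)
     \<and> (\<forall>x \<in> Ob C. \<alpha> x \<in> hom D (fob F x) (fob G x))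
     \<and> (\<forall>x y. \<forall>f \<in> hom C x y. \<alpha> y \<cdot>\<^bsub>D\<^esub> far F f = far G f \<cdot>\<^bsub>D\<^esub> \<alpha> x)"

definition is_iso :: "('o, 'a, 'z) category_scheme \<Rightarrow> 'a \<Rightarrow> bool" where
  "is_iso C f \<longleftrightarrow> (\<exists>x y g. f \<in> hom C x y \<and> g \<in> hom C y x
     \<and> g \<cdot>\<^bsub>C\<^esub> f = Ident C x \<and> f \<cdot>\<^bsub>C\<^esub> g = Ident C y)"

definition nat_iso ::
  "('o, 'a, 'y) category_scheme \<Rightarrow> ('p, 'b, 'z) category_scheme
    \<Rightarrow> ('o, 'a, 'p, 'b) functor_data \<Rightarrow> ('o, 'a, 'p, 'b) functor_data \<Rightarrow> ('o \<Rightarrow> 'b) \<Rightarrow> bool" where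
  "nat_iso C D F G \<alpha> \<longleftrightarrow> nat_trans C D F G \<alpha> \<and> (\<forall>x \<in> Ob C. is_iso D (\<alpha> x))"

definition id_trans :: "('o, 'a, 'z) category_scheme \<Rightarrow> 'o \<Rightarrow> 'a" where
  "id_trans C = (\<lambda>x \<in> Ob C. Ident C x)"

text \<open>The whiskerings \<open>\<gamma>c\<close> and \<open>k\<gamma>\<close>.\<close>

definition whisker_right ::
  "('o, 'a, 'z) category_scheme \<Rightarrow> ('p \<Rightarrow> 'c) \<Rightarrow> ('o, 'a, 'p, 'b) functor_data \<Rightarrow> 'o \<Rightarrow> 'c" where
  "whisker_right B \<gamma> c = (\<lambda>x \<in> Ob B. \<gamma> (fob c x))"

definition whisker_left ::
  "('o, 'a, 'z) category_scheme \<Rightarrow> ('p, 'b, 'q, 'c) functor_data \<Rightarrow> ('o \<Rightarrow> 'b) \<Rightarrow> 'o \<Rightarrow> 'c" where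
  "whisker_left X k \<gamma> = (\<lambda>x \<in> Ob X. far k (\<gamma> x))"

definition right_adjoint_with_counit ::
  "('o, 'a, 'y) category_scheme \<Rightarrow> ('p, 'b, 'z) category_scheme \<Rightarrow> ('o, 'a, 'p, 'b) functor_data
    \<Rightarrow> ('p, 'b, 'o, 'a) functor_data \<Rightarrow> ('p \<Rightarrow> 'b) \<Rightarrow> bool" where
  "right_adjoint_with_counit G H E R \<epsilon> \<longleftrightarrow>
     nat_trans H H (E \<odot> R) id_functor \<epsilon> \<and>
     (\<exists>\<eta>. nat_trans G G id_functor (R \<odot> E) \<eta>
        \<and> (\<forall>x \<in> Ob G. \<epsilon> (fob E x) \<cdot>\<^bsub>H\<^esub> far E (\<eta> x) = Ident H (fob E x))
        \<and> (\<forall>y \<in> Ob H. far R (\<epsilon> y) \<cdot>\<^bsub>G\<^esub> \<eta> (fob R y) = Ident G (fob R y)))"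


section \<open>Finite limits\<close>

definition is_terminal :: "('o, 'a, 'z) category_scheme \<Rightarrow> 'o \<Rightarrow> bool" where
  "is_terminal C t \<longleftrightarrow> t \<in> Ob C \<and> (\<forall>x \<in> Ob C. \<exists>!f. f \<in> hom C x t)"

definition is_initial :: "('o, 'a, 'z) category_scheme \<Rightarrow> 'o \<Rightarrow> bool" where
  "is_initial C i \<longleftrightarrow> i \<in> Ob C \<and> (\<forall>x \<in> Ob C. \<exists>!f. f \<in> hom C i x)"

definition is_cone ::
  "('j, 'k, 'y) category_scheme \<Rightarrow> ('o, 'a, 'z) category_scheme \<Rightarrow> ('j, 'k, 'o, 'a) functor_data
    \<Rightarrow> 'o \<Rightarrow> ('j \<Rightarrow> 'a) \<Rightarrow> bool" where
  "is_cone J C D v p \<longleftrightarrow> v \<in> Ob C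
     \<and> (\<forall>j \<in> Ob J. p j \<in> hom C v (fob D j))
     \<and> (\<forall>i j. \<forall>u \<in> hom J i j. far D u \<cdot>\<^bsub>C\<^esub> p i = p j)"

definition is_limit ::
  "('j, 'k, 'y) category_scheme \<Rightarrow> ('o, 'a, 'z) category_scheme \<Rightarrow> ('j, 'k, 'o, 'a) functor_data
    \<Rightarrow> 'o \<Rightarrow> ('j \<Rightarrow> 'a) \<Rightarrow> bool" where
  "is_limit J C D v p \<longleftrightarrow> is_cone J C D v p
     \<and> (\<forall>w q. is_cone J C D w q \<longrightarrow>
          (\<exists>!f. f \<in> hom C w v \<and> (\<forall>j \<in> Ob J. p j \<cdot>\<^bsub>C\<^esub> f = q j)))"

text \<open>Every finite category is isomorphic to one whose objects and arrows are natural numbers,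
  so index categories can be taken on a fixed type.\<close>

definition finite_diagram ::
  "(nat, nat) category \<Rightarrow> ('o, 'a, 'z) category_scheme \<Rightarrow> (nat, nat, 'o, 'a) functor_data \<Rightarrow> bool" where
  "finite_diagram J C D \<longleftrightarrow> finite (Ob J) \<and> finite (Ar J) \<and> is_functor J C D"

definition has_finite_limits :: "('o, 'a, 'z) category_scheme \<Rightarrow> bool" where
  "has_finite_limits C \<longleftrightarrow> (\<forall>J D. finite_diagram J C D \<longrightarrow> (\<exists>v p. is_limit J C D v p))"

definition preserves_finite_limits ::
  "('o, 'a, 'y) category_scheme \<Rightarrow> ('p, 'b, 'z) category_scheme \<Rightarrow> ('o, 'a, 'p, 'b) functor_data \<Rightarrow> bool"
  where
  "preserves_finite_limits C C' F \<longleftrightarrow>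
     (\<forall>J D v p. finite_diagram J C D \<longrightarrow> is_limit J C D v p
        \<longrightarrow> is_limit J C' (F \<odot> D) (fob F v) (\<lambda>j. far F (p j)))"

definition lex_functor ::
  "('o, 'a, 'y) category_scheme \<Rightarrow> ('p, 'b, 'z) category_scheme \<Rightarrow> ('o, 'a, 'p, 'b) functor_data \<Rightarrow> bool"
  where
  "lex_functor C D F \<longleftrightarrow> is_functor C D F \<and> preserves_finite_limits C D F"


section \<open>Elementary toposes\<close>

definition is_product :: "('o, 'a, 'z) category_scheme \<Rightarrow> 'o \<Rightarrow> 'o \<Rightarrow> 'o \<Rightarrow> 'a \<Rightarrow> 'a \<Rightarrow> bool" where
  "is_product C x y v p q \<longleftrightarrow> v \<in> Ob C \<and> p \<in> hom C v x \<and> q \<in> hom C v y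
     \<and> (\<forall>w. \<forall>f \<in> hom C w x. \<forall>g \<in> hom C w y.
          \<exists>!u. u \<in> hom C w v \<and> p \<cdot>\<^bsub>C\<^esub> u = f \<and> q \<cdot>\<^bsub>C\<^esub> u = g)"

text \<open>The object \<open>e\<close> with evaluation \<open>ev : e \<times> x \<rightarrow> y\<close> is the exponential of \<open>y\<close> by \<open>x\<close>. Here
  \<open>(v, p, q)\<close> is the product \<open>e \<times> x\<close>, and \<open>u\<close> is the arrow \<open>h \<times> x : c \<times> x \<rightarrow> e \<times> x\<close>.\<close>

definition is_exponential ::
  "('o, 'a, 'z) category_scheme \<Rightarrow> 'o \<Rightarrow> 'o \<Rightarrow> 'o \<Rightarrow> 'o \<Rightarrow> 'a \<Rightarrow> 'a \<Rightarrow> 'a \<Rightarrow> bool" where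
  "is_exponential C x y e v p q ev \<longleftrightarrow> e \<in> Ob C \<and> is_product C e x v p q \<and> ev \<in> hom C v y
     \<and> (\<forall>c w r s. c \<in> Ob C \<longrightarrow> is_product C c x w r s \<longrightarrow> (\<forall>g \<in> hom C w y.
          \<exists>!h. h \<in> hom C c e \<and>
            (\<exists>u \<in> hom C w v. p \<cdot>\<^bsub>C\<^esub> u = h \<cdot>\<^bsub>C\<^esub> r \<and> q \<cdot>\<^bsub>C\<^esub> u = s \<and> ev \<cdot>\<^bsub>C\<^esub> u = g)))"

definition is_mono :: "('o, 'a, 'z) category_scheme \<Rightarrow> 'a \<Rightarrow> bool" where
  "is_mono C m \<longleftrightarrow> m \<in> Ar C
     \<and> (\<forall>w. \<forall>f \<in> hom C w (Dom C m). \<forall>g \<in> hom C w (Dom C m). m \<cdot>\<^bsub>C\<^esub> f = m \<cdot>\<^bsub>C\<^esub> g \<longrightarrow> f = g)"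

definition is_pullback :: "('o, 'a, 'z) category_scheme \<Rightarrow> 'a \<Rightarrow> 'a \<Rightarrow> 'a \<Rightarrow> 'a \<Rightarrow> bool" where
  "is_pullback C f g p q \<longleftrightarrow>
     (\<exists>x y z v. f \<in> hom C x z \<and> g \<in> hom C y z \<and> p \<in> hom C v x \<and> q \<in> hom C v y
        \<and> f \<cdot>\<^bsub>C\<^esub> p = g \<cdot>\<^bsub>C\<^esub> q
        \<and> (\<forall>w. \<forall>p' \<in> hom C w x. \<forall>q' \<in> hom C w y. f \<cdot>\<^bsub>C\<^esub> p' = g \<cdot>\<^bsub>C\<^esub> q' \<longrightarrow>
             (\<exists>!u. u \<in> hom C w v \<and> p \<cdot>\<^bsub>C\<^esub> u = p' \<and> q \<cdot>\<^bsub>C\<^esub> u = q')))"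

definition is_subobject_classifier ::
  "('o, 'a, 'z) category_scheme \<Rightarrow> 'o \<Rightarrow> 'o \<Rightarrow> 'a \<Rightarrow> bool" where
  "is_subobject_classifier C t \<Omega> \<tau> \<longleftrightarrow> is_terminal C t \<and> \<Omega> \<in> Ob C \<and> \<tau> \<in> hom C t \<Omega>
     \<and> (\<forall>m. is_mono C m \<longrightarrow>
          (\<exists>!\<chi>. \<chi> \<in> hom C (Cod C m) \<Omega> \<and> (\<exists>k. is_pullback C \<chi> \<tau> m k)))"

record ('o, 'a) topos = "('o, 'a) category" +
  One :: 'o
  Zero :: 'o

locale topos = category T for T :: "('o, 'a, 'z) topos_scheme" (structure) +
  assumes finite_limits: "has_finite_limits T"
    and One_terminal: "is_terminal T (One T)"
    and Zero_initial: "is_initial T (Zero T)"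
    and exponentials: "x \<in> Ob T \<Longrightarrow> y \<in> Ob T \<Longrightarrow> \<exists>e v p q ev. is_exponential T x y e v p q ev"
    and subobject_classifier: "\<exists>\<Omega> \<tau>. is_subobject_classifier T (One T) \<Omega> \<tau>"


section \<open>Adjoint split extensions\<close>

definition top_lex ::
  "('o, 'a, 'y) topos_scheme \<Rightarrow> ('p, 'b, 'z) topos_scheme \<Rightarrow> ('o, 'a, 'p, 'b) functor_data \<Rightarrow> bool" where
  "top_lex A B f \<longleftrightarrow> topos A \<and> topos B \<and> lex_functor A B f"

definition is_zero ::
  "('o, 'a, 'y) topos_scheme \<Rightarrow> ('p, 'b, 'z) topos_scheme \<Rightarrow> ('o, 'a, 'p, 'b) functor_data \<Rightarrow> bool" where
  "is_zero A B f \<longleftrightarrow> top_lex A B f \<and> (\<forall>x \<in> Ob A. is_terminal B (fob f x))"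

text \<open>In the two universal properties \<open>X\<close> ranges over all toposes with objects in \<open>'xo\<close> and arrows
  in \<open>'xa\<close>. As HOL has no quantification over types within a formula, these types are recorded by an
  \<open>itself\<close> argument; being type variables of a theorem, they are then universally quantified.\<close>

definition is_2cokernel ::
  "('xo, 'xa) topos itself
    \<Rightarrow> ('o, 'a) topos \<Rightarrow> ('p, 'b) topos \<Rightarrow> ('q, 'c) topos
    \<Rightarrow> ('o, 'a, 'p, 'b) functor_data \<Rightarrow> ('p, 'b, 'q, 'c) functor_data \<Rightarrow> bool" where
  "is_2cokernel _ A B C f c \<longleftrightarrow> top_lex A B f \<and> top_lex B C c \<and> is_zero A C (c \<odot> f)
     \<and> (\<forall>(X :: ('xo, 'xa) topos) t. top_lex B X t \<longrightarrow> is_zero A X (t \<odot> f) \<longrightarrow>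
          (\<exists>h \<alpha>. top_lex C X h \<and> nat_iso B X t (h \<odot> c) \<alpha>))
     \<and> (\<forall>(X :: ('xo, 'xa) topos) h h' \<alpha>. top_lex C X h \<longrightarrow> top_lex C X h' \<longrightarrow>
          nat_trans B X (h \<odot> c) (h' \<odot> c) \<alpha> \<longrightarrow>
          (\<exists>!\<gamma>. nat_trans C X h h' \<gamma> \<and> whisker_right B \<gamma> c = \<alpha>))"

definition is_2kernel ::
  "('xo, 'xa) topos itself
    \<Rightarrow> ('o, 'a) topos \<Rightarrow> ('p, 'b) topos \<Rightarrow> ('q, 'c) topos
    \<Rightarrow> ('o, 'a, 'p, 'b) functor_data \<Rightarrow> ('p, 'b, 'q, 'c) functor_data \<Rightarrow> bool" where
  "is_2kernel _ A B C k f \<longleftrightarrow> top_lex A B k \<and> top_lex B C f \<and> is_zero A C (f \<odot> k)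
     \<and> (\<forall>(X :: ('xo, 'xa) topos) t. top_lex X B t \<longrightarrow> is_zero X C (f \<odot> t) \<longrightarrow>
          (\<exists>h \<alpha>. top_lex X A h \<and> nat_iso X B t (k \<odot> h) \<alpha>))
     \<and> (\<forall>(X :: ('xo, 'xa) topos) h h' \<alpha>. top_lex X A h \<longrightarrow> top_lex X A h' \<longrightarrow>
          nat_trans X B (k \<odot> h) (k \<odot> h') \<alpha> \<longrightarrow>
          (\<exists>!\<gamma>. nat_trans X A h h' \<gamma> \<and> whisker_left X k \<gamma> = \<alpha>))"

definition adjoint_split_extension ::
  "('xo, 'xa) topos itself
    \<Rightarrow> ('o, 'a) topos \<Rightarrow> ('p, 'b) topos \<Rightarrow> ('q, 'c) topos
    \<Rightarrow> ('o, 'a, 'p, 'b) functor_data \<Rightarrow> ('p, 'b, 'q, 'c) functor_data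
    \<Rightarrow> ('q, 'c, 'p, 'b) functor_data \<Rightarrow> ('q \<Rightarrow> 'c) \<Rightarrow> bool" where
  "adjoint_split_extension U N G H K E R \<epsilon> \<longleftrightarrow>
     top_lex N G K \<and> top_lex G H E \<and> top_lex H G R
     \<and> nat_iso H H (E \<odot> R) id_functor \<epsilon>
     \<and> is_2kernel U N G H K E
     \<and> is_2cokernel U N G H K E
     \<and> right_adjoint_with_counit G H E R \<epsilon>"


section \<open>Artin gluing\<close>

type_synonym ('no, 'na, 'ho) gl_ob = "'no \<times> 'ho \<times> 'na"

text \<open>A morphism \<open>(f, g)\<close> of the gluing carries its source and target, since \<open>f\<close> and \<open>g\<close> do
  not determine the third components of these.\<close>

type_synonym ('no, 'na, 'ho, 'ha) gl_ar =
  "('no, 'na, 'ho) gl_ob \<times> ('no, 'na, 'ho) gl_ob \<times> 'na \<times> 'ha"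

definition the_arrow :: "('o, 'a, 'z) category_scheme \<Rightarrow> 'o \<Rightarrow> 'o \<Rightarrow> 'a" where
  "the_arrow C x y = (THE f. f \<in> hom C x y)"

definition Gl_Ob ::
  "('no, 'na) topos \<Rightarrow> ('ho, 'ha) topos \<Rightarrow> ('ho, 'ha, 'no, 'na) functor_data
    \<Rightarrow> ('no, 'na, 'ho) gl_ob set" where
  "Gl_Ob N H F = {(n, h, l). n \<in> Ob N \<and> h \<in> Ob H \<and> l \<in> hom N n (fob F h)}"

definition Gl_Ar ::
  "('no, 'na) topos \<Rightarrow> ('ho, 'ha) topos \<Rightarrow> ('ho, 'ha, 'no, 'na) functor_data
    \<Rightarrow> ('no, 'na, 'ho, 'ha) gl_ar set" where
  "Gl_Ar N H F = {((n, h, l), (n', h', l'), f, g).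
     (n, h, l) \<in> Gl_Ob N H F \<and> (n', h', l') \<in> Gl_Ob N H F
     \<and> f \<in> hom N n n' \<and> g \<in> hom H h h' \<and> l' \<cdot>\<^bsub>N\<^esub> f = far F g \<cdot>\<^bsub>N\<^esub> l}"

definition Gl ::
  "('no, 'na) topos \<Rightarrow> ('ho, 'ha) topos \<Rightarrow> ('ho, 'ha, 'no, 'na) functor_data
    \<Rightarrow> (('no, 'na, 'ho) gl_ob, ('no, 'na, 'ho, 'ha) gl_ar) topos" where
  "Gl N H F = \<lparr>
     Ob = Gl_Ob N H F,
     Ar = Gl_Ar N H F,
     Dom = (\<lambda>(a, b, f, g). a),
     Cod = (\<lambda>(a, b, f, g). b),
     Ident = (\<lambda>(n, h, l). ((n, h, l), (n, h, l), Ident N n, Ident H h)),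
     Comp = (\<lambda>(b', c, f', g') (a, b, f, g). (a, c, f' \<cdot>\<^bsub>N\<^esub> f, g' \<cdot>\<^bsub>H\<^esub> g)),
     One = (One N, One H, the_arrow N (One N) (fob F (One H))),
     Zero = (Zero N, Zero H, the_arrow N (Zero N) (fob F (Zero H))) \<rparr>"

definition pi2 ::
  "(('no, 'na, 'ho) gl_ob, ('no, 'na, 'ho, 'ha) gl_ar, 'ho, 'ha) functor_data" where
  "pi2 = \<lparr> fob = (\<lambda>(n, h, l). h), far = (\<lambda>(a, b, f, g). g) \<rparr>"

definition pi1_star_ob ::
  "('no, 'na) topos \<Rightarrow> ('ho, 'ha) topos \<Rightarrow> ('ho, 'ha, 'no, 'na) functor_data
    \<Rightarrow> 'no \<Rightarrow> ('no, 'na, 'ho) gl_ob" where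
  "pi1_star_ob N H F n = (n, One H, the_arrow N n (fob F (One H)))"

definition pi1_star ::
  "('no, 'na) topos \<Rightarrow> ('ho, 'ha) topos \<Rightarrow> ('ho, 'ha, 'no, 'na) functor_data
    \<Rightarrow> ('no, 'na, ('no, 'na, 'ho) gl_ob, ('no, 'na, 'ho, 'ha) gl_ar) functor_data" where
  "pi1_star N H F = \<lparr>
     fob = pi1_star_ob N H F,
     far = (\<lambda>f. (pi1_star_ob N H F (Dom N f), pi1_star_ob N H F (Cod N f), f, Ident H (One H))) \<rparr>"

definition pi2_star_ob ::
  "('no, 'na) topos \<Rightarrow> ('ho, 'ha, 'no, 'na) functor_data
    \<Rightarrow> 'ho \<Rightarrow> ('no, 'na, 'ho) gl_ob" where
  "pi2_star_ob N F h = (fob F h, h, Ident N (fob F h))"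

definition pi2_star ::
  "('no, 'na) topos \<Rightarrow> ('ho, 'ha) topos \<Rightarrow> ('ho, 'ha, 'no, 'na) functor_data
    \<Rightarrow> ('ho, 'ha, ('no, 'na, 'ho) gl_ob, ('no, 'na, 'ho, 'ha) gl_ar) functor_data" where
  "pi2_star N H F = \<lparr>
     fob = pi2_star_ob N F,
     far = (\<lambda>g. (pi2_star_ob N F (Dom H g), pi2_star_ob N F (Cod H g), far F g, g)) \<rparr>"

end

theory Submission imports Defs begin

text \<open>
  Finite limits in \<open>Gl(F)\<close> are computed componentwise, because \<open>F\<close> preserves them; this makes
  \<open>\<pi>\<^sub>1\<close>, \<open>\<pi>\<^sub>2\<close>, \<open>\<pi>\<^sub>1\<^sub>*\<close> and \<open>\<pi>\<^sub>2\<^sub>*\<close> preserve finite limits. Exponentials and the subobject classifier of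
  \<open>Gl(F)\<close> have those of \<open>H\<close> as second component, and a pullback, respectively an equalizer, as first.
  A functor \<open>t\<close> into \<open>Gl(F)\<close> with \<open>\<pi>\<^sub>2 t\<close> zero factors as \<open>\<pi>\<^sub>1\<^sub>* (\<pi>\<^sub>1 t)\<close>. For \<open>t\<close> out of \<open>Gl(F)\<close>
  with \<open>t \<pi>\<^sub>1\<^sub>*\<close> zero, the unit \<open>(N, H, \<ell>) \<rightarrow> \<pi>\<^sub>2\<^sub>* H\<close> is a pullback of
  \<open>\<pi>\<^sub>1\<^sub>* \<ell>\<close>, which \<open>t\<close> sends to an arrow between terminal objects; so \<open>t\<close> inverts the unit and
  factors as \<open>(t \<pi>\<^sub>2\<^sub>*) \<pi>\<^sub>2\<close>.
\<close>

section \<open>Arrows, functors and isomorphisms\<close>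

text \<open>The obstacle is that \<open>F\<close> preserves products, pullbacks and monos, but in
  general neither exponentials nor the object of truth values, so data of \<open>H\<close> seen
  through \<open>F\<close> must be matched with data of \<open>N\<close>. An arrow from a product
  \<open>d \<times> x\<close> to \<open>y\<close> is a pair of arrows whose transposes agree in
  \<open>F(h')^n\<close>; this agreement is the pullback. A subobject of \<open>(n, h, l)\<close>
  amounts to a subobject of \<open>n\<close> and one of \<open>h\<close> such that \<open>l\<close>
  sends the first into \<open>F\<close> of the second; this condition is an implication between
  truth values and gives the equalizer. Since products are not chosen, the universal properties are
  restated on generalized elements (\<open>is_application\<close>, \<open>factors\<close>), where
  they can be treated componentwise and carried along \<open>F\<close>. Uniqueness of characteristic
  arrows needs test objects that isolate one component. For 2-cells, the kernel property is full
  faithfulness of \<open>K\<close>; the cokernel property rests on \<open>pi2\<close> after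
  \<open>R\<close> being the identity and on the unit having an identity as its
  \<open>H\<close>-component.\<close>

lemma homI: "f \<in> Ar C \<Longrightarrow> Dom C f = x \<Longrightarrow> Cod C f = y \<Longrightarrow> f \<in> hom C x y"
  by (simp add: hom_def)

lemma homD:
  assumes "f \<in> hom C x y"
  shows "f \<in> Ar C" "Dom C f = x" "Cod C f = y"
  using assms by (simp_all add: hom_def)

context category
begin

lemma Dom_Ob [simp]: "f \<in> Ar C \<Longrightarrow> Dom C f \<in> Ob C"
  and Cod_Ob [simp]: "f \<in> Ar C \<Longrightarrow> Cod C f \<in> Ob C"
  by (fact Dom_closed Cod_closed)+

lemma hom_Ob:
  assumes "f \<in> hom C x y"
  shows "x \<in> Ob C" "y \<in> Ob C"
  using assms Dom_Ob Cod_Ob by (auto simp: hom_def)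

lemma Ident_simps [simp]:
  assumes "x \<in> Ob C"
  shows "Ident C x \<in> Ar C" "Dom C (Ident C x) = x" "Cod C (Ident C x) = x"
  using Ident_hom[OF assms] by (auto simp: hom_def)

text \<open>Composability as an equation between \<open>Dom\<close> and \<open>Cod\<close> can be
  discharged by simp; the axioms phrased with \<open>hom\<close> have objects that occur only in the
  premises.\<close>

lemma Comp_simps [simp]:
  assumes "f \<in> Ar C" "g \<in> Ar C" "Dom C g = Cod C f"
  shows "g \<cdot> f \<in> Ar C" "Dom C (g \<cdot> f) = Dom C f" "Cod C (g \<cdot> f) = Cod C g"
  using Comp_hom[of f "Dom C f" "Cod C f" g "Cod C g"] assms by (auto simp: hom_def)

lemma Comp_Ident_left [simp]: "f \<in> Ar C \<Longrightarrow> Cod C f = x \<Longrightarrow> Ident C x \<cdot> f = f"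
  using Ident_Comp[of f "Dom C f" x] by (auto simp: hom_def)

lemma Comp_Ident_right [simp]: "f \<in> Ar C \<Longrightarrow> Dom C f = x \<Longrightarrow> f \<cdot> Ident C x = f"
  using Comp_Ident[of f x "Cod C f"] by (auto simp: hom_def)

lemma assoc [simp]:
  "f \<in> Ar C \<Longrightarrow> g \<in> Ar C \<Longrightarrow> h \<in> Ar C \<Longrightarrow> Dom C g = Cod C f \<Longrightarrow> Dom C h = Cod C g
    \<Longrightarrow> (h \<cdot> g) \<cdot> f = h \<cdot> (g \<cdot> f)"
  using Comp_assoc[of f "Dom C f" "Cod C f" g "Cod C g" h "Cod C h"] by (auto simp: hom_def)

lemma terminal_unique: "is_terminal C t \<Longrightarrow> f \<in> hom C x t \<Longrightarrow> g \<in> hom C x t \<Longrightarrow> f = g"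
  using hom_Ob(1) unfolding is_terminal_def by blast

lemma initial_unique: "is_initial C t \<Longrightarrow> f \<in> hom C t x \<Longrightarrow> g \<in> hom C t x \<Longrightarrow> f = g"
  using hom_Ob(2) unfolding is_initial_def by blast

lemma terminal_arrow: "is_terminal C t \<Longrightarrow> x \<in> Ob C \<Longrightarrow> the_arrow C x t \<in> hom C x t"
  unfolding is_terminal_def the_arrow_def by (metis theI)

lemma initial_arrow: "is_initial C t \<Longrightarrow> x \<in> Ob C \<Longrightarrow> the_arrow C t x \<in> hom C t x"
  unfolding is_initial_def the_arrow_def by (metis theI)

lemma terminal_arrow_iso:
  assumes "is_terminal C s" "is_terminal C t" "f \<in> hom C s t"
  shows "is_iso C f"
proof -
  have g: "the_arrow C t s \<in> hom C t s"
    using assms terminal_arrow by (simp add: is_terminal_def)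
  have "the_arrow C t s \<cdot> f = Ident C s" "f \<cdot> the_arrow C t s = Ident C t"
    using assms g hom_Ob[OF assms(3)]
    by (blast intro: terminal_unique Comp_hom Ident_hom)+
  then show ?thesis
    using assms(3) g unfolding is_iso_def by blast
qed

lemma Ident_iso: "x \<in> Ob C \<Longrightarrow> is_iso C (Ident C x)"
  unfolding is_iso_def using Ident_hom Comp_Ident by blast

lemma monoD:
  assumes "is_mono C m" "f \<in> Ar C" "g \<in> Ar C" "Dom C f = Dom C g"
    "Cod C f = Dom C m" "Cod C g = Dom C m" "m \<cdot> f = m \<cdot> g"
  shows "f = g"
  using assms unfolding is_mono_def hom_def by auto

end

section \<open>Functors and their composites\<close>

locale cat_functor = C: category C + D: category D
  for C :: "('o, 'a, 'y) category_scheme" and D :: "('p, 'b, 'z) category_scheme" +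
  fixes F :: "('o, 'a, 'p, 'b) functor_data"
  assumes functoriality: "is_functor C D F"
begin

lemma fob_Ob [simp]: "x \<in> Ob C \<Longrightarrow> fob F x \<in> Ob D"
  using functoriality by (simp add: is_functor_def)

lemma far_hom: "f \<in> hom C x y \<Longrightarrow> far F f \<in> hom D (fob F x) (fob F y)"
  using functoriality by (simp add: is_functor_def)

lemma far_simps [simp]:
  assumes "f \<in> Ar C"
  shows "far F f \<in> Ar D" "Dom D (far F f) = fob F (Dom C f)" "Cod D (far F f) = fob F (Cod C f)"
  using far_hom[of f "Dom C f" "Cod C f"] assms by (auto simp: hom_def)

lemma far_Ident [simp]: "x \<in> Ob C \<Longrightarrow> far F (Ident C x) = Ident D (fob F x)"
  using functoriality by (simp add: is_functor_def)

lemma far_Comp [simp]: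
  assumes "f \<in> Ar C" "g \<in> Ar C" "Dom C g = Cod C f"
  shows "far F (g \<cdot>\<^bsub>C\<^esub> f) = far F g \<cdot>\<^bsub>D\<^esub> far F f"
  using functoriality assms unfolding is_functor_def hom_def by auto

end

lemma functor_iff: "cat_functor C D F \<longleftrightarrow> is_functor C D F"
  by (auto simp: cat_functor_def cat_functor_axioms_def is_functor_def)

lemma fob_comp [simp]: "fob (G \<odot> F) x = fob G (fob F x)"
  and far_comp [simp]: "far (G \<odot> F) f = far G (far F f)"
  by (simp_all add: comp_functor_def)

lemma fob_id [simp]: "fob id_functor x = x"
  and far_id [simp]: "far id_functor f = f"
  by (simp_all add: id_functor_def)

lemma comp_functor_assoc: "(K \<odot> G) \<odot> F = K \<odot> (G \<odot> F)"
  by (simp add: comp_functor_def)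

lemma is_functorI:
  assumes "category C" "category D" "\<And>x. x \<in> Ob C \<Longrightarrow> fob F x \<in> Ob D"
    "\<And>f. f \<in> Ar C \<Longrightarrow> far F f \<in> hom D (fob F (Dom C f)) (fob F (Cod C f))"
    "\<And>x. x \<in> Ob C \<Longrightarrow> far F (Ident C x) = Ident D (fob F x)"
    "\<And>f g. f \<in> Ar C \<Longrightarrow> g \<in> Ar C \<Longrightarrow> Dom C g = Cod C f
      \<Longrightarrow> far F (g \<cdot>\<^bsub>C\<^esub> f) = far F g \<cdot>\<^bsub>D\<^esub> far F f"
  shows "is_functor C D F"
  using assms unfolding is_functor_def by (auto simp: hom_def)

lemma far_Comp_hom:
  assumes "is_functor C D F" "f \<in> hom C x y" "g \<in> hom C y z"
  shows "far F (g \<cdot>\<^bsub>C\<^esub> f) = far F g \<cdot>\<^bsub>D\<^esub> far F f"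
  using assms by (auto simp: is_functor_def)

lemma id_is_functor: "category C \<Longrightarrow> is_functor C C id_functor"
  by (rule is_functorI) (auto simp: hom_def)

lemma is_functor_comp:
  assumes "is_functor B C F" "is_functor C D G"
  shows "is_functor B D (G \<odot> F)"
proof -
  interpret F: cat_functor B C F using assms(1) by (simp add: functor_iff)
  interpret G: cat_functor C D G using assms(2) by (simp add: functor_iff)
  show ?thesis
    by (rule is_functorI) (auto intro: homI F.C.category_axioms G.D.category_axioms)
qed

lemma finite_diagram_comp:
  "finite_diagram J C D \<Longrightarrow> is_functor C C' F \<Longrightarrow> finite_diagram J C' (F \<odot> D)"
  by (auto simp: finite_diagram_def is_functor_comp)

lemma lex_comp:
  assumes "lex_functor B C F" "lex_functor C D G"
  shows "lex_functor B D (G \<odot> F)"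
  unfolding lex_functor_def preserves_finite_limits_def
proof (intro conjI allI impI)
  show "is_functor B D (G \<odot> F)"
    using assms by (auto simp: lex_functor_def intro: is_functor_comp)
  fix J P v p
  assume *: "finite_diagram J B P" "is_limit J B P v p"
  then have "is_limit J C (F \<odot> P) (fob F v) (\<lambda>j. far F (p j))" "finite_diagram J C (F \<odot> P)"
    using assms by (auto simp: lex_functor_def preserves_finite_limits_def intro: finite_diagram_comp)
  then show "is_limit J D ((G \<odot> F) \<odot> P) (fob (G \<odot> F) v) (\<lambda>j. far (G \<odot> F) (p j))"
    using assms by (simp add: lex_functor_def preserves_finite_limits_def comp_functor_assoc)
qed

section \<open>Finite limits\<close>

context category
begin

lemma limit_lift:
  assumes "is_limit J C D v p" "is_cone J C D w q"
  obtains f where "f \<in> hom C w v" "\<And>j. j \<in> Ob J \<Longrightarrow> p j \<cdot> f = q j"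
proof -
  have "\<exists>!f. f \<in> hom C w v \<and> (\<forall>j \<in> Ob J. p j \<cdot> f = q j)"
    using assms by (simp add: is_limit_def)
  then show thesis using that by blast
qed

lemma limit_arrow_unique:
  assumes lim: "is_limit J C D v p" "is_cone J C D w q" and f: "f \<in> hom C w v" "g \<in> hom C w v"
    and q: "\<And>j. j \<in> Ob J \<Longrightarrow> p j \<cdot> f = q j" "\<And>j. j \<in> Ob J \<Longrightarrow> p j \<cdot> g = q j"
  shows "f = g"
proof -
  have "\<exists>!f. f \<in> hom C w v \<and> (\<forall>j \<in> Ob J. p j \<cdot> f = q j)"
    using lim by (simp add: is_limit_def)
  then show ?thesis using f q by blast
qed

lemma limit_iso:
  assumes lim: "is_limit J C D v p"
    and phi: "\<phi> \<in> hom C v' v" "\<psi> \<in> hom C v v'" "\<phi> \<cdot> \<psi> = Ident C v" "\<psi> \<cdot> \<phi> = Ident C v'"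
    and q: "\<And>j. j \<in> Ob J \<Longrightarrow> q j = p j \<cdot> \<phi>"
    and D: "is_functor J C D"
  shows "is_limit J C D v' q"
proof -
  interpret D: cat_functor J C D using D by (simp add: functor_iff)
  have p: "\<And>j. j \<in> Ob J \<Longrightarrow> p j \<in> hom C v (fob D j)"
    and pu: "\<And>i j u. u \<in> hom J i j \<Longrightarrow> far D u \<cdot> p i = p j"
    using lim by (auto simp: is_limit_def is_cone_def)
  have pD: "p j \<in> Ar C" "Dom C (p j) = v" "Cod C (p j) = fob D j" if "j \<in> Ob J" for j
    using homD[OF p[OF that]] by auto
  note ph = homD[OF phi(1)] homD[OF phi(2)]
  have cone: "is_cone J C D v' q"
    unfolding is_cone_def
  proof (intro conjI ballI allI)
    show "v' \<in> Ob C" using hom_Ob phi by blast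
    show "q j \<in> hom C v' (fob D j)" if "j \<in> Ob J" for j
      using q that p phi Comp_hom by metis
    fix i j u assume u: "u \<in> hom J i j"
    then have ij: "i \<in> Ob J" "j \<in> Ob J" using D.C.hom_Ob by auto
    then show "far D u \<cdot> q i = q j"
      using q[OF ij(1)] q[OF ij(2)] pu[OF u] pD[OF ij(1)] ph homD[OF u] assoc[of \<phi> "p i" "far D u"]
      by simp
  qed
  have "\<exists>!f. f \<in> hom C w v' \<and> (\<forall>j \<in> Ob J. q j \<cdot> f = r j)" if r: "is_cone J C D w r" for w r
  proof -
    obtain f where f: "f \<in> hom C w v" "\<forall>j \<in> Ob J. p j \<cdot> f = r j"
      and u: "\<And>f'. f' \<in> hom C w v \<Longrightarrow> \<forall>j \<in> Ob J. p j \<cdot> f' = r j \<Longrightarrow> f' = f"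
      using lim r unfolding is_limit_def by metis
    note fD = homD[OF f(1)]
    show ?thesis
    proof (intro ex1I conjI ballI)
      show "\<psi> \<cdot> f \<in> hom C w v'" using f phi Comp_hom by blast
      show "q j \<cdot> (\<psi> \<cdot> f) = r j" if j: "j \<in> Ob J" for j
      proof -
        have "q j \<cdot> (\<psi> \<cdot> f) = p j \<cdot> ((\<phi> \<cdot> \<psi>) \<cdot> f)"
          using q[OF j] pD[OF j] ph fD by simp
        then show ?thesis using phi(3) fD f(2) j by simp
      qed
      fix g assume g: "g \<in> hom C w v' \<and> (\<forall>j \<in> Ob J. q j \<cdot> g = r j)"
      then have gD: "g \<in> Ar C" "Dom C g = w" "Cod C g = v'" by (auto simp: hom_def)
      have "\<phi> \<cdot> g = f"
      proof (rule u)
        show "\<phi> \<cdot> g \<in> hom C w v" using g phi Comp_hom by blast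
        show "\<forall>j \<in> Ob J. p j \<cdot> (\<phi> \<cdot> g) = r j"
          using g gD pD q ph by (metis assoc)
      qed
      then have "\<psi> \<cdot> f = (\<psi> \<cdot> \<phi>) \<cdot> g" using gD ph by simp
      then show "g = \<psi> \<cdot> f" using phi(4) gD by simp
    qed
  qed
  then show ?thesis using cone by (simp add: is_limit_def)
qed

lemma limit_unique:
  assumes "is_limit J C D v p" "is_limit J C D v' p'"
  obtains \<phi> \<psi> where "\<phi> \<in> hom C v' v" "\<psi> \<in> hom C v v'" "\<phi> \<cdot> \<psi> = Ident C v"
    "\<psi> \<cdot> \<phi> = Ident C v'" "\<And>j. j \<in> Ob J \<Longrightarrow> p' j = p j \<cdot> \<phi>"
proof -
  have c: "is_cone J C D v p" "is_cone J C D v' p'" using assms by (auto simp: is_limit_def)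
  have v: "v \<in> Ob C" "v' \<in> Ob C" using c by (auto simp: is_cone_def)
  obtain \<phi> where a: "\<phi> \<in> hom C v' v" "\<forall>j \<in> Ob J. p j \<cdot> \<phi> = p' j"
    using assms(1) c(2) unfolding is_limit_def by metis
  obtain \<psi> where b: "\<psi> \<in> hom C v v'" "\<forall>j \<in> Ob J. p' j \<cdot> \<psi> = p j"
    using assms(2) c(1) unfolding is_limit_def by metis
  have pD: "p j \<in> hom C v (fob D j)" "p' j \<in> hom C v' (fob D j)" if "j \<in> Ob J" for j
    using c that by (auto simp: is_cone_def)
  have "\<phi> \<cdot> \<psi> = Ident C v"
  proof -
    have "\<forall>j \<in> Ob J. p j \<cdot> (\<phi> \<cdot> \<psi>) = p j" using a(2) b(2) Comp_assoc[OF b(1) a(1) pD(1)] by metis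
    moreover have "\<forall>j \<in> Ob J. p j \<cdot> Ident C v = p j" using pD Comp_Ident by blast
    ultimately show ?thesis
      using assms(1) c(1) v Comp_hom[OF b(1) a(1)] Ident_hom[OF v(1)] unfolding is_limit_def by metis
  qed
  moreover have "\<psi> \<cdot> \<phi> = Ident C v'"
  proof -
    have "\<forall>j \<in> Ob J. p' j \<cdot> (\<psi> \<cdot> \<phi>) = p' j" using a(2) b(2) Comp_assoc[OF a(1) b(1) pD(2)] by metis
    moreover have "\<forall>j \<in> Ob J. p' j \<cdot> Ident C v' = p' j" using pD Comp_Ident by blast
    ultimately show ?thesis
      using assms(2) c(2) v Comp_hom[OF a(1) b(1)] Ident_hom[OF v(2)] unfolding is_limit_def by metis
  qed
  ultimately show thesis using a b that by metis
qed

end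

text \<open>Two limits of one diagram differ by an isomorphism compatible with the legs, and
  \<open>F\<close> keeps it an isomorphism. Preservation thus has to be checked on a single limit
  per diagram; for the gluing this is the one built componentwise.\<close>

lemma (in cat_functor) preserves_limit_from_one:
  assumes D: "is_functor J C D'" and lim: "is_limit J C D' v p" "is_limit J C D' v' p'"
    and im: "is_limit J D (F \<odot> D') (fob F v) (\<lambda>j. far F (p j))"
  shows "is_limit J D (F \<odot> D') (fob F v') (\<lambda>j. far F (p' j))"
proof -
  obtain \<phi> \<psi> where iso: "\<phi> \<in> hom C v' v" "\<psi> \<in> hom C v v'" "\<phi> \<cdot>\<^bsub>C\<^esub> \<psi> = Ident C v"
      "\<psi> \<cdot>\<^bsub>C\<^esub> \<phi> = Ident C v'" "\<And>j. j \<in> Ob J \<Longrightarrow> p' j = p j \<cdot>\<^bsub>C\<^esub> \<phi>"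
    using C.limit_unique[OF lim] by metis
  have p: "\<And>j. j \<in> Ob J \<Longrightarrow> p j \<in> hom C v (fob D' j)"
    using lim by (auto simp: is_limit_def is_cone_def)
  show ?thesis
  proof (rule D.limit_iso[OF im])
    show "far F \<phi> \<in> hom D (fob F v') (fob F v)" "far F \<psi> \<in> hom D (fob F v) (fob F v')"
      using iso far_hom by auto
    show "far F \<phi> \<cdot>\<^bsub>D\<^esub> far F \<psi> = Ident D (fob F v)" "far F \<psi> \<cdot>\<^bsub>D\<^esub> far F \<phi> = Ident D (fob F v')"
      using iso(1-4) C.hom_Ob[OF iso(1)] far_Comp[of \<phi> \<psi>] far_Comp[of \<psi> \<phi>] by (auto simp: hom_def)
    show "far F (p' j) = far F (p j) \<cdot>\<^bsub>D\<^esub> far F \<phi>" if "j \<in> Ob J" for j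
      using iso(1) iso(5)[OF that] p[OF that] by (auto simp: hom_def)
    show "is_functor J D (F \<odot> D')" using D functoriality is_functor_comp by blast
  qed
qed

section \<open>Terminal objects and pullbacks as finite limits\<close>

definition empty_category :: "(nat, nat) category" where
  "empty_category = \<lparr> Ob = {}, Ar = {}, Dom = id, Cod = id, Ident = id, Comp = (\<lambda>g f. f) \<rparr>"

text \<open>A cone over the empty diagram is a bare object; this is how
  \<open>preserves_finite_limits\<close> speaks about terminal objects.\<close>

lemma limit_empty_iff: "is_limit empty_category C D v p \<longleftrightarrow> is_terminal C v"
  by (auto simp: is_limit_def is_cone_def empty_category_def is_terminal_def hom_def)

lemma finite_diagram_empty: "category C \<Longrightarrow> finite_diagram empty_category C D"
  by (auto simp: finite_diagram_def is_functor_def empty_category_def hom_def category_def)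

lemma lex_terminal: "lex_functor C D F \<Longrightarrow> is_terminal C t \<Longrightarrow> is_terminal D (fob F t)"
  unfolding lex_functor_def preserves_finite_limits_def
  by (metis finite_diagram_empty is_functor_def limit_empty_iff)

text \<open>The shape \<open>0 \<rightarrow> 2 \<leftarrow> 1\<close>: its arrows are the identities \<open>0, 1, 2\<close> and \<open>3 : 0 \<rightarrow> 2\<close>,
  \<open>4 : 1 \<rightarrow> 2\<close>.\<close>

definition cospan_category :: "(nat, nat) category" where
  "cospan_category = \<lparr> Ob = {0, 1, 2}, Ar = {0, 1, 2, 3, 4},
     Dom = (\<lambda>k. if k = 3 then 0 else if k = 4 then 1 else k),
     Cod = (\<lambda>k. if k \<ge> 3 then 2 else k),
     Ident = (\<lambda>k. k), Comp = (\<lambda>g f. if f < 3 then g else f) \<rparr>"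

text \<open>The objects are read off from \<open>f\<close> and \<open>g\<close>, and the values are
  fixed on all natural numbers, so that \<open>F \<odot> cospan C f g\<close> and
  \<open>cospan D (far F f) (far F g)\<close> are equal as records in
  \<open>lex_pullback\<close>.\<close>

definition cospan :: "('o, 'a, 'z) category_scheme \<Rightarrow> 'a \<Rightarrow> 'a \<Rightarrow> (nat, nat, 'o, 'a) functor_data" where
  "cospan C f g = (let o' = (\<lambda>k. if k = 0 then Dom C f else if k = 1 then Dom C g else Cod C f) in
     \<lparr> fob = o', far = (\<lambda>k. if k = 3 then f else if k = 4 then g else Ident C (o' k)) \<rparr>)"

lemma category_cospan: "category cospan_category"
  by unfold_locales (auto simp: cospan_category_def hom_def)

context category
begin

lemma finite_diagram_cospan:
  assumes "f \<in> hom C x z" "g \<in> hom C y z"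
  shows "finite_diagram cospan_category C (cospan C f g)"
proof -
  have "is_functor cospan_category C (cospan C f g)"
    by (rule is_functorI[OF category_cospan category_axioms])
      (use assms in \<open>auto simp: hom_def cospan_def cospan_category_def\<close>)
  then show ?thesis by (simp add: finite_diagram_def cospan_category_def)
qed

lemma cone_cospan_iff:
  assumes "f \<in> hom C x z" "g \<in> hom C y z"
  shows "is_cone cospan_category C (cospan C f g) v p \<longleftrightarrow>
    p 0 \<in> hom C v x \<and> p 1 \<in> hom C v y \<and> f \<cdot> p 0 = p 2 \<and> g \<cdot> p 1 = p 2" (is "?L \<longleftrightarrow> ?R")
proof
  assume L: ?L
  have "3 \<in> hom cospan_category 0 2" "4 \<in> hom cospan_category 1 2"
    by (auto simp: cospan_category_def hom_def)
  then have "far (cospan C f g) 3 \<cdot> p 0 = p 2" "far (cospan C f g) 4 \<cdot> p 1 = p 2"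
    using L unfolding is_cone_def by metis+
  moreover have "p 0 \<in> hom C v (fob (cospan C f g) 0)" "p 1 \<in> hom C v (fob (cospan C f g) 1)"
    using L by (auto simp: is_cone_def cospan_category_def)
  ultimately show ?R using assms by (auto simp: hom_def cospan_def)
next
  assume R: ?R
  have v: "v \<in> Ob C" using R hom_Ob by blast
  have p2: "p 2 \<in> hom C v z" using R assms Comp_hom by metis
  show ?L unfolding is_cone_def
  proof (intro conjI ballI allI)
    show "p j \<in> hom C v (fob (cospan C f g) j)" if "j \<in> Ob cospan_category" for j
      using that R p2 assms by (auto simp: cospan_category_def cospan_def hom_def)
    fix i j u assume "u \<in> hom cospan_category i j"
    then have "(u = 3 \<and> i = 0 \<and> j = 2) \<or> (u = 4 \<and> i = 1 \<and> j = 2) \<or> (u = i \<and> j = i \<and> u \<in> {0,1,2})"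
      by (auto simp: cospan_category_def hom_def)
    then show "far (cospan C f g) u \<cdot> p i = p j"
      using R p2 assms by (auto simp: cospan_def hom_def)
  qed (fact v)
qed

text \<open>The objects that are existentially quantified in \<open>is_pullback\<close> are the
  sources and targets of the four arrows.\<close>

lemma pullback_iff:
  assumes "f \<in> hom C x z" "g \<in> hom C y z" "p \<in> hom C v x" "q \<in> hom C v y"
  shows "is_pullback C f g p q \<longleftrightarrow> f \<cdot> p = g \<cdot> q
        \<and> (\<forall>w. \<forall>p' \<in> hom C w x. \<forall>q' \<in> hom C w y. f \<cdot> p' = g \<cdot> q' \<longrightarrow>
             (\<exists>!u. u \<in> hom C w v \<and> p \<cdot> u = p' \<and> q \<cdot> u = q'))"
  using assms unfolding is_pullback_def by (auto simp: hom_def)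

lemma pullbackE:
  assumes "is_pullback C f g p q" "f \<in> hom C x z" "g \<in> hom C y z"
  obtains v where "p \<in> hom C v x" "q \<in> hom C v y" "f \<cdot> p = g \<cdot> q"
  using assms unfolding is_pullback_def by (auto simp: hom_def)

lemma pullback_lift:
  assumes "is_pullback C f g p q" "f \<in> hom C x z" "g \<in> hom C y z" "p \<in> hom C v x"
    "p' \<in> hom C w x" "q' \<in> hom C w y" "f \<cdot> p' = g \<cdot> q'"
  obtains u where "u \<in> hom C w v" "p \<cdot> u = p'" "q \<cdot> u = q'"
proof -
  have q: "q \<in> hom C v y" using pullbackE[OF assms(1-3)] assms(4) by (metis homD(2))
  show thesis using assms that unfolding pullback_iff[OF assms(2-4) q] by metis
qed

lemma pullback_unique:
  assumes pb: "is_pullback C f g p q" and fg: "f \<in> hom C x z" "g \<in> hom C y z" "p \<in> hom C v x"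
    and u: "u \<in> hom C w v" "u' \<in> hom C w v" "p \<cdot> u = p \<cdot> u'" "q \<cdot> u = q \<cdot> u'"
  shows "u = u'"
proof -
  have q: "q \<in> hom C v y" using pullbackE[OF pb fg(1,2)] fg(3) by (metis homD(2))
  have c: "f \<cdot> p = g \<cdot> q" using pullbackE[OF pb fg(1,2)] by blast
  have "f \<cdot> (p \<cdot> u) = g \<cdot> (q \<cdot> u)"
    using c Comp_assoc[OF u(1) fg(3) fg(1)] Comp_assoc[OF u(1) q fg(2)] by simp
  moreover have "p \<cdot> u \<in> hom C w x" "q \<cdot> u \<in> hom C w y"
    using Comp_hom u fg q by blast+
  ultimately have "\<exists>!u'. u' \<in> hom C w v \<and> p \<cdot> u' = p \<cdot> u \<and> q \<cdot> u' = q \<cdot> u"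
    using pb unfolding pullback_iff[OF fg q] by blast
  then show ?thesis using u by metis
qed

text \<open>The leg at the vertex 2 is forced to be \<open>f \<cdot> p 0\<close>. A cone is
  therefore a commuting square, and the equation for a lift at 2 follows from the one at 0.\<close>

lemma limit_cospan_iff:
  assumes fg: "f \<in> hom C x z" "g \<in> hom C y z"
  shows "is_limit cospan_category C (cospan C f g) v p \<longleftrightarrow>
    p 0 \<in> hom C v x \<and> p 2 = f \<cdot> p 0 \<and> is_pullback C f g (p 0) (p 1)" (is "?L \<longleftrightarrow> ?R")
proof
  assume L: ?L
  then have c: "p 0 \<in> hom C v x \<and> p 1 \<in> hom C v y \<and> f \<cdot> p 0 = p 2 \<and> g \<cdot> p 1 = p 2"
    using cone_cospan_iff[OF fg] by (simp add: is_limit_def)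
  have "\<exists>!u. u \<in> hom C w v \<and> p 0 \<cdot> u = p' \<and> p 1 \<cdot> u = q'"
    if pq: "p' \<in> hom C w x" "q' \<in> hom C w y" "f \<cdot> p' = g \<cdot> q'" for w p' q'
  proof -
    define q where "q = (\<lambda>j::nat. if j = 0 then p' else if j = 1 then q' else f \<cdot> p')"
    have "is_cone cospan_category C (cospan C f g) w q"
      unfolding cone_cospan_iff[OF fg] using pq by (simp add: q_def)
    then obtain u where u: "u \<in> hom C w v" "\<forall>j \<in> Ob cospan_category. p j \<cdot> u = q j"
      and uu: "\<And>u'. u' \<in> hom C w v \<Longrightarrow> \<forall>j \<in> Ob cospan_category. p j \<cdot> u' = q j \<Longrightarrow> u' = u"
      using L unfolding is_limit_def by metis
    have j: "(\<forall>j \<in> Ob cospan_category. p j \<cdot> u' = q j) \<longleftrightarrow> p 0 \<cdot> u' = p' \<and> p 1 \<cdot> u' = q'"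
      if "u' \<in> hom C w v" for u'
    proof -
      have "p 2 \<cdot> u' = f \<cdot> (p 0 \<cdot> u')" using c Comp_assoc[OF that _ fg(1)] by metis
      then show ?thesis by (auto simp: cospan_category_def q_def)
    qed
    show ?thesis
    proof (rule ex1I[of _ u])
      show "u \<in> hom C w v \<and> p 0 \<cdot> u = p' \<and> p 1 \<cdot> u = q'" using u j[OF u(1)] by simp
      show "u' = u" if "u' \<in> hom C w v \<and> p 0 \<cdot> u' = p' \<and> p 1 \<cdot> u' = q'" for u'
        using uu[of u'] j[of u'] that by simp
    qed
  qed
  then have "is_pullback C f g (p 0) (p 1)"
    using c by (subst pullback_iff[OF fg, of _ v]) (simp_all only: ball_simps, blast)
  then show ?R using c by simp
next
  assume R: ?R
  then have c: "p 0 \<in> hom C v x" "p 1 \<in> hom C v y" "f \<cdot> p 0 = p 2" "g \<cdot> p 1 = p 2"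
    using pullbackE[OF _ fg] by (metis homD(2))+
  show ?L unfolding is_limit_def
  proof (intro conjI allI impI)
    show "is_cone cospan_category C (cospan C f g) v p" using c cone_cospan_iff[OF fg] by blast
    fix w q assume "is_cone cospan_category C (cospan C f g) w q"
    then have q: "q 0 \<in> hom C w x" "q 1 \<in> hom C w y" "f \<cdot> q 0 = q 2" "g \<cdot> q 1 = q 2"
      using cone_cospan_iff[OF fg] by auto
    then have "\<exists>!u. u \<in> hom C w v \<and> p 0 \<cdot> u = q 0 \<and> p 1 \<cdot> u = q 1"
      using R unfolding pullback_iff[OF fg c(1,2)] by metis
    moreover have "(\<forall>j \<in> Ob cospan_category. p j \<cdot> u = q j) \<longleftrightarrow> p 0 \<cdot> u = q 0 \<and> p 1 \<cdot> u = q 1"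
      if "u \<in> hom C w v" for u
    proof -
      have "p 2 \<cdot> u = f \<cdot> (p 0 \<cdot> u)" using c Comp_assoc[OF that _ fg(1)] by metis
      then show ?thesis using q by (auto simp: cospan_category_def)
    qed
    ultimately show "\<exists>!u. u \<in> hom C w v \<and> (\<forall>j \<in> Ob cospan_category. p j \<cdot> u = q j)"
      by metis
  qed
qed

lemma pullback_exists:
  assumes "has_finite_limits C" "f \<in> hom C x z" "g \<in> hom C y z"
  obtains v p q where "is_pullback C f g p q" "p \<in> hom C v x" "q \<in> hom C v y" "f \<cdot> p = g \<cdot> q"
proof -
  obtain v p where "is_limit cospan_category C (cospan C f g) v p"
    using assms finite_diagram_cospan unfolding has_finite_limits_def by blast
  then have "is_pullback C f g (p 0) (p 1)" using limit_cospan_iff assms by blast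
  then show thesis using pullbackE[OF _ assms(2,3)] that by metis
qed

lemma pullback_of_iso:
  assumes pb: "is_pullback C f g p q" and fg: "f \<in> hom C x z" "g \<in> hom C y z" and iso: "is_iso C f"
  shows "is_iso C q"
proof -
  obtain v where pq: "p \<in> hom C v x" "q \<in> hom C v y" "f \<cdot> p = g \<cdot> q"
    using pullbackE[OF pb fg] .
  obtain f' where f': "f' \<in> hom C z x" "f' \<cdot> f = Ident C x" "f \<cdot> f' = Ident C z"
    using iso fg(1) unfolding is_iso_def hom_def by auto
  note hD = homD[OF fg(1)] homD[OF fg(2)] homD[OF pq(1)] homD[OF pq(2)] homD[OF f'(1)]
  have y: "y \<in> Ob C" "v \<in> Ob C" using pq hom_Ob by auto
  \<comment> \<open>The inverse of \<open>q\<close> is the lift \<open>u\<close> of the square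
    formed by \<open>f' \<cdot> g\<close> and the identity of \<open>y\<close>. It is a right
    inverse by construction, and a left inverse because \<open>u \<cdot> q\<close> and the identity
    agree after \<open>p\<close> and after \<open>q\<close>.\<close>
  have "f' \<cdot> g \<in> hom C y x" "Ident C y \<in> hom C y y"
    using f'(1) fg y Comp_hom Ident_hom by blast+
  moreover have "f \<cdot> (f' \<cdot> g) = (f \<cdot> f') \<cdot> g" using hD by simp
  then have "f \<cdot> (f' \<cdot> g) = g \<cdot> Ident C y" using f'(3) hD y by simp
  ultimately obtain u where u: "u \<in> hom C y v" "p \<cdot> u = f' \<cdot> g" "q \<cdot> u = Ident C y"
    using pullback_lift[OF pb fg pq(1)] by metis
  note hu = homD[OF u(1)]
  have "u \<cdot> q = Ident C v"
  proof (rule pullback_unique[OF pb fg pq(1)])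
    show "u \<cdot> q \<in> hom C v v" "Ident C v \<in> hom C v v" using u pq y Comp_hom Ident_hom by blast+
    have "p \<cdot> (u \<cdot> q) = (f' \<cdot> g) \<cdot> q" using u(2) hD hu by (metis assoc)
    also have "\<dots> = (f' \<cdot> f) \<cdot> p" using hD pq(3) by simp
    finally show "p \<cdot> (u \<cdot> q) = p \<cdot> Ident C v" using f'(2) hD y by simp
    have "q \<cdot> (u \<cdot> q) = (q \<cdot> u) \<cdot> q" using hD hu by simp
    then show "q \<cdot> (u \<cdot> q) = q \<cdot> Ident C v" using u(3) hD y by simp
  qed
  then show ?thesis using u pq unfolding is_iso_def by blast
qed

text \<open>In this form being a mono is a statement about a finite limit, and hence preserved by
  functors that preserve those.\<close>

lemma mono_iff_pullback:
  assumes m: "m \<in> hom C x y"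
  shows "is_mono C m \<longleftrightarrow> is_pullback C m m (Ident C x) (Ident C x)"
proof -
  have "x \<in> Ob C" using m hom_Ob by blast
  then have "is_pullback C m m (Ident C x) (Ident C x) \<longleftrightarrow>
     (\<forall>w. \<forall>p \<in> hom C w x. \<forall>q \<in> hom C w x. m \<cdot> p = m \<cdot> q \<longrightarrow> p = q)"
    by (subst pullback_iff[OF m m]) (auto simp: hom_def intro!: ex1I)
  then show ?thesis using m unfolding is_mono_def by (auto simp: hom_def)
qed

lemma pullback_mono:
  assumes pb: "is_pullback C f g p q" and fg: "f \<in> hom C x z" "g \<in> hom C y z" and "is_mono C g"
  shows "is_mono C p"
proof -
  obtain v where pq: "p \<in> hom C v x" "q \<in> hom C v y" "f \<cdot> p = g \<cdot> q"
    using pullbackE[OF pb fg] .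
  note hD = homD[OF fg(1)] homD[OF fg(2)] homD[OF pq(1)] homD[OF pq(2)]
  show ?thesis unfolding is_mono_def
  proof (intro conjI allI ballI impI)
    show "p \<in> Ar C" by fact
    fix w a b assume ab: "a \<in> hom C w (Dom C p)" "b \<in> hom C w (Dom C p)" "p \<cdot> a = p \<cdot> b"
    note hab = homD[OF ab(1)] homD[OF ab(2)]
    have "g \<cdot> (q \<cdot> a) = g \<cdot> (q \<cdot> b)"
      using ab(3) hD hab pq(3) by (metis assoc)
    then have "q \<cdot> a = q \<cdot> b"
      using monoD[OF \<open>is_mono C g\<close>] hD hab by simp
    then show "a = b"
      using pullback_unique[OF pb fg pq(1)] ab hD by metis
  qed
qed

lemma terminal_source_mono:
  assumes "is_terminal C t" "f \<in> hom C t x"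
  shows "is_mono C f"
  using assms terminal_unique unfolding is_mono_def by (metis homD(1,2))

text \<open>Every square over a terminal object commutes. This yields both the existence of products
  and their preservation from the corresponding facts on pullbacks.\<close>

lemma product_iff_pullback:
  assumes t: "is_terminal C t" and fg: "f \<in> hom C x t" "g \<in> hom C y t" and p: "p \<in> hom C v x"
  shows "is_product C x y v p q \<longleftrightarrow> is_pullback C f g p q" (is "?L \<longleftrightarrow> ?R")
proof
  assume L: ?L
  have q: "q \<in> hom C v y" using L by (simp add: is_product_def)
  have "f \<cdot> p = g \<cdot> q" using terminal_unique[OF t] Comp_hom p q fg by blast
  then show ?R using L unfolding pullback_iff[OF fg p q] is_product_def by blast
next
  assume R: ?R
  have q: "q \<in> hom C v y" using pullbackE[OF R fg] p by (metis homD(2))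
  have "\<exists>!u. u \<in> hom C w v \<and> p \<cdot> u = p' \<and> q \<cdot> u = q'"
    if pq: "p' \<in> hom C w x" "q' \<in> hom C w y" for w p' q'
  proof -
    have "f \<cdot> p' = g \<cdot> q'" using terminal_unique[OF t] Comp_hom pq fg by blast
    then show ?thesis using R pq unfolding pullback_iff[OF fg p q] by blast
  qed
  then show ?L using p q hom_Ob unfolding is_product_def by blast
qed

lemma productE:
  assumes "is_product C x y v p q"
  shows "v \<in> Ob C" "p \<in> hom C v x" "q \<in> hom C v y"
  using assms by (auto simp: is_product_def)

lemma product_lift:
  assumes "is_product C x y v p q" "f \<in> hom C w x" "g \<in> hom C w y"
  obtains u where "u \<in> hom C w v" "p \<cdot> u = f" "q \<cdot> u = g"
  using assms unfolding is_product_def by metis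

lemma product_unique:
  assumes "is_product C x y v p q" "u \<in> hom C w v" "u' \<in> hom C w v" "p \<cdot> u = p \<cdot> u'" "q \<cdot> u = q \<cdot> u'"
  shows "u = u'"
proof -
  have "p \<cdot> u \<in> hom C w x" "q \<cdot> u \<in> hom C w y"
    using assms(2) productE[OF assms(1)] Comp_hom by blast+
  then show ?thesis using assms unfolding is_product_def by metis
qed

lemma product_exists:
  assumes "has_finite_limits C" "is_terminal C t" "x \<in> Ob C" "y \<in> Ob C"
  obtains v p q where "is_product C x y v p q"
proof -
  have fg: "the_arrow C x t \<in> hom C x t" "the_arrow C y t \<in> hom C y t"
    using terminal_arrow assms by auto
  obtain v p q where "is_pullback C (the_arrow C x t) (the_arrow C y t) p q" "p \<in> hom C v x"
    using pullback_exists[OF assms(1) fg] .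
  then show thesis
    using product_iff_pullback[OF assms(2) fg] that by blast
qed

text \<open>The equalizer of \<open>f\<close> and \<open>g\<close> as the pullback of \<open>(id, f)\<close> and \<open>(id, g)\<close>.\<close>

lemma equalizer_exists:
  assumes lim: "has_finite_limits C" "is_terminal C t" and fg: "f \<in> hom C x y" "g \<in> hom C x y"
  obtains v e where "e \<in> hom C v x" "f \<cdot> e = g \<cdot> e" "is_mono C e"
    "\<forall>w. \<forall>k \<in> hom C w x. f \<cdot> k = g \<cdot> k \<longrightarrow> (\<exists>u \<in> hom C w v. e \<cdot> u = k)"
proof -
  have xy: "x \<in> Ob C" "y \<in> Ob C" using fg hom_Ob by auto
  obtain z p q where pr: "is_product C x y z p q" using product_exists[OF lim xy] .
  obtain a where a: "a \<in> hom C x z" "p \<cdot> a = Ident C x" "q \<cdot> a = f"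
    using product_lift[OF pr Ident_hom[OF xy(1)] fg(1)] .
  obtain b where b: "b \<in> hom C x z" "p \<cdot> b = Ident C x" "q \<cdot> b = g"
    using product_lift[OF pr Ident_hom[OF xy(1)] fg(2)] .
  obtain v e e' where pb: "is_pullback C a b e e'" "e \<in> hom C v x" "e' \<in> hom C v x" "a \<cdot> e = b \<cdot> e'"
    using pullback_exists[OF lim(1) a(1) b(1)] .
  note hD = homD[OF productE(2)[OF pr]] homD[OF productE(3)[OF pr]] homD[OF a(1)] homD[OF b(1)]
    homD[OF pb(2)] homD[OF pb(3)] homD[OF fg(1)] homD[OF fg(2)]
  have ab: "p \<cdot> (a \<cdot> k) = k" "q \<cdot> (a \<cdot> k) = f \<cdot> k" "p \<cdot> (b \<cdot> k) = k" "q \<cdot> (b \<cdot> k) = g \<cdot> k"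
    if "k \<in> Ar C" "Cod C k = x" for k
    using that hD a(2,3) b(2,3) assoc[of k a p] assoc[of k a q] assoc[of k b p] assoc[of k b q]
    by simp_all
  \<comment> \<open>The first projection \<open>p\<close> turns
    \<open>a \<cdot> e = b \<cdot> e'\<close> into this equation.\<close>
  have e: "e' = e" using ab(1)[of e] ab(3)[of e'] pb(4) hD by simp
  show thesis
  proof
    show "e \<in> hom C v x" by fact
    have "f \<cdot> e = q \<cdot> (a \<cdot> e)" using ab(2)[of e] hD by simp
    also have "\<dots> = q \<cdot> (b \<cdot> e)" using pb(4) e by simp
    finally show "f \<cdot> e = g \<cdot> e" using ab(4)[of e] hD by simp
    \<comment> \<open>The arrow \<open>b\<close> is a mono because \<open>p\<close> is a retraction
      of it, and \<open>e\<close> is the pullback of \<open>b\<close> along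
      \<open>a\<close>.\<close>
    have "k = k'" if "k \<in> hom C w x" "k' \<in> hom C w x" "b \<cdot> k = b \<cdot> k'" for w k k'
    proof -
      have "p \<cdot> (b \<cdot> k) = k" "p \<cdot> (b \<cdot> k') = k'" 
        using ab(3)[OF homD(1,3)[OF that(1)]] ab(3)[OF homD(1,3)[OF that(2)]] .
      then show ?thesis using that(3) by metis
    qed
    then have "is_mono C b" using hD by (auto simp: is_mono_def)
    then show "is_mono C e" using pullback_mono[OF pb(1) a(1) b(1)] by blast
    have "\<exists>u \<in> hom C w v. e \<cdot> u = k" if k: "k \<in> hom C w x" "f \<cdot> k = g \<cdot> k" for w k
    proof -
      have "a \<cdot> k = b \<cdot> k"
        using product_unique[OF pr Comp_hom[OF k(1) a(1)] Comp_hom[OF k(1) b(1)]]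
          ab[of k] homD[OF k(1)] k(2) by simp
      then show ?thesis
        using pullback_lift[OF pb(1) a(1) b(1) pb(2) k(1) k(1)] by metis
    qed
    then show "\<forall>w. \<forall>k \<in> hom C w x. f \<cdot> k = g \<cdot> k \<longrightarrow> (\<exists>u \<in> hom C w v. e \<cdot> u = k)"
      by blast
  qed
qed

end

section \<open>Pullbacks, monos and products under functors preserving finite limits\<close>

lemma lex_pullback:
  assumes lex: "lex_functor C D F" and pb: "is_pullback C f g p q"
  shows "is_pullback D (far F f) (far F g) (far F p) (far F q)"
proof -
  interpret cat_functor C D F using lex by (simp add: functor_iff lex_functor_def)
  obtain x y z v where h: "f \<in> hom C x z" "g \<in> hom C y z" "p \<in> hom C v x"
    using pb by (auto simp: is_pullback_def)
  have eq: "F \<odot> cospan C f g = cospan D (far F f) (far F g)"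
    using homD[OF h(1)] homD[OF h(2)] C.hom_Ob[OF h(1)] C.hom_Ob[OF h(2)]
    by (auto simp: cospan_def comp_functor_def Let_def fun_eq_iff)
  define l where "l = (\<lambda>j::nat. if j = 0 then p else if j = 1 then q else f \<cdot>\<^bsub>C\<^esub> p)"
  have "is_limit cospan_category C (cospan C f g) v l"
    unfolding C.limit_cospan_iff[OF h(1,2)] using h pb by (simp add: l_def)
  then have "is_limit cospan_category D (cospan D (far F f) (far F g)) (fob F v) (\<lambda>j. far F (l j))"
    using lex C.finite_diagram_cospan[OF h(1,2)] eq
    unfolding lex_functor_def preserves_finite_limits_def by metis
  then show ?thesis
    unfolding D.limit_cospan_iff[OF far_hom[OF h(1)] far_hom[OF h(2)]] by (simp add: l_def)
qed

lemma lex_mono: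
  assumes lex: "lex_functor C D F" and m: "is_mono C m"
  shows "is_mono D (far F m)"
proof -
  interpret cat_functor C D F using lex by (simp add: functor_iff lex_functor_def)
  have h: "m \<in> hom C (Dom C m) (Cod C m)" using m by (auto simp: is_mono_def hom_def)
  show ?thesis
    using lex_pullback[OF lex, of m m "Ident C (Dom C m)" "Ident C (Dom C m)"] m C.mono_iff_pullback[OF h] D.mono_iff_pullback[OF far_hom[OF h]]
      C.hom_Ob[OF h] by simp
qed

lemma lex_product:
  assumes lex: "lex_functor C D F" and t: "is_terminal C t" and pr: "is_product C x y v p q"
  shows "is_product D (fob F x) (fob F y) (fob F v) (far F p) (far F q)"
proof -
  interpret cat_functor C D F using lex by (simp add: functor_iff lex_functor_def)
  note h = C.productE[OF pr]
  have fg: "the_arrow C x t \<in> hom C x t" "the_arrow C y t \<in> hom C y t"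
    using C.terminal_arrow[OF t] C.hom_Ob h by blast+
  show ?thesis
    using lex_pullback[OF lex, of "the_arrow C x t" "the_arrow C y t" p q] pr
      C.product_iff_pullback[OF t fg h(2)]
      D.product_iff_pullback[OF lex_terminal[OF lex t] far_hom[OF fg(1)] far_hom[OF fg(2)] far_hom[OF h(2)]]
    by simp
qed

section \<open>Exponentials and truth values through generalized elements\<close>

text \<open>The product cone is an argument because no products are chosen; the source is read off
  from \<open>f\<close>.\<close>

definition pairing ::
  "('o, 'a, 'z) category_scheme \<Rightarrow> 'o \<Rightarrow> 'a \<Rightarrow> 'a \<Rightarrow> 'a \<Rightarrow> 'a \<Rightarrow> 'a" where
  "pairing C v p q f g = (THE u. u \<in> hom C (Dom C f) v \<and> p \<cdot>\<^bsub>C\<^esub> u = f \<and> q \<cdot>\<^bsub>C\<^esub> u = g)"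

text \<open>The exponential \<open>e\<close> of \<open>y\<close> by \<open>x\<close>, with evaluation replaced by its effect \<open>app\<close> on
  generalized elements of \<open>e\<close> and \<open>x\<close>; this does not involve a choice of product \<open>e \<times> x\<close>.\<close>

definition is_application ::
  "('o, 'a, 'z) category_scheme \<Rightarrow> 'o \<Rightarrow> 'o \<Rightarrow> 'o \<Rightarrow> ('a \<Rightarrow> 'a \<Rightarrow> 'a) \<Rightarrow> bool" where
  "is_application C x y e app \<longleftrightarrow> e \<in> Ob C
     \<and> (\<forall>w. \<forall>k \<in> hom C w e. \<forall>s \<in> hom C w x. app k s \<in> hom C w y)
     \<and> (\<forall>w z. \<forall>k \<in> hom C w e. \<forall>s \<in> hom C w x. \<forall>f \<in> hom C z w.
          app (k \<cdot>\<^bsub>C\<^esub> f) (s \<cdot>\<^bsub>C\<^esub> f) = app k s \<cdot>\<^bsub>C\<^esub> f)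
     \<and> (\<forall>c w r s. is_product C c x w r s \<longrightarrow>
          (\<forall>g \<in> hom C w y. \<exists>!h. h \<in> hom C c e \<and> app (h \<cdot>\<^bsub>C\<^esub> r) s = g))"

text \<open>Membership of the generalized element \<open>f\<close> in the subobject
  \<open>m\<close>. For \<open>m\<close> the arrow \<open>true\<close> of a subobject classifier, it
  says that the truth value \<open>f\<close> holds.\<close>

definition factors :: "('o, 'a, 'z) category_scheme \<Rightarrow> 'a \<Rightarrow> 'a \<Rightarrow> bool" where
  "factors C m f \<longleftrightarrow> (\<exists>k \<in> hom C (Dom C f) (Dom C m). f = m \<cdot>\<^bsub>C\<^esub> k)"

context category
begin

lemma pairing_unique:
  assumes pr: "is_product C x y v p q" and u: "u \<in> hom C w v" "p \<cdot> u = f" "q \<cdot> u = g"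
  shows "pairing C v p q f g = u"
  unfolding pairing_def
proof (rule the_equality)
  have "Dom C f = w" using Comp_hom[OF u(1) productE(2)[OF pr]] u(2) homD(2) by metis
  then show "u \<in> hom C (Dom C f) v \<and> p \<cdot> u = f \<and> q \<cdot> u = g" using u by simp
  show "u' = u" if "u' \<in> hom C (Dom C f) v \<and> p \<cdot> u' = f \<and> q \<cdot> u' = g" for u'
    using product_unique[OF pr, of u' w u] that u \<open>Dom C f = w\<close> by simp
qed

lemma pairing:
  assumes pr: "is_product C x y v p q" and "f \<in> hom C w x" "g \<in> hom C w y"
  shows "pairing C v p q f g \<in> hom C w v"
    "p \<cdot> pairing C v p q f g = f" "q \<cdot> pairing C v p q f g = g"
proof -
  obtain u where u: "u \<in> hom C w v" "p \<cdot> u = f" "q \<cdot> u = g" using product_lift[OF assms] .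
  show "pairing C v p q f g \<in> hom C w v"
    "p \<cdot> pairing C v p q f g = f" "q \<cdot> pairing C v p q f g = g"
    using pairing_unique[OF pr u] u by simp_all
qed

lemma pairing_comp:
  assumes pr: "is_product C x y v p q" and fg: "f \<in> hom C w x" "g \<in> hom C w y" and h: "h \<in> hom C z w"
  shows "pairing C v p q (f \<cdot> h) (g \<cdot> h) = pairing C v p q f g \<cdot> h"
proof (rule pairing_unique[OF pr])
  note u = pairing[OF pr fg]
  show "pairing C v p q f g \<cdot> h \<in> hom C z v" using u(1) h Comp_hom by blast
  show "p \<cdot> (pairing C v p q f g \<cdot> h) = f \<cdot> h" "q \<cdot> (pairing C v p q f g \<cdot> h) = g \<cdot> h"
    using Comp_assoc[OF h u(1) productE(2)[OF pr]] Comp_assoc[OF h u(1) productE(3)[OF pr]] u(2,3)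
    by simp_all
qed

lemma application_hom:
  "is_application C x y e app \<Longrightarrow> k \<in> hom C w e \<Longrightarrow> s \<in> hom C w x \<Longrightarrow> app k s \<in> hom C w y"
  by (simp add: is_application_def)

lemma application_comp:
  "is_application C x y e app \<Longrightarrow> k \<in> hom C w e \<Longrightarrow> s \<in> hom C w x \<Longrightarrow> f \<in> hom C z w
    \<Longrightarrow> app (k \<cdot> f) (s \<cdot> f) = app k s \<cdot> f"
  by (simp add: is_application_def)

lemma application_transpose:
  assumes "is_application C x y e app" "is_product C c x w r s" "g \<in> hom C w y"
  obtains h where "h \<in> hom C c e" "app (h \<cdot> r) s = g"
  using assms unfolding is_application_def by metis

lemma application_inject:
  assumes app: "is_application C x y e app" and pr: "is_product C c x w r s"
    and h: "h \<in> hom C c e" "h' \<in> hom C c e" "app (h \<cdot> r) s = app (h' \<cdot> r) s"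
  shows "h = h'"
proof -
  have "h \<cdot> r \<in> hom C w e" "s \<in> hom C w x"
    using h productE[OF pr] Comp_hom by blast+
  then have "app (h \<cdot> r) s \<in> hom C w y" using application_hom[OF app] by blast
  then show ?thesis using app pr h unfolding is_application_def by metis
qed

text \<open>The arrow \<open>u\<close> can only be the pairing of \<open>k\<close> and
  \<open>s\<close>, so the existential condition in \<open>is_exponential\<close> collapses to one
  equation.\<close>

lemma evaluation_application:
  assumes pr: "is_product C e x v p q" and ev: "ev \<in> hom C v y"
    and k: "k \<in> hom C w e" "s \<in> hom C w x"
  shows "(\<exists>u \<in> hom C w v. p \<cdot> u = k \<and> q \<cdot> u = s \<and> ev \<cdot> u = g)
    \<longleftrightarrow> ev \<cdot> pairing C v p q k s = g"
proof
  assume "\<exists>u \<in> hom C w v. p \<cdot> u = k \<and> q \<cdot> u = s \<and> ev \<cdot> u = g"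
  then show "ev \<cdot> pairing C v p q k s = g" using pairing_unique[OF pr, of _ w k s] by auto
next
  assume "ev \<cdot> pairing C v p q k s = g"
  then show "\<exists>u \<in> hom C w v. p \<cdot> u = k \<and> q \<cdot> u = s \<and> ev \<cdot> u = g"
    using pairing[OF pr k] by auto
qed

lemma exponential_application:
  assumes "is_exponential C x y e v p q ev"
  shows "is_application C x y e (\<lambda>k s. ev \<cdot> pairing C v p q k s)"
proof -
  have pr: "is_product C e x v p q" and ev: "ev \<in> hom C v y" and e: "e \<in> Ob C"
    and ex: "\<And>c w r s g. c \<in> Ob C \<Longrightarrow> is_product C c x w r s \<Longrightarrow> g \<in> hom C w y \<Longrightarrow> \<exists>!h. h \<in> hom C c e \<and>
            (\<exists>u \<in> hom C w v. p \<cdot> u = h \<cdot> r \<and> q \<cdot> u = s \<and> ev \<cdot> u = g)"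
    using assms by (auto simp: is_exponential_def)
  show ?thesis
    unfolding is_application_def
  proof (intro conjI allI ballI impI)
    show "e \<in> Ob C" by fact
    show "ev \<cdot> pairing C v p q k s \<in> hom C w y" if "k \<in> hom C w e" "s \<in> hom C w x" for w k s
      using pairing(1)[OF pr that] ev Comp_hom by blast
    show "ev \<cdot> pairing C v p q (k \<cdot> f) (s \<cdot> f) = (ev \<cdot> pairing C v p q k s) \<cdot> f"
      if "k \<in> hom C w e" "s \<in> hom C w x" "f \<in> hom C z w" for w k s z f
      using pairing_comp[OF pr that] Comp_assoc[OF that(3) pairing(1)[OF pr that(1,2)] ev] by simp
    fix c w r s g assume w: "is_product C c x w r s" and g: "g \<in> hom C w y"
    have c: "c \<in> Ob C" using productE(2)[OF w] hom_Ob by blast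
    have "(\<exists>u \<in> hom C w v. p \<cdot> u = h \<cdot> r \<and> q \<cdot> u = s \<and> ev \<cdot> u = g)
        \<longleftrightarrow> ev \<cdot> pairing C v p q (h \<cdot> r) s = g" if "h \<in> hom C c e" for h
      by (rule evaluation_application[OF pr ev Comp_hom[OF productE(2)[OF w] that] productE(3)[OF w]])
    then show "\<exists>!h. h \<in> hom C c e \<and> ev \<cdot> pairing C v p q (h \<cdot> r) s = g"
      using ex[OF c w g] by (simp cong: conj_cong)
  qed
qed

text \<open>By naturality \<open>app\<close> is determined by its value on the universal pair of
  elements \<open>p\<close>, \<open>q\<close>; that value is the evaluation, whichever product of
  \<open>e\<close> and \<open>x\<close> is used.\<close>

lemma application_exponential:
  assumes app: "is_application C x y e app" and pr: "is_product C e x v p q"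
  shows "is_exponential C x y e v p q (app p q)"
  unfolding is_exponential_def
proof (intro conjI allI ballI impI)
  note h = productE(2,3)[OF pr]
  show "e \<in> Ob C" using h(1) hom_Ob by blast
  show "is_product C e x v p q" by fact
  show ev: "app p q \<in> hom C v y" using application_hom[OF app] h by blast
  fix c w r s g assume w: "is_product C c x w r s" and g: "g \<in> hom C w y"
  have "(\<exists>u \<in> hom C w v. p \<cdot> u = h \<cdot> r \<and> q \<cdot> u = s \<and> app p q \<cdot> u = g)
      \<longleftrightarrow> app (h \<cdot> r) s = g" if hh: "h \<in> hom C c e" for h
  proof -
    have k: "h \<cdot> r \<in> hom C w e" using Comp_hom[OF productE(2)[OF w] hh] .
    note s = productE(3)[OF w]
    have "app p q \<cdot> pairing C v p q (h \<cdot> r) s = app (h \<cdot> r) s"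
      using application_comp[OF app h pairing(1)[OF pr k s]] pairing(2,3)[OF pr k s] by simp
    then show ?thesis using evaluation_application[OF pr ev k s] by simp
  qed
  then show "\<exists>!h. h \<in> hom C c e \<and>
      (\<exists>u \<in> hom C w v. p \<cdot> u = h \<cdot> r \<and> q \<cdot> u = s \<and> app p q \<cdot> u = g)"
    using app w g unfolding is_application_def by (simp cong: conj_cong)
qed

section \<open>Subobjects, characteristic arrows and truth values\<close>

lemma factors_comp:
  assumes "factors C m f" "m \<in> hom C v w" "f \<in> hom C x w" "g \<in> hom C y x"
  shows "factors C m (f \<cdot> g)"
proof -
  obtain k where k: "k \<in> hom C x v" "f = m \<cdot> k"
    using assms by (auto simp: factors_def hom_def)
  then have "f \<cdot> g = m \<cdot> (k \<cdot> g)" "k \<cdot> g \<in> hom C y v" "f \<cdot> g \<in> hom C y w"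
    using Comp_assoc[OF assms(4) k(1) assms(2)] Comp_hom assms by blast+
  then show ?thesis using assms by (auto simp: factors_def homD)
qed

lemma factorsI: "k \<in> hom C x v \<Longrightarrow> m \<in> hom C v w \<Longrightarrow> factors C m (m \<cdot> k)"
  unfolding factors_def by (auto simp: hom_def)

lemma factorsE:
  assumes "factors C m f" "m \<in> hom C v w" "f \<in> hom C x w"
  obtains k where "k \<in> hom C x v" "f = m \<cdot> k"
  using assms by (auto simp: factors_def hom_def)

text \<open>The leg into the terminal object carries no information, so a lift of a square into the
  pullback is just a factorization through \<open>m\<close>, and it is unique as soon as
  \<open>m\<close> is a mono.\<close>

lemma classifies_iff:
  assumes t: "is_terminal C t" "\<tau> \<in> hom C t \<Omega>" and m: "m \<in> hom C v w" and \<chi>: "\<chi> \<in> hom C w \<Omega>"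
  shows "(\<exists>k. is_pullback C \<chi> \<tau> m k) \<longleftrightarrow>
    is_mono C m \<and> (\<forall>x. \<forall>f \<in> hom C x w. factors C \<tau> (\<chi> \<cdot> f) \<longleftrightarrow> factors C m f)" (is "?L \<longleftrightarrow> ?R")
proof
  assume ?L
  then obtain k where pb: "is_pullback C \<chi> \<tau> m k" by blast
  have k: "k \<in> hom C v t" "\<chi> \<cdot> m = \<tau> \<cdot> k" using pullbackE[OF pb \<chi> t(2)] m by (metis homD(2))+
  have "is_mono C m" using pullback_mono[OF pb \<chi> t(2)] terminal_source_mono t by blast
  moreover have "factors C \<tau> (\<chi> \<cdot> f) \<longleftrightarrow> factors C m f" if f: "f \<in> hom C x w" for x f
  proof
    have cf: "\<chi> \<cdot> f \<in> hom C x \<Omega>" using f \<chi> Comp_hom by blast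
    assume "factors C \<tau> (\<chi> \<cdot> f)"
    then obtain b where b: "b \<in> hom C x t" "\<chi> \<cdot> f = \<tau> \<cdot> b"
      using factorsE t(2) cf by metis
    obtain u where u: "u \<in> hom C x v" "m \<cdot> u = f" using pullback_lift[OF pb \<chi> t(2) m f b] .
    show "factors C m f" using factorsI[OF u(1) m] u(2) by simp
  next
    assume "factors C m f"
    then obtain u where u: "u \<in> hom C x v" "f = m \<cdot> u" using factorsE m f by metis
    have "\<chi> \<cdot> f = \<tau> \<cdot> (k \<cdot> u)"
      using u(2) Comp_assoc[OF u(1) m \<chi>] Comp_assoc[OF u(1) k(1) t(2)] k(2) by simp
    then show "factors C \<tau> (\<chi> \<cdot> f)" using factorsI[OF Comp_hom[OF u(1) k(1)] t(2)] by simp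
  qed
  ultimately show ?R by blast
next
  assume R: ?R
  have v: "v \<in> Ob C" using m hom_Ob by blast
  \<comment> \<open>The generic member of \<open>m\<close> is \<open>m\<close> itself; testing on it
    produces the missing leg \<open>k\<close>.\<close>
  have "factors C m m" using factorsI[OF Ident_hom[OF v] m] Comp_Ident[OF m] by simp
  then obtain k where k: "k \<in> hom C v t" "\<chi> \<cdot> m = \<tau> \<cdot> k"
    using R m factorsE[OF _ t(2) Comp_hom[OF m \<chi>]] by metis
  have "is_pullback C \<chi> \<tau> m k"
    unfolding pullback_iff[OF \<chi> t(2) m k(1)]
  proof (intro conjI allI ballI impI)
    fix x f b assume f: "f \<in> hom C x w" "b \<in> hom C x t" "\<chi> \<cdot> f = \<tau> \<cdot> b"
    then have "factors C \<tau> (\<chi> \<cdot> f)" using factorsI t(2) by simp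
    then obtain u where u: "u \<in> hom C x v" "f = m \<cdot> u" using R f(1) factorsE[OF _ m f(1)] by metis
    show "\<exists>!u. u \<in> hom C x v \<and> m \<cdot> u = f \<and> k \<cdot> u = b"
    proof (rule ex1I[of _ u])
      show "u \<in> hom C x v \<and> m \<cdot> u = f \<and> k \<cdot> u = b"
        using u terminal_unique[OF t(1) Comp_hom[OF u(1) k(1)] f(2)] by simp
      show "u' = u" if "u' \<in> hom C x v \<and> m \<cdot> u' = f \<and> k \<cdot> u' = b" for u'
        using monoD[of m u' u] R that u m by (simp add: hom_def)
    qed
  qed (fact k(2))
  then show ?L by blast
qed

lemma pullback_of_truth:
  assumes t: "is_terminal C t" "\<tau> \<in> hom C t \<Omega>" and m: "is_mono C m" "m \<in> hom C v w"
    and \<chi>: "\<chi> \<in> hom C w \<Omega>"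
    and f: "\<And>x f. f \<in> hom C x w \<Longrightarrow> factors C \<tau> (\<chi> \<cdot> f) \<longleftrightarrow> factors C m f"
  obtains k where "is_pullback C \<chi> \<tau> m k"
  using classifies_iff[OF t m(2) \<chi>] m(1) f by blast

text \<open>Replacing the pullback square by a test on generalized elements gives a condition that
  can be split into the two components of the gluing.\<close>

lemma subobject_classifier_iff:
  "is_subobject_classifier C t \<Omega> \<tau> \<longleftrightarrow> is_terminal C t \<and> \<Omega> \<in> Ob C \<and> \<tau> \<in> hom C t \<Omega>
     \<and> (\<forall>m. is_mono C m \<longrightarrow> (\<exists>!\<chi>. \<chi> \<in> hom C (Cod C m) \<Omega>
          \<and> (\<forall>x. \<forall>f \<in> hom C x (Cod C m). factors C \<tau> (\<chi> \<cdot> f) \<longleftrightarrow> factors C m f)))"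
proof -
  have "(\<chi> \<in> hom C (Cod C m) \<Omega> \<and> (\<exists>k. is_pullback C \<chi> \<tau> m k)) \<longleftrightarrow> (\<chi> \<in> hom C (Cod C m) \<Omega>
          \<and> (\<forall>x. \<forall>f \<in> hom C x (Cod C m). factors C \<tau> (\<chi> \<cdot> f) \<longleftrightarrow> factors C m f))"
    if "is_terminal C t" "\<tau> \<in> hom C t \<Omega>" "is_mono C m" for m \<chi>
  proof -
    have "m \<in> hom C (Dom C m) (Cod C m)" using that(3) by (simp add: is_mono_def hom_def)
    then show ?thesis using classifies_iff[OF that(1,2), of m] that(3) by blast
  qed
  then show ?thesis unfolding is_subobject_classifier_def by (simp cong: conj_cong imp_cong)
qed

lemma classifierE:
  assumes "is_subobject_classifier C t \<Omega> \<tau>"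
  shows "is_terminal C t" "\<Omega> \<in> Ob C" "\<tau> \<in> hom C t \<Omega>"
  using assms by (auto simp: is_subobject_classifier_def)

lemma classify:
  assumes "is_subobject_classifier C t \<Omega> \<tau>" "is_mono C m" "m \<in> hom C v w"
  obtains \<chi> where "\<chi> \<in> hom C w \<Omega>"
    "\<And>x f. f \<in> hom C x w \<Longrightarrow> factors C \<tau> (\<chi> \<cdot> f) \<longleftrightarrow> factors C m f"
  using assms unfolding subobject_classifier_iff by (metis homD(3))

lemma classify_unique:
  assumes cl: "is_subobject_classifier C t \<Omega> \<tau>" and m: "is_mono C m" "m \<in> hom C v w"
    and h: "\<chi> \<in> hom C w \<Omega>" "\<chi>' \<in> hom C w \<Omega>"
    and f: "\<And>x f. f \<in> hom C x w \<Longrightarrow> factors C \<tau> (\<chi> \<cdot> f) \<longleftrightarrow> factors C m f"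
      "\<And>x f. f \<in> hom C x w \<Longrightarrow> factors C \<tau> (\<chi>' \<cdot> f) \<longleftrightarrow> factors C m f"
  shows "\<chi> = \<chi>'"
proof -
  have "\<exists>!\<chi>. \<chi> \<in> hom C w \<Omega> \<and> (\<forall>x. \<forall>f \<in> hom C x w. factors C \<tau> (\<chi> \<cdot> f) \<longleftrightarrow> factors C m f)"
    using cl m homD(3)[OF m(2)] unfolding subobject_classifier_iff by blast
  then show ?thesis using h f by blast
qed

text \<open>Both arrows are characteristic arrows of the same subobject, the pullback of
  \<open>\<tau>\<close> along \<open>u\<close>.\<close>

lemma truth_value_ext:
  assumes lim: "has_finite_limits C" and cl: "is_subobject_classifier C t \<Omega> \<tau>"
    and u: "u \<in> hom C w \<Omega>" "u' \<in> hom C w \<Omega>"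
    and ext: "\<And>x f. f \<in> hom C x w \<Longrightarrow> factors C \<tau> (u \<cdot> f) \<longleftrightarrow> factors C \<tau> (u' \<cdot> f)"
  shows "u = u'"
proof -
  note c = classifierE[OF cl]
  obtain v m k where pb: "is_pullback C u \<tau> m k" "m \<in> hom C v w"
    using pullback_exists[OF lim u(1) c(3)] .
  then have m: "is_mono C m" "\<And>x f. f \<in> hom C x w \<Longrightarrow> factors C \<tau> (u \<cdot> f) \<longleftrightarrow> factors C m f"
    using classifies_iff[OF c(1,3) pb(2) u(1)] by auto
  show ?thesis using classify_unique[OF cl m(1) pb(2) u m(2)] m(2) ext by simp
qed

text \<open>\<open>P\<close> is the equalizer of \<open>u \<and> (v \<in> \<sigma>)\<close> and \<open>u\<close> on \<open>\<Omega> \<times> b\<close>.\<close>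

lemma implication_object:
  assumes lim: "has_finite_limits C" and cl: "is_subobject_classifier C t \<Omega> \<tau>"
    and \<sigma>: "is_mono C \<sigma>" "\<sigma> \<in> hom C a b"
  obtains P p \<kappa> where "p \<in> hom C P \<Omega>" "\<kappa> \<in> hom C P b"
    "\<forall>w. \<forall>z \<in> hom C w P. factors C \<tau> (p \<cdot> z) \<longrightarrow> factors C \<sigma> (\<kappa> \<cdot> z)"
    "\<forall>w. \<forall>f \<in> hom C w P. \<forall>g \<in> hom C w P. p \<cdot> f = p \<cdot> g \<longrightarrow> \<kappa> \<cdot> f = \<kappa> \<cdot> g \<longrightarrow> f = g"
    "\<forall>w. \<forall>u \<in> hom C w \<Omega>. \<forall>v \<in> hom C w b.
       (\<forall>x. \<forall>z \<in> hom C x w. factors C \<tau> (u \<cdot> z) \<longrightarrow> factors C \<sigma> (v \<cdot> z)) \<longrightarrow>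
       (\<exists>f \<in> hom C w P. p \<cdot> f = u \<and> \<kappa> \<cdot> f = v)"
proof -
  note c = classifierE[OF cl]
  have ab: "a \<in> Ob C" "b \<in> Ob C" using \<sigma> hom_Ob by auto
  define ta where "ta = the_arrow C a t"
  have ta: "ta \<in> hom C a t" using terminal_arrow[OF c(1)] ab by (simp add: ta_def)
  obtain W q1 q2 where pr: "is_product C \<Omega> b W q1 q2" using product_exists[OF lim c(1,2) ab(2)] .
  note q = productE[OF pr]
  \<comment> \<open>The arrow \<open>\<sigma>'\<close> is the pair of \<open>true\<close> and
    \<open>\<sigma>\<close>: the subobject of those pairs whose first entry is true and whose second
    entry lies in \<open>\<sigma>\<close>.\<close>
  obtain \<sigma>' where s': "\<sigma>' \<in> hom C a W" "q1 \<cdot> \<sigma>' = \<tau> \<cdot> ta" "q2 \<cdot> \<sigma>' = \<sigma>"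
    using product_lift[OF pr Comp_hom[OF ta c(3)] \<sigma>(2)] .
  have s'_mono: "is_mono C \<sigma>'"
    unfolding is_mono_def
  proof (intro conjI allI ballI impI)
    show "\<sigma>' \<in> Ar C" using homD(1)[OF s'(1)] .
    fix w f g assume "f \<in> hom C w (Dom C \<sigma>')" "g \<in> hom C w (Dom C \<sigma>')" and eq: "\<sigma>' \<cdot> f = \<sigma>' \<cdot> g"
    then have fg: "f \<in> hom C w a" "g \<in> hom C w a" using homD(2)[OF s'(1)] by auto
    have "\<sigma> \<cdot> f = \<sigma> \<cdot> g"
      using Comp_assoc[OF fg(1) s'(1) q(3)] Comp_assoc[OF fg(2) s'(1) q(3)] s'(3) eq by simp
    then show "f = g" using monoD[OF \<sigma>(1), of f g] fg \<sigma>(2) by (simp add: hom_def)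
  qed
  have s'_iff: "factors C \<sigma>' k \<longleftrightarrow> factors C \<tau> (q1 \<cdot> k) \<and> factors C \<sigma> (q2 \<cdot> k)"
    if k: "k \<in> hom C w W" for w k
  proof (intro iffI conjI)
    assume "factors C \<sigma>' k"
    then obtain j where j: "j \<in> hom C w a" "k = \<sigma>' \<cdot> j" using factorsE s'(1) k by metis
    have "q1 \<cdot> k = \<tau> \<cdot> (ta \<cdot> j)" "q2 \<cdot> k = \<sigma> \<cdot> j"
      using Comp_assoc[OF j(1) s'(1) q(2)] Comp_assoc[OF j(1) s'(1) q(3)] s'(2,3) j(2)
        Comp_assoc[OF j(1) ta c(3)] by simp_all
    then show "factors C \<tau> (q1 \<cdot> k)" "factors C \<sigma> (q2 \<cdot> k)"
      using factorsI[OF Comp_hom[OF j(1) ta] c(3)] factorsI[OF j(1) \<sigma>(2)] by simp_all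
  next
    assume *: "factors C \<tau> (q1 \<cdot> k) \<and> factors C \<sigma> (q2 \<cdot> k)"
    obtain i where i: "i \<in> hom C w t" "q1 \<cdot> k = \<tau> \<cdot> i"
      using factorsE[OF _ c(3) Comp_hom[OF k q(2)]] * by blast
    obtain j where j: "j \<in> hom C w a" "q2 \<cdot> k = \<sigma> \<cdot> j"
      using factorsE[OF _ \<sigma>(2) Comp_hom[OF k q(3)]] * by blast
    have "i = ta \<cdot> j" using terminal_unique[OF c(1) i(1)] Comp_hom[OF j(1) ta] by blast
    then have "q1 \<cdot> k = q1 \<cdot> (\<sigma>' \<cdot> j)" "q2 \<cdot> k = q2 \<cdot> (\<sigma>' \<cdot> j)"
      using Comp_assoc[OF j(1) s'(1) q(2)] Comp_assoc[OF j(1) s'(1) q(3)] s'(2,3) j(2)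
        Comp_assoc[OF j(1) ta c(3)] i(2) by metis+
    then have "k = \<sigma>' \<cdot> j" using product_unique[OF pr k Comp_hom[OF j(1) s'(1)]] by blast
    then show "factors C \<sigma>' k" using factorsI j(1) s'(1) by blast
  qed
  \<comment> \<open>On a pair \<open>(u, v)\<close>, \<open>\<psi>\<close> is the conjunction of
    \<open>u\<close> with \<open>v\<close> being in \<open>\<sigma>\<close>. A conjunction equals
    its first member exactly if that member implies the other, hence the equalizer with
    \<open>q1\<close>.\<close>
  obtain \<psi> where psi: "\<psi> \<in> hom C W \<Omega>"
    "\<And>x f. f \<in> hom C x W \<Longrightarrow> factors C \<tau> (\<psi> \<cdot> f) \<longleftrightarrow> factors C \<sigma>' f"
    using classify[OF cl s'_mono s'(1)] by blast
  obtain P e where e: "e \<in> hom C P W" "\<psi> \<cdot> e = q1 \<cdot> e" "is_mono C e"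
    "\<forall>w. \<forall>k \<in> hom C w W. \<psi> \<cdot> k = q1 \<cdot> k \<longrightarrow> (\<exists>u \<in> hom C w P. e \<cdot> u = k)"
    using equalizer_exists[OF lim c(1) psi(1) q(2)] .
  have eq: "(q1 \<cdot> e) \<cdot> z = q1 \<cdot> (e \<cdot> z)" "(q2 \<cdot> e) \<cdot> z = q2 \<cdot> (e \<cdot> z)" "e \<cdot> z \<in> hom C w W"
    if "z \<in> hom C w P" for z w
    using Comp_assoc[OF that e(1)] Comp_hom[OF that e(1)] q by auto
  show thesis
  proof
    show "q1 \<cdot> e \<in> hom C P \<Omega>" "q2 \<cdot> e \<in> hom C P b" using e(1) q Comp_hom by blast+
    show "\<forall>w. \<forall>z \<in> hom C w P. factors C \<tau> ((q1 \<cdot> e) \<cdot> z) \<longrightarrow> factors C \<sigma> ((q2 \<cdot> e) \<cdot> z)"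
    proof (intro allI ballI impI)
      fix w z assume z: "z \<in> hom C w P" and fz: "factors C \<tau> ((q1 \<cdot> e) \<cdot> z)"
      have "\<psi> \<cdot> (e \<cdot> z) = (q1 \<cdot> e) \<cdot> z"
        using Comp_assoc[OF z e(1) psi(1)] e(2) by simp
      then have "factors C \<sigma>' (e \<cdot> z)" using psi(2)[OF eq(3)[OF z]] fz by metis
      then show "factors C \<sigma> ((q2 \<cdot> e) \<cdot> z)" using s'_iff[OF eq(3)[OF z]] eq(2)[OF z] by simp
    qed
    show "\<forall>w. \<forall>f \<in> hom C w P. \<forall>g \<in> hom C w P. (q1 \<cdot> e) \<cdot> f = (q1 \<cdot> e) \<cdot> g
        \<longrightarrow> (q2 \<cdot> e) \<cdot> f = (q2 \<cdot> e) \<cdot> g \<longrightarrow> f = g"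
    proof (intro allI ballI impI)
      fix w f g assume fg: "f \<in> hom C w P" "g \<in> hom C w P" "(q1 \<cdot> e) \<cdot> f = (q1 \<cdot> e) \<cdot> g"
        "(q2 \<cdot> e) \<cdot> f = (q2 \<cdot> e) \<cdot> g"
      have "e \<cdot> f = e \<cdot> g"
        using product_unique[OF pr eq(3)[OF fg(1)] eq(3)[OF fg(2)]] fg(3,4) eq[OF fg(1)] eq[OF fg(2)]
        by simp
      then show "f = g" using monoD[OF e(3), of f g] fg(1,2) e(1) by (simp add: hom_def)
    qed
    have "\<exists>f \<in> hom C w P. (q1 \<cdot> e) \<cdot> f = u \<and> (q2 \<cdot> e) \<cdot> f = v"
      if uv: "u \<in> hom C w \<Omega>" "v \<in> hom C w b"
      and imp: "\<forall>x. \<forall>z \<in> hom C x w. factors C \<tau> (u \<cdot> z) \<longrightarrow> factors C \<sigma> (v \<cdot> z)" for w u v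
    proof -
      obtain k where k: "k \<in> hom C w W" "q1 \<cdot> k = u" "q2 \<cdot> k = v" using product_lift[OF pr uv] .
      \<comment> \<open>Under the implication, the conjunction and \<open>u\<close> are true on the
        same generalized elements.\<close>
      have "\<psi> \<cdot> k = u"
      proof (rule truth_value_ext[OF lim cl Comp_hom[OF k(1) psi(1)] uv(1)])
        fix x z assume z: "z \<in> hom C x w"
        have "factors C \<tau> (\<psi> \<cdot> (k \<cdot> z)) \<longleftrightarrow> factors C \<tau> (q1 \<cdot> (k \<cdot> z)) \<and> factors C \<sigma> (q2 \<cdot> (k \<cdot> z))"
          using psi(2) s'_iff Comp_hom[OF z k(1)] by blast
        also have "\<dots> \<longleftrightarrow> factors C \<tau> (u \<cdot> z) \<and> factors C \<sigma> (v \<cdot> z)"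
          using Comp_assoc[OF z k(1) q(2)] Comp_assoc[OF z k(1) q(3)] k(2,3) by simp
        finally show "factors C \<tau> ((\<psi> \<cdot> k) \<cdot> z) \<longleftrightarrow> factors C \<tau> (u \<cdot> z)"
          using imp z Comp_assoc[OF z k(1) psi(1)] by auto
      qed
      then obtain f where f: "f \<in> hom C w P" "e \<cdot> f = k" using e(4) k by metis
      show ?thesis using f eq[OF f(1)] k by metis
    qed
    then show "\<forall>w. \<forall>u \<in> hom C w \<Omega>. \<forall>v \<in> hom C w b.
        (\<forall>x. \<forall>z \<in> hom C x w. factors C \<tau> (u \<cdot> z) \<longrightarrow> factors C \<sigma> (v \<cdot> z)) \<longrightarrow>
        (\<exists>f \<in> hom C w P. (q1 \<cdot> e) \<cdot> f = u \<and> (q2 \<cdot> e) \<cdot> f = v)" by blast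
  qed
qed

end

text \<open>The image cone is again a product cone and pairings are unique, so this holds as an
  equation, without a comparison isomorphism.\<close>

lemma lex_pairing:
  assumes lex: "lex_functor C D F" and t: "is_terminal C t" and pr: "is_product C x y v p q"
    and fg: "f \<in> hom C w x" "g \<in> hom C w y"
  shows "pairing D (fob F v) (far F p) (far F q) (far F f) (far F g) = far F (pairing C v p q f g)"
proof -
  interpret cat_functor C D F using lex by (simp add: functor_iff lex_functor_def)
  note u = C.pairing[OF pr fg] and h = C.productE[OF pr]
  show ?thesis
  proof (rule D.pairing_unique[OF lex_product[OF lex t pr] far_hom[OF u(1)]])
    show "far F p \<cdot>\<^bsub>D\<^esub> far F (pairing C v p q f g) = far F f"
      "far F q \<cdot>\<^bsub>D\<^esub> far F (pairing C v p q f g) = far F g"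
      using u h far_Comp[of "pairing C v p q f g" p] far_Comp[of "pairing C v p q f g" q]
      by (auto simp: hom_def)
  qed
qed

section \<open>The gluing and its limits\<close>

context category
begin

lemma square_paste:
  assumes "f \<in> hom C x y" "f' \<in> hom C y z" "k \<in> hom C u v" "k' \<in> hom C v w"
    "l \<in> hom C x u" "l' \<in> hom C y v" "l'' \<in> hom C z w" "l' \<cdot> f = k \<cdot> l" "l'' \<cdot> f' = k' \<cdot> l'"
  shows "l'' \<cdot> (f' \<cdot> f) = (k' \<cdot> k) \<cdot> l"
  using assms Comp_assoc[OF assms(1,2,7)] Comp_assoc[OF assms(1,6,4)] Comp_assoc[OF assms(5,3,4)]
  by metis

text \<open>A Yoneda argument: \<open>\<Phi>\<close> is determined by its value on the two
  projections of \<open>a \<times> x\<close>, and \<open>m\<close> is the transpose of that value.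
  It yields the two arrows into \<open>F(h')^n\<close> from which the exponential of the gluing is
  formed.\<close>

lemma application_representable:
  assumes lim: "has_finite_limits C" and t: "is_terminal C t" and a: "a \<in> Ob C" "x \<in> Ob C"
    and app: "is_application C x y e app"
    and hom: "\<And>w k s. k \<in> hom C w a \<Longrightarrow> s \<in> hom C w x \<Longrightarrow> \<Phi> k s \<in> hom C w y"
    and nat: "\<And>w z k s f. k \<in> hom C w a \<Longrightarrow> s \<in> hom C w x \<Longrightarrow> f \<in> hom C z w
                \<Longrightarrow> \<Phi> (k \<cdot> f) (s \<cdot> f) = \<Phi> k s \<cdot> f"
  shows "\<exists>m \<in> hom C a e. \<forall>w. \<forall>k \<in> hom C w a. \<forall>s \<in> hom C w x. app (m \<cdot> k) s = \<Phi> k s"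
proof -
  obtain v p q where pr: "is_product C a x v p q" using product_exists[OF lim t a] .
  note h = productE[OF pr]
  obtain m where m: "m \<in> hom C a e" "app (m \<cdot> p) q = \<Phi> p q"
    using application_transpose[OF app pr hom[OF h(2,3)]] .
  have "app (m \<cdot> k) s = \<Phi> k s" if ks: "k \<in> hom C w a" "s \<in> hom C w x" for w k s
  proof -
    obtain u where u: "u \<in> hom C w v" "p \<cdot> u = k" "q \<cdot> u = s" using product_lift[OF pr ks] .
    show ?thesis
      using application_comp[OF app Comp_hom[OF h(2) m(1)] h(3) u(1)] m(2) nat[OF h(2,3) u(1)]
        Comp_assoc[OF u(1) h(2) m(1)] u(2,3) by simp
  qed
  then show ?thesis using m(1) by blast
qed

end

lemma (in cat_functor) far_cone:
  assumes "is_functor J C D'" "is_cone J C D' v p"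
  shows "is_cone J D (F \<odot> D') (fob F v) (\<lambda>j. far F (p j))"
proof -
  interpret J: cat_functor J C D' using assms(1) by (simp add: functor_iff)
  show ?thesis
    unfolding is_cone_def
  proof (intro conjI ballI allI)
    fix i j u assume u: "u \<in> hom J i j"
    then have "i \<in> Ob J" using J.C.hom_Ob by blast
    then have p: "p i \<in> hom C v (fob D' i)" "far D' u \<cdot>\<^bsub>C\<^esub> p i = p j"
      using assms(2) u by (auto simp: is_cone_def)
    then show "far (F \<odot> D') u \<cdot>\<^bsub>D\<^esub> far F (p i) = far F (p j)"
      using J.far_hom[OF u] far_Comp[of "p i" "far D' u"] by (simp add: hom_def)
  qed (use assms(2) far_hom in \<open>auto simp: is_cone_def\<close>)
qed

section \<open>The gluing as a category, with its two projections\<close>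

definition pi1 ::
  "(('no, 'na, 'ho) gl_ob, ('no, 'na, 'ho, 'ha) gl_ar, 'no, 'na) functor_data" where
  "pi1 = \<lparr> fob = (\<lambda>(n, h, l). n), far = (\<lambda>(a, b, f, g). f) \<rparr>"

abbreviation lab :: "('no, 'na, 'ho) gl_ob \<Rightarrow> 'na" where
  "lab x \<equiv> snd (snd x)"

lemma pi_simps [simp]:
  "fob pi1 (n, h, l) = n" "fob pi2 (n, h, l) = h"
  "far pi1 (x, y, f, g) = f" "far pi2 (x, y, f, g) = g"
  by (simp_all add: pi1_def pi2_def)

locale gluing = N: topos N + H: topos H
  for N :: "('no, 'na) topos" and H :: "('ho, 'ha) topos" +
  fixes F :: "('ho, 'ha, 'no, 'na) functor_data"
  assumes lex: "lex_functor H N F"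
begin

text \<open>\<open>fob pi1\<close> alone leaves the type of arrows of \<open>H\<close> undetermined; these abbreviations fix it.\<close>

abbreviation P1 :: "(('no, 'na, 'ho) gl_ob, ('no, 'na, 'ho, 'ha) gl_ar, 'no, 'na) functor_data" where
  "P1 \<equiv> pi1"
abbreviation P2 :: "(('no, 'na, 'ho) gl_ob, ('no, 'na, 'ho, 'ha) gl_ar, 'ho, 'ha) functor_data" where
  "P2 \<equiv> pi2"
abbreviation G where "G \<equiv> Gl N H F"
abbreviation K where "K \<equiv> pi1_star N H F"
abbreviation R where "R \<equiv> pi2_star N H F"

sublocale F: cat_functor H N F
  using lex by (simp add: functor_iff lex_functor_def)

lemma Ob_G: "x \<in> Ob G \<longleftrightarrow> fob P1 x \<in> Ob N \<and> fob P2 x \<in> Ob H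
    \<and> lab x \<in> hom N (fob P1 x) (fob F (fob P2 x))"
  by (cases x) (simp add: Gl_def Gl_Ob_def)

lemma Ob_G_tuple [simp]: "(n, h, l) \<in> Ob G \<longleftrightarrow> h \<in> Ob H \<and> l \<in> hom N n (fob F h)"
  using N.hom_Ob by (auto simp: Ob_G)

lemma lab_hom: "x \<in> Ob G \<Longrightarrow> lab x \<in> hom N (fob P1 x) (fob F (fob P2 x))"
  by (simp add: Ob_G)

lemma hom_G [simp]:
  "(x, y, f, g) \<in> hom G x' y' \<longleftrightarrow> x = x' \<and> y = y' \<and> x \<in> Ob G \<and> y \<in> Ob G
     \<and> f \<in> hom N (fob P1 x) (fob P1 y) \<and> g \<in> hom H (fob P2 x) (fob P2 y)
     \<and> lab y \<cdot>\<^bsub>N\<^esub> f = far F g \<cdot>\<^bsub>N\<^esub> lab x"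
  by (cases x; cases y) (auto simp: Gl_def Gl_Ar_def hom_def)

lemma hom_GE:
  assumes "u \<in> hom G x y"
  obtains f g where "u = (x, y, f, g)" "x \<in> Ob G" "y \<in> Ob G"
    "f \<in> hom N (fob P1 x) (fob P1 y)" "g \<in> hom H (fob P2 x) (fob P2 y)"
    "lab y \<cdot>\<^bsub>N\<^esub> f = far F g \<cdot>\<^bsub>N\<^esub> lab x"
  using assms by (cases u) auto

lemma Comp_G [simp]: "(y', z, f', g') \<cdot>\<^bsub>G\<^esub> (x, y, f, g) = (x, z, f' \<cdot>\<^bsub>N\<^esub> f, g' \<cdot>\<^bsub>H\<^esub> g)"
  by (simp add: Gl_def)

lemma Ident_G: "Ident G x = (x, x, Ident N (fob P1 x), Ident H (fob P2 x))"
  by (cases x) (simp add: Gl_def)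

lemma far_F_Comp: "f \<in> hom H x y \<Longrightarrow> g \<in> hom H y z \<Longrightarrow> far F (g \<cdot>\<^bsub>H\<^esub> f) = far F g \<cdot>\<^bsub>N\<^esub> far F f"
  using far_Comp_hom[OF F.functoriality] .

lemma Ar_G: "u \<in> Ar G \<Longrightarrow> u \<in> hom G (Dom G u) (Cod G u)"
  by (simp add: hom_def)

sublocale G: category G
proof
  fix u assume "u \<in> Ar G"
  from Ar_G[OF this] show "Dom G u \<in> Ob G" "Cod G u \<in> Ob G" by (auto elim: hom_GE)
next
  fix x assume "x \<in> Ob G"
  then show "Ident G x \<in> hom G x x"
    by (auto simp: Ident_G Ob_G N.Ident_hom H.Ident_hom hom_def[of N])
next
  fix f x y g z assume "f \<in> hom G x y" "g \<in> hom G y z"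
  then show "g \<cdot>\<^bsub>G\<^esub> f \<in> hom G x z"
    by (elim hom_GE) (auto simp: far_F_Comp intro!: N.Comp_hom H.Comp_hom
      N.square_paste[OF _ _ F.far_hom F.far_hom lab_hom lab_hom lab_hom])
next
  fix f x y assume "f \<in> hom G x y"
  then show "f \<cdot>\<^bsub>G\<^esub> Ident G x = f" "Ident G y \<cdot>\<^bsub>G\<^esub> f = f"
    by (auto elim!: hom_GE simp: Ident_G N.Comp_Ident H.Comp_Ident N.Ident_Comp H.Ident_Comp)
next
  fix f w x g y h z assume "f \<in> hom G w x" "g \<in> hom G x y" "h \<in> hom G y z"
  then show "(h \<cdot>\<^bsub>G\<^esub> g) \<cdot>\<^bsub>G\<^esub> f = h \<cdot>\<^bsub>G\<^esub> (g \<cdot>\<^bsub>G\<^esub> f)"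
    by (auto elim!: hom_GE simp: N.Comp_assoc H.Comp_assoc)
qed

lemma pi1_hom: "u \<in> hom G x y \<Longrightarrow> far P1 u \<in> hom N (fob P1 x) (fob P1 y)"
  and pi2_hom: "u \<in> hom G x y \<Longrightarrow> far P2 u \<in> hom H (fob P2 x) (fob P2 y)"
  and lab_square: "u \<in> hom G x y \<Longrightarrow> lab y \<cdot>\<^bsub>N\<^esub> far P1 u = far F (far P2 u) \<cdot>\<^bsub>N\<^esub> lab x"
  by (auto elim: hom_GE)

lemma hom_G_eqI:
  "u \<in> hom G x y \<Longrightarrow> u' \<in> hom G x y \<Longrightarrow> far P1 u = far P1 u' \<Longrightarrow> far P2 u = far P2 u' \<Longrightarrow> u = u'"
  by (auto elim!: hom_GE)

lemma pi1_functor: "is_functor G N P1" and pi2_functor: "is_functor G H P2"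
proof -
  have Comp: "far P1 (g \<cdot>\<^bsub>G\<^esub> f) = far P1 g \<cdot>\<^bsub>N\<^esub> far P1 f" "far P2 (g \<cdot>\<^bsub>G\<^esub> f) = far P2 g \<cdot>\<^bsub>H\<^esub> far P2 f"
    if "f \<in> hom G x y" "g \<in> hom G y z" for f g x y z
    using that by (auto elim!: hom_GE)
  have Ob: "fob P1 x \<in> Ob N" "fob P2 x \<in> Ob H" if "x \<in> Ob G" for x
    using that by (simp_all add: Ob_G)
  have Id: "far P1 (Ident G x) = Ident N (fob P1 x)" "far P2 (Ident G x) = Ident H (fob P2 x)" for x
    by (simp_all add: Ident_G)
  show "is_functor G N pi1" "is_functor G H pi2"
    unfolding is_functor_def by (intro conjI ballI allI Ob Id Comp pi1_hom pi2_hom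
      G.category_axioms N.category_axioms H.category_axioms; assumption)+
qed

lemmas pi1_Comp = far_Comp_hom[OF pi1_functor] and pi2_Comp = far_Comp_hom[OF pi2_functor]

section \<open>Finite limits in the gluing\<close>

lemma far_F_limit:
  assumes "finite_diagram J H D" "is_limit J H D v p"
  shows "is_limit J N (F \<odot> D) (fob F v) (\<lambda>j. far F (p j))"
  using lex assms by (simp add: lex_functor_def preserves_finite_limits_def)

text \<open>The components of a lift exist and are unique separately. That they form an arrow of the
  gluing is tested against the images under \<open>F\<close> of the legs in \<open>H\<close>, which
  are jointly monic because \<open>F\<close> preserves this limit.\<close>

lemma limit_G:
  assumes D: "finite_diagram J G D" and cone: "is_cone J G D v p"
    and lim1: "is_limit J N (P1 \<odot> D) (fob P1 v) (\<lambda>j. far P1 (p j))"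
    and lim2: "is_limit J H (P2 \<odot> D) (fob P2 v) (\<lambda>j. far P2 (p j))"
  shows "is_limit J G D v p"
  unfolding is_limit_def
proof (intro conjI allI impI)
  have DG: "is_functor J G D" using D by (simp add: finite_diagram_def)
  note cone_pi1 = cat_functor.far_cone[OF pi1_functor[folded functor_iff] DG]
    and cone_pi2 = cat_functor.far_cone[OF pi2_functor[folded functor_iff] DG]
  have lim3: "is_limit J N (F \<odot> P2 \<odot> D) (fob F (fob P2 v)) (\<lambda>j. far F (far P2 (p j)))"
    using far_F_limit[OF finite_diagram_comp[OF D pi2_functor] lim2] .
  have p: "p j \<in> hom G v (fob D j)" if "j \<in> Ob J" for j
    using cone that by (simp add: is_cone_def)
  show "is_cone J G D v p" by fact
  fix w q assume q: "is_cone J G D w q"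
  have qj: "q j \<in> hom G w (fob D j)" if "j \<in> Ob J" for j
    using q that by (simp add: is_cone_def)
  have v: "v \<in> Ob G" and w: "w \<in> Ob G" using cone q by (auto simp: is_cone_def)
  obtain f where f: "f \<in> hom N (fob P1 w) (fob P1 v)"
    and fj: "\<And>j. j \<in> Ob J \<Longrightarrow> far P1 (p j) \<cdot>\<^bsub>N\<^esub> f = far P1 (q j)"
    using N.limit_lift[OF lim1 cone_pi1[OF q]] by auto
  obtain g where g: "g \<in> hom H (fob P2 w) (fob P2 v)"
    and gj: "\<And>j. j \<in> Ob J \<Longrightarrow> far P2 (p j) \<cdot>\<^bsub>H\<^esub> g = far P2 (q j)"
    using H.limit_lift[OF lim2 cone_pi2[OF q]] by auto
  \<comment> \<open>\<open>c\<close> and \<open>c'\<close> are the two sides of the square that the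
    pair \<open>(f, g)\<close> has to make commute.\<close>
  define c where "c = far F g \<cdot>\<^bsub>N\<^esub> lab w"
  have c: "c \<in> hom N (fob P1 w) (fob F (fob P2 v))"
    unfolding c_def using N.Comp_hom[OF lab_hom[OF w] F.far_hom[OF g]] .
  define c' where "c' = lab v \<cdot>\<^bsub>N\<^esub> f"
  have c': "c' \<in> hom N (fob P1 w) (fob F (fob P2 v))"
    unfolding c'_def using N.Comp_hom[OF f lab_hom[OF v]] .
  have eq: "far F (far P2 (p j)) \<cdot>\<^bsub>N\<^esub> c = far F (far P2 (p j)) \<cdot>\<^bsub>N\<^esub> c'" if j: "j \<in> Ob J" for j
  proof -
    have Dj: "fob D j \<in> Ob G" using p[OF j] G.hom_Ob by blast
    have "far F (far P2 (p j)) \<cdot>\<^bsub>N\<^esub> c = far F (far P2 (p j) \<cdot>\<^bsub>H\<^esub> g) \<cdot>\<^bsub>N\<^esub> lab w"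
      unfolding c_def far_F_Comp[OF g pi2_hom[OF p[OF j]]]
      using N.Comp_assoc[OF lab_hom[OF w] F.far_hom[OF g] F.far_hom[OF pi2_hom[OF p[OF j]]]]
      by simp
    also have "\<dots> = lab (fob D j) \<cdot>\<^bsub>N\<^esub> (far P1 (p j) \<cdot>\<^bsub>N\<^esub> f)"
      using gj[OF j] fj[OF j] lab_square[OF qj[OF j]] by simp
    also have "\<dots> = (lab (fob D j) \<cdot>\<^bsub>N\<^esub> far P1 (p j)) \<cdot>\<^bsub>N\<^esub> f"
      using N.Comp_assoc[OF f pi1_hom[OF p[OF j]] lab_hom[OF Dj]] by simp
    also have "\<dots> = far F (far P2 (p j)) \<cdot>\<^bsub>N\<^esub> c'"
      unfolding c'_def lab_square[OF p[OF j]]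
      using N.Comp_assoc[OF f lab_hom[OF v] F.far_hom[OF pi2_hom[OF p[OF j]]]] .
    finally show ?thesis .
  qed
  \<comment> \<open>Both \<open>c\<close> and \<open>c'\<close> induce this cone, so uniqueness of
    lifts into \<open>fob F (fob P2 v)\<close> identifies them.\<close>
  have "is_cone J N (F \<odot> P2 \<odot> D) (fob P1 w) (\<lambda>j. far F (far P2 (p j)) \<cdot>\<^bsub>N\<^esub> c)"
    unfolding is_cone_def
  proof (intro conjI ballI allI)
    show "fob P1 w \<in> Ob N" using w by (simp add: Ob_G)
    show "far F (far P2 (p j)) \<cdot>\<^bsub>N\<^esub> c \<in> hom N (fob P1 w) (fob (F \<odot> P2 \<odot> D) j)" if "j \<in> Ob J" for j
      using N.Comp_hom[OF c F.far_hom[OF pi2_hom[OF p[OF that]]]] by simp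
    fix i j u assume u: "u \<in> hom J i j"
    have i: "i \<in> Ob J" using u DG by (auto simp: is_functor_def dest: category.hom_Ob)
    have "far D u \<in> hom G (fob D i) (fob D j)" using DG u by (simp add: is_functor_def)
    from pi2_hom[OF this] have "far F (far P2 (far D u)) \<in> hom N (fob F (fob P2 (fob D i))) (fob F (fob P2 (fob D j)))"
      using F.far_hom by blast
    note a = N.Comp_assoc[OF c F.far_hom[OF pi2_hom[OF p[OF i]]] this]
    have "far (F \<odot> P2 \<odot> D) u \<cdot>\<^bsub>N\<^esub> far F (far P2 (p i)) = far F (far P2 (p j))"
      using lim3 u unfolding is_limit_def is_cone_def by blast
    then show "far (F \<odot> P2 \<odot> D) u \<cdot>\<^bsub>N\<^esub> (far F (far P2 (p i)) \<cdot>\<^bsub>N\<^esub> c) = far F (far P2 (p j)) \<cdot>\<^bsub>N\<^esub> c"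
      using a by simp
  qed
  from N.limit_arrow_unique[OF lim3 this c c' refl] have "c = c'" by (simp add: eq)
  then have fg: "(w, v, f, g) \<in> hom G w v" using v w f g by (simp add: c_def c'_def)
  show "\<exists>!u. u \<in> hom G w v \<and> (\<forall>j \<in> Ob J. p j \<cdot>\<^bsub>G\<^esub> u = q j)"
  proof (intro ex1I conjI ballI)
    show "(w, v, f, g) \<in> hom G w v" by fact
    show "p j \<cdot>\<^bsub>G\<^esub> (w, v, f, g) = q j" if "j \<in> Ob J" for j
      using G.Comp_hom[OF fg p[OF that]] qj[OF that]
      by (rule hom_G_eqI)
        (use fj[OF that] gj[OF that] pi1_Comp[OF fg p[OF that]] pi2_Comp[OF fg p[OF that]] in auto)
    fix u assume u: "u \<in> hom G w v \<and> (\<forall>j \<in> Ob J. p j \<cdot>\<^bsub>G\<^esub> u = q j)"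
    then have uv: "u \<in> hom G w v" and uq: "\<And>j. j \<in> Ob J \<Longrightarrow> p j \<cdot>\<^bsub>G\<^esub> u = q j" by auto
    have "far P1 u = f"
      by (rule N.limit_arrow_unique[OF lim1 cone_pi1[OF q] pi1_hom[OF uv] f _ fj])
        (simp_all add: uq flip: pi1_Comp[OF uv p])
    moreover have "far P2 u = g"
      by (rule H.limit_arrow_unique[OF lim2 cone_pi2[OF q] pi2_hom[OF uv] g _ gj])
        (simp_all add: uq flip: pi2_Comp[OF uv p])
    ultimately show "u = (w, v, f, g)" using hom_G_eqI[OF uv fg] by simp
  qed
qed

lemma limit_G_exists:
  assumes D: "finite_diagram J G D"
  shows "\<exists>v p. is_limit J G D v p \<and> is_limit J N (P1 \<odot> D) (fob P1 v) (\<lambda>j. far P1 (p j))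
    \<and> is_limit J H (P2 \<odot> D) (fob P2 v) (\<lambda>j. far P2 (p j))"
proof -
  have DG: "is_functor J G D" using D by (simp add: finite_diagram_def)
  then interpret D: cat_functor J G D by (simp add: functor_iff)
  note D1 = finite_diagram_comp[OF D pi1_functor] and D2 = finite_diagram_comp[OF D pi2_functor]
  obtain n p where n: "is_limit J N (P1 \<odot> D) n p"
    using N.finite_limits D1 unfolding has_finite_limits_def by blast
  obtain h q where h: "is_limit J H (P2 \<odot> D) h q"
    using H.finite_limits D2 unfolding has_finite_limits_def by blast
  note h' = far_F_limit[OF D2 h]
  have p: "p j \<in> hom N n (fob P1 (fob D j))" and q: "q j \<in> hom H h (fob P2 (fob D j))"
    if "j \<in> Ob J" for j
    using n h that by (auto simp: is_limit_def is_cone_def)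
  have pu: "far P1 (far D u) \<cdot>\<^bsub>N\<^esub> p i = p j" and qu: "far P2 (far D u) \<cdot>\<^bsub>H\<^esub> q i = q j"
    if "u \<in> hom J i j" for i j u
    using n h that by (auto simp: is_limit_def is_cone_def)
  have nh: "n \<in> Ob N" "h \<in> Ob H" using n h by (auto simp: is_limit_def is_cone_def)
  \<comment> \<open>The third component of the limit object is the arrow from \<open>n\<close> to
    \<open>fob F h\<close> induced by this cone. Its defining equations are the squares of the
    projections.\<close>
  have "is_cone J N (F \<odot> P2 \<odot> D) n (\<lambda>j. lab (fob D j) \<cdot>\<^bsub>N\<^esub> p j)"
    unfolding is_cone_def
  proof (intro conjI ballI allI)
    show "n \<in> Ob N" by fact
    show "lab (fob D j) \<cdot>\<^bsub>N\<^esub> p j \<in> hom N n (fob (F \<odot> P2 \<odot> D) j)" if "j \<in> Ob J" for j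
      using N.Comp_hom[OF p[OF that] lab_hom[OF D.fob_Ob[OF that]]] by simp
    fix i j u assume u: "u \<in> hom J i j"
    note ij = D.C.hom_Ob[OF u] and Du = D.far_hom[OF u]
    have "far F (far P2 (far D u)) \<cdot>\<^bsub>N\<^esub> (lab (fob D i) \<cdot>\<^bsub>N\<^esub> p i)
      = (lab (fob D j) \<cdot>\<^bsub>N\<^esub> far P1 (far D u)) \<cdot>\<^bsub>N\<^esub> p i"
      unfolding lab_square[OF Du]
      using N.Comp_assoc[OF p[OF ij(1)] lab_hom[OF D.fob_Ob[OF ij(1)]] F.far_hom[OF pi2_hom[OF Du]]]
      by simp
    also have "\<dots> = lab (fob D j) \<cdot>\<^bsub>N\<^esub> p j"
      using N.Comp_assoc[OF p[OF ij(1)] pi1_hom[OF Du] lab_hom[OF D.fob_Ob[OF ij(2)]]] pu[OF u]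
      by simp
    finally show "far (F \<odot> P2 \<odot> D) u \<cdot>\<^bsub>N\<^esub> (lab (fob D i) \<cdot>\<^bsub>N\<^esub> p i) = lab (fob D j) \<cdot>\<^bsub>N\<^esub> p j"
      by simp
  qed
  from N.limit_lift[OF h' this] obtain l where l: "l \<in> hom N n (fob F h)"
    and lj: "\<And>j. j \<in> Ob J \<Longrightarrow> far F (q j) \<cdot>\<^bsub>N\<^esub> l = lab (fob D j) \<cdot>\<^bsub>N\<^esub> p j"
    by auto
  define v where "v = (n, h, l)"
  define r where "r = (\<lambda>j. (v, fob D j, p j, q j))"
  have v: "v \<in> Ob G" using l nh by (simp add: v_def)
  have r: "r j \<in> hom G v (fob D j)" if "j \<in> Ob J" for j
    using v p[OF that] q[OF that] lj[OF that] D.fob_Ob[OF that] by (simp add: r_def) (simp add: v_def)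
  have "is_cone J G D v r"
    unfolding is_cone_def
  proof (intro conjI ballI allI)
    fix i j u assume u: "u \<in> hom J i j"
    obtain f g where "far D u = (fob D i, fob D j, f, g)" using D.far_hom[OF u] by (rule hom_GE)
    then show "far D u \<cdot>\<^bsub>G\<^esub> r i = r j" using pu[OF u] qu[OF u] by (simp add: r_def)
  qed (fact v r)+
  moreover have "fob P1 v = n" "fob P2 v = h" "\<And>j. far P1 (r j) = p j" "\<And>j. far P2 (r j) = q j"
    by (simp_all add: v_def r_def)
  ultimately show ?thesis using limit_G[OF D, of v r] n h by (intro exI[of _ v] exI[of _ r]) simp
qed

lemma finite_limits_G: "has_finite_limits G"
  using limit_G_exists unfolding has_finite_limits_def by blast

lemma lex_pi1: "lex_functor G N P1"
  unfolding lex_functor_def preserves_finite_limits_def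
proof (intro conjI allI impI pi1_functor)
  fix J D v p assume D: "finite_diagram J G D" and lim: "is_limit J G D v p"
  obtain v' p' where "is_limit J G D v' p'"
      "is_limit J N (P1 \<odot> D) (fob P1 v') (\<lambda>j. far P1 (p' j))"
    using limit_G_exists[OF D] by blast
  then show "is_limit J N (P1 \<odot> D) (fob P1 v) (\<lambda>j. far P1 (p j))"
    using cat_functor.preserves_limit_from_one[OF pi1_functor[folded functor_iff] _ _ lim] D
    by (simp add: finite_diagram_def)
qed

lemma lex_pi2: "lex_functor G H P2"
  unfolding lex_functor_def preserves_finite_limits_def
proof (intro conjI allI impI pi2_functor)
  fix J D v p assume D: "finite_diagram J G D" and lim: "is_limit J G D v p"
  obtain v' p' where "is_limit J G D v' p'"
      "is_limit J H (P2 \<odot> D) (fob P2 v') (\<lambda>j. far P2 (p' j))"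
    using limit_G_exists[OF D] by blast
  then show "is_limit J H (P2 \<odot> D) (fob P2 v) (\<lambda>j. far P2 (p j))"
    using cat_functor.preserves_limit_from_one[OF pi2_functor[folded functor_iff] _ _ lim] D
    by (simp add: finite_diagram_def)
qed

section \<open>The functors \<open>K\<close> and \<open>R\<close>\<close>

lemma F_One: "is_terminal N (fob F (One H))"
  using lex_terminal[OF lex H.One_terminal] .

lemma One_Ob [simp]: "One H \<in> Ob H" "One N \<in> Ob N" "Zero H \<in> Ob H" "Zero N \<in> Ob N"
  using H.One_terminal N.One_terminal H.Zero_initial N.Zero_initial
  by (simp_all add: is_terminal_def is_initial_def)

lemma fob_K: "fob K n = (n, One H, the_arrow N n (fob F (One H)))"
  by (simp add: pi1_star_def pi1_star_ob_def)

lemma far_K: "f \<in> hom N n m \<Longrightarrow> far K f = (fob K n, fob K m, f, Ident H (One H))"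
  by (auto simp: pi1_star_def hom_def)

lemma fob_K_Ob: "n \<in> Ob N \<Longrightarrow> fob K n \<in> Ob G"
  by (simp add: fob_K N.terminal_arrow[OF F_One])

text \<open>The square ends in the terminal object \<open>fob F (One H)\<close> and so commutes for
  every \<open>f\<close>.\<close>

lemma far_K_hom:
  assumes f: "f \<in> hom N n m"
  shows "far K f \<in> hom G (fob K n) (fob K m)"
proof -
  note o = N.hom_Ob[OF f] and a = N.terminal_arrow[OF F_One]
  have "the_arrow N m (fob F (One H)) \<cdot>\<^bsub>N\<^esub> f
      = far F (Ident H (One H)) \<cdot>\<^bsub>N\<^esub> the_arrow N n (fob F (One H))"
    using N.Comp_hom[OF f a[OF o(2)]] N.Comp_hom[OF a[OF o(1)] F.far_hom[OF H.Ident_hom[OF One_Ob(1)]]]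
    by (rule N.terminal_unique[OF F_One])
  then show ?thesis
    using f o by (simp add: far_K[OF f] fob_K_Ob) (simp add: fob_K H.Ident_hom)
qed

lemma K_functor: "is_functor N G K"
  unfolding is_functor_def
proof (intro conjI allI ballI)
  show "far K (Ident N x) = Ident G (fob K x)" if "x \<in> Ob N" for x
    using far_K[OF N.Ident_hom[OF that]] by (simp add: Ident_G fob_K)
  show "far K (g \<cdot>\<^bsub>N\<^esub> f) = far K g \<cdot>\<^bsub>G\<^esub> far K f" if "f \<in> hom N x y" "g \<in> hom N y z" for x y z f g
    using that by (simp add: far_K[OF that(1)] far_K[OF that(2)] far_K[OF N.Comp_hom[OF that]])
qed (fact N.category_axioms G.category_axioms fob_K_Ob far_K_hom)+

lemma fob_R: "fob R h = (fob F h, h, Ident N (fob F h))"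
  by (simp add: pi2_star_def pi2_star_ob_def)

lemma far_R: "g \<in> hom H h k \<Longrightarrow> far R g = (fob R h, fob R k, far F g, g)"
  by (auto simp: pi2_star_def hom_def)

lemma fob_R_Ob: "h \<in> Ob H \<Longrightarrow> fob R h \<in> Ob G"
  by (simp add: fob_R N.Ident_hom)

lemma far_R_hom:
  assumes g: "g \<in> hom H h k"
  shows "far R g \<in> hom G (fob R h) (fob R k)"
  using H.hom_Ob[OF g] g F.far_hom[OF g] by (simp add: far_R[OF g] fob_R_Ob) (simp add: fob_R homD)

lemma R_functor: "is_functor H G R"
  unfolding is_functor_def
proof (intro conjI allI ballI)
  show "far R (Ident H x) = Ident G (fob R x)" if "x \<in> Ob H" for x
    using that far_R[OF H.Ident_hom[OF that]] by (simp add: Ident_G fob_R)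
  show "far R (g \<cdot>\<^bsub>H\<^esub> f) = far R g \<cdot>\<^bsub>G\<^esub> far R f" if "f \<in> hom H x y" "g \<in> hom H y z" for x y z f g
    using that far_F_Comp[OF that]
    by (simp add: far_R[OF that(1)] far_R[OF that(2)] far_R[OF H.Comp_hom[OF that]])
qed (fact H.category_axioms G.category_axioms fob_R_Ob far_R_hom)+

lemma lex_K: "lex_functor N G K"
  unfolding lex_functor_def preserves_finite_limits_def
proof (intro conjI allI impI K_functor)
  fix J D v p assume D: "finite_diagram J N D" and lim: "is_limit J N D v p"
  have DN: "is_functor J N D" using D by (simp add: finite_diagram_def)
  have cone: "is_cone J G (K \<odot> D) (fob K v) (\<lambda>j. far K (p j))"
    using cat_functor.far_cone[OF K_functor[folded functor_iff] DN] lim by (simp add: is_limit_def)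
  have far: "far P1 (far K f) = f" "far P2 (far K f) = Ident H (One H)" for f
    by (simp_all add: pi1_star_def)
  have "is_limit J N (P1 \<odot> K \<odot> D) (fob P1 (fob K v)) (\<lambda>j. far P1 (far K (p j)))"
    using lim by (cases D) (simp add: comp_functor_def far fob_K)
  \<comment> \<open>This diagram is constant at a terminal object, so its limit is
    \<open>One H\<close> for every shape, empty and disconnected ones included.\<close>
  moreover have "is_limit J H (P2 \<odot> K \<odot> D) (fob P2 (fob K v)) (\<lambda>j. far P2 (far K (p j)))"
    unfolding is_limit_def
  proof (intro conjI allI impI)
    show "is_cone J H (P2 \<odot> K \<odot> D) (fob P2 (fob K v)) (\<lambda>j. far P2 (far K (p j)))"
      by (simp add: is_cone_def fob_K far H.Ident_hom)
    fix w q assume q: "is_cone J H (P2 \<odot> K \<odot> D) w q"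
    then have w: "w \<in> Ob H" and q: "\<And>j. j \<in> Ob J \<Longrightarrow> q j \<in> hom H w (One H)"
      by (auto simp: is_cone_def fob_K)
    have "(\<forall>j \<in> Ob J. Ident H (One H) \<cdot>\<^bsub>H\<^esub> f = q j)" if f: "f \<in> hom H w (One H)" for f
      using H.Ident_Comp[OF f] H.terminal_unique[OF H.One_terminal f] q by simp
    then show "\<exists>!f. f \<in> hom H w (fob P2 (fob K v)) \<and> (\<forall>j \<in> Ob J. far P2 (far K (p j)) \<cdot>\<^bsub>H\<^esub> f = q j)"
      using H.One_terminal w unfolding is_terminal_def by (simp add: fob_K far) blast
  qed
  ultimately show "is_limit J G (K \<odot> D) (fob K v) (\<lambda>j. far K (p j))"
    using limit_G[OF finite_diagram_comp[OF D K_functor] cone] by simp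
qed

lemma lex_R: "lex_functor H G R"
  unfolding lex_functor_def preserves_finite_limits_def
proof (intro conjI allI impI R_functor)
  fix J D v p assume D: "finite_diagram J H D" and lim: "is_limit J H D v p"
  have DH: "is_functor J H D" using D by (simp add: finite_diagram_def)
  have cone: "is_cone J G (R \<odot> D) (fob R v) (\<lambda>j. far R (p j))"
    using cat_functor.far_cone[OF R_functor[folded functor_iff] DH] lim by (simp add: is_limit_def)
  have far: "far P1 (far R f) = far F f" "far P2 (far R f) = f" for f
    by (simp_all add: pi2_star_def)
  have "is_limit J N (P1 \<odot> R \<odot> D) (fob P1 (fob R v)) (\<lambda>j. far P1 (far R (p j)))"
    using far_F_limit[OF D lim] by (simp add: comp_functor_def far fob_R)
  moreover have "is_limit J H (P2 \<odot> R \<odot> D) (fob P2 (fob R v)) (\<lambda>j. far P2 (far R (p j)))"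
    using lim by (cases D) (simp add: comp_functor_def far fob_R)
  ultimately show "is_limit J G (R \<odot> D) (fob R v) (\<lambda>j. far R (p j))"
    using limit_G[OF finite_diagram_comp[OF D R_functor] cone] by simp
qed

section \<open>The gluing is a topos\<close>

lemma One_G_terminal: "is_terminal G (One G)"
  unfolding is_terminal_def
proof (intro conjI ballI)
  have O: "One G = (One N, One H, the_arrow N (One N) (fob F (One H)))" by (simp add: Gl_def)
  have a: "the_arrow N (One N) (fob F (One H)) \<in> hom N (One N) (fob F (One H))"
    using N.terminal_arrow[OF F_One] by simp
  then show OG: "One G \<in> Ob G" by (simp add: O)
  fix x assume x: "x \<in> Ob G"
  then have x12: "fob P1 x \<in> Ob N" "fob P2 x \<in> Ob H" by (simp_all add: Ob_G)
  note f = N.terminal_arrow[OF N.One_terminal x12(1)]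
  note g = H.terminal_arrow[OF H.One_terminal x12(2)]
  have "lab (One G) \<cdot>\<^bsub>N\<^esub> the_arrow N (fob P1 x) (One N)
      = far F (the_arrow H (fob P2 x) (One H)) \<cdot>\<^bsub>N\<^esub> lab x"
    using N.Comp_hom[OF f a] N.Comp_hom[OF lab_hom[OF x] F.far_hom[OF g]]
    by (intro N.terminal_unique[OF F_One]) (simp_all add: O)
  then have u: "(x, One G, the_arrow N (fob P1 x) (One N), the_arrow H (fob P2 x) (One H)) \<in> hom G x (One G)"
    using x OG f g by (simp add: O)
  show "\<exists>!u. u \<in> hom G x (One G)"
  proof (rule ex1I, rule u)
    fix u' assume u': "u' \<in> hom G x (One G)"
    have "far P1 u' \<in> hom N (fob P1 x) (One N)" "far P2 u' \<in> hom H (fob P2 x) (One H)"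
      using pi1_hom[OF u'] pi2_hom[OF u'] by (simp_all add: O)
    then show "u' = (x, One G, the_arrow N (fob P1 x) (One N), the_arrow H (fob P2 x) (One H))"
      using N.terminal_unique[OF N.One_terminal _ f] H.terminal_unique[OF H.One_terminal _ g]
      by (intro hom_G_eqI[OF u' u]) simp_all
  qed
qed

lemma Zero_arrow: "h \<in> Ob H \<Longrightarrow> the_arrow N (Zero N) (fob F h) \<in> hom N (Zero N) (fob F h)"
  using N.initial_arrow[OF N.Zero_initial F.fob_Ob] .

lemma Zero_G_initial: "is_initial G (Zero G)"
  unfolding is_initial_def
proof (intro conjI ballI)
  have O: "Zero G = (Zero N, Zero H, the_arrow N (Zero N) (fob F (Zero H)))" by (simp add: Gl_def)
  note a = Zero_arrow[OF One_Ob(3)]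
  then show OG: "Zero G \<in> Ob G" by (simp add: O)
  fix x assume x: "x \<in> Ob G"
  then have x12: "fob P1 x \<in> Ob N" "fob P2 x \<in> Ob H" by (simp_all add: Ob_G)
  note f = N.initial_arrow[OF N.Zero_initial x12(1)]
  note g = H.initial_arrow[OF H.Zero_initial x12(2)]
  have "lab x \<cdot>\<^bsub>N\<^esub> the_arrow N (Zero N) (fob P1 x)
      = far F (the_arrow H (Zero H) (fob P2 x)) \<cdot>\<^bsub>N\<^esub> lab (Zero G)"
    using N.Comp_hom[OF f lab_hom[OF x]] N.Comp_hom[OF a F.far_hom[OF g]]
    by (intro N.initial_unique[OF N.Zero_initial]) (simp_all add: O)
  then have u: "(Zero G, x, the_arrow N (Zero N) (fob P1 x), the_arrow H (Zero H) (fob P2 x)) \<in> hom G (Zero G) x"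
    using x OG f g by (simp add: O)
  show "\<exists>!u. u \<in> hom G (Zero G) x"
  proof (rule ex1I, rule u)
    fix u' assume u': "u' \<in> hom G (Zero G) x"
    have "far P1 u' \<in> hom N (Zero N) (fob P1 x)" "far P2 u' \<in> hom H (Zero H) (fob P2 x)"
      using pi1_hom[OF u'] pi2_hom[OF u'] by (simp_all add: O)
    then show "u' = (Zero G, x, the_arrow N (Zero N) (fob P1 x), the_arrow H (Zero H) (fob P2 x))"
      using N.initial_unique[OF N.Zero_initial _ f] H.initial_unique[OF H.Zero_initial _ g]
      by (intro hom_G_eqI[OF u' u]) simp_all
  qed
qed

text \<open>The \<open>N\<close>-component of the exponential is the pullback of \<open>n'\<^sup>n \<rightarrow> F(h')\<^sup>n\<close>
  and \<open>F(h'\<^sup>h) \<rightarrow> F(h')\<^sup>n\<close>.\<close>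

lemma exponentials_G:
  assumes x: "x \<in> Ob G" and y: "y \<in> Ob G"
  shows "\<exists>e v p q ev. is_exponential G x y e v p q ev"
proof -
  define n h l where "n = fob P1 x" and "h = fob P2 x" and "l = lab x"
  define n' h' l' where "n' = fob P1 y" and "h' = fob P2 y" and "l' = lab y"
  note defs = n_def h_def l_def n'_def h'_def l'_def
  have nh: "n \<in> Ob N" "h \<in> Ob H" "n' \<in> Ob N" "h' \<in> Ob H"
    and l: "l \<in> hom N n (fob F h)" "l' \<in> hom N n' (fob F h')"
    using x y by (simp_all add: defs Ob_G)
  obtain A appA where A: "is_application N n n' A appA"
    using N.exponentials[OF nh(1,3)] N.exponential_application by blast
  obtain B appB where B: "is_application N n (fob F h') B appB"
    using N.exponentials[OF nh(1) F.fob_Ob[OF nh(4)]] N.exponential_application by blast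
  obtain e v p q ev where ev: "is_exponential H h h' e v p q ev"
    using H.exponentials[OF nh(2,4)] by blast
  define appE where "appE = (\<lambda>k s. ev \<cdot>\<^bsub>H\<^esub> pairing H v p q k s)"
  \<comment> \<open>The image of the evaluation under \<open>F\<close>. It is a natural application
    of \<open>F(h'^h)\<close> to \<open>F(h)\<close>, but in general not a universal one; so
    \<open>F(h'^h)\<close> is mapped to the exponential \<open>B\<close> formed in
    \<open>N\<close>.\<close>
  define appF where "appF = (\<lambda>k s. far F ev \<cdot>\<^bsub>N\<^esub> pairing N (fob F v) (far F p) (far F q) k s)"
  have E: "is_application H h h' e appE"
    using H.exponential_application[OF ev] by (simp add: appE_def)
  have pr: "is_product H e h v p q" and ev_hom: "ev \<in> hom H v h'"
    using ev by (auto simp: is_exponential_def)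
  note prF = lex_product[OF lex H.One_terminal pr]
  have appF_hom: "appF k s \<in> hom N w (fob F h')"
    if "k \<in> hom N w (fob F e)" "s \<in> hom N w (fob F h)" for k s w
    unfolding appF_def using N.Comp_hom[OF N.pairing(1)[OF prF that] F.far_hom[OF ev_hom]] .
  have appF_comp: "appF (k \<cdot>\<^bsub>N\<^esub> f) (s \<cdot>\<^bsub>N\<^esub> f) = appF k s \<cdot>\<^bsub>N\<^esub> f"
    if "k \<in> hom N w (fob F e)" "s \<in> hom N w (fob F h)" "f \<in> hom N z w" for k s w f z
    unfolding appF_def N.pairing_comp[OF prF that]
    using N.Comp_assoc[OF that(3) N.pairing(1)[OF prF that(1,2)] F.far_hom[OF ev_hom]] by simp
  have appF_far: "appF (far F k) (far F s) = far F (appE k s)"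
    if "k \<in> hom H w e" "s \<in> hom H w h" for k s w
    unfolding appF_def appE_def lex_pairing[OF lex H.One_terminal pr that]
    using far_F_Comp[OF H.pairing(1)[OF pr that] ev_hom] by simp
  have AO: "A \<in> Ob N" "B \<in> Ob N" "e \<in> Ob H" using A B E by (simp_all add: is_application_def)
  \<comment> \<open>This arrow, named \<open>\<mu>\<close> below, is composition with
    \<open>l'\<close> on \<open>n'^n\<close>.\<close>
  have "\<exists>m \<in> hom N A B. \<forall>w. \<forall>k \<in> hom N w A. \<forall>s \<in> hom N w n. appB (m \<cdot>\<^bsub>N\<^esub> k) s = l' \<cdot>\<^bsub>N\<^esub> appA k s"
  proof (rule N.application_representable[OF N.finite_limits N.One_terminal AO(1) nh(1) B])
    fix w k s assume ks: "k \<in> hom N w A" "s \<in> hom N w n"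
    note a = N.application_hom[OF A ks]
    show "l' \<cdot>\<^bsub>N\<^esub> appA k s \<in> hom N w (fob F h')" using N.Comp_hom[OF a l(2)] .
    show "l' \<cdot>\<^bsub>N\<^esub> appA (k \<cdot>\<^bsub>N\<^esub> f) (s \<cdot>\<^bsub>N\<^esub> f) = (l' \<cdot>\<^bsub>N\<^esub> appA k s) \<cdot>\<^bsub>N\<^esub> f" if "f \<in> hom N z w" for z f
      unfolding N.application_comp[OF A ks that] using N.Comp_assoc[OF that a l(2)] by simp
  qed
  then obtain \<mu> where lam: "\<mu> \<in> hom N A B"
    "\<And>w k s. k \<in> hom N w A \<Longrightarrow> s \<in> hom N w n \<Longrightarrow> appB (\<mu> \<cdot>\<^bsub>N\<^esub> k) s = l' \<cdot>\<^bsub>N\<^esub> appA k s"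
    by blast
  \<comment> \<open>This arrow, named \<open>\<theta>\<close> below, is restriction along
    \<open>l\<close>: it sends \<open>k\<close> to the map taking \<open>s\<close> to
    \<open>F(ev)\<close> of \<open>k\<close> and \<open>l s\<close>.\<close>
  have "\<exists>m \<in> hom N (fob F e) B. \<forall>w. \<forall>k \<in> hom N w (fob F e). \<forall>s \<in> hom N w n.
      appB (m \<cdot>\<^bsub>N\<^esub> k) s = appF k (l \<cdot>\<^bsub>N\<^esub> s)"
  proof (rule N.application_representable[OF N.finite_limits N.One_terminal F.fob_Ob[OF AO(3)] nh(1) B])
    fix w k s assume ks: "k \<in> hom N w (fob F e)" "s \<in> hom N w n"
    note ls = N.Comp_hom[OF ks(2) l(1)]
    show "appF k (l \<cdot>\<^bsub>N\<^esub> s) \<in> hom N w (fob F h')" using appF_hom[OF ks(1) ls] .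
    show "appF (k \<cdot>\<^bsub>N\<^esub> f) (l \<cdot>\<^bsub>N\<^esub> (s \<cdot>\<^bsub>N\<^esub> f)) = appF k (l \<cdot>\<^bsub>N\<^esub> s) \<cdot>\<^bsub>N\<^esub> f" if "f \<in> hom N z w" for z f
      using appF_comp[OF ks(1) ls that] N.Comp_assoc[OF that ks(2) l(1)] by simp
  qed
  then obtain \<theta> where th: "\<theta> \<in> hom N (fob F e) B"
    "\<And>w k s. k \<in> hom N w (fob F e) \<Longrightarrow> s \<in> hom N w n \<Longrightarrow> appB (\<theta> \<cdot>\<^bsub>N\<^esub> k) s = appF k (l \<cdot>\<^bsub>N\<^esub> s)"
    by blast
  obtain P pa \<kappa> where pb: "is_pullback N \<mu> \<theta> pa \<kappa>" "pa \<in> hom N P A" "\<kappa> \<in> hom N P (fob F e)"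
      "\<mu> \<cdot>\<^bsub>N\<^esub> pa = \<theta> \<cdot>\<^bsub>N\<^esub> \<kappa>"
    using N.pullback_exists[OF N.finite_limits lam(1) th(1)] .
  define c where "c = (P, e, \<kappa>)"
  have c: "c \<in> Ob G" "fob P1 c = P" "fob P2 c = e" "lab c = \<kappa>"
    using pb(3) AO(3) by (simp_all add: c_def)
  \<comment> \<open>An arrow of the gluing carries its source, so \<open>fst s\<close> is the common
    source of \<open>k\<close> and \<open>s\<close>.\<close>
  define app where "app = (\<lambda>k s. (fst s, y, appA (pa \<cdot>\<^bsub>N\<^esub> far P1 k) (far P1 s), appE (far P2 k) (far P2 s)))"
  have "is_application G x y c app"
    unfolding is_application_def
  proof (intro conjI allI ballI impI)
    show "c \<in> Ob G" by (fact c(1))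
  next
    fix w k s assume k: "k \<in> hom G w c" and s: "s \<in> hom G w x"
    have w: "w \<in> Ob G" using G.hom_Ob[OF k] by blast
    have k1: "far P1 k \<in> hom N (fob P1 w) P" and k2: "far P2 k \<in> hom H (fob P2 w) e"
      using pi1_hom[OF k] pi2_hom[OF k] c by simp_all
    have s1: "far P1 s \<in> hom N (fob P1 w) n" and s2: "far P2 s \<in> hom H (fob P2 w) h"
      using pi1_hom[OF s] pi2_hom[OF s] by (simp_all add: defs)
    note pk = N.Comp_hom[OF k1 pb(2)] and \<kappa>k = N.Comp_hom[OF k1 pb(3)]
    \<comment> \<open>This chain shows that applying the components separately gives an arrow of the
      gluing; the pullback equation is what moves from the side of \<open>\<mu>\<close> to the side
      of \<open>\<theta>\<close>.\<close>
    have "l' \<cdot>\<^bsub>N\<^esub> appA (pa \<cdot>\<^bsub>N\<^esub> far P1 k) (far P1 s) = appB (\<mu> \<cdot>\<^bsub>N\<^esub> (pa \<cdot>\<^bsub>N\<^esub> far P1 k)) (far P1 s)"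
      using lam(2)[OF pk s1] by simp
    also have "\<mu> \<cdot>\<^bsub>N\<^esub> (pa \<cdot>\<^bsub>N\<^esub> far P1 k) = \<theta> \<cdot>\<^bsub>N\<^esub> (\<kappa> \<cdot>\<^bsub>N\<^esub> far P1 k)"
      using N.Comp_assoc[OF k1 pb(2) lam(1)] N.Comp_assoc[OF k1 pb(3) th(1)] pb(4) by simp
    also have "appB \<dots> (far P1 s) = appF (\<kappa> \<cdot>\<^bsub>N\<^esub> far P1 k) (l \<cdot>\<^bsub>N\<^esub> far P1 s)"
      using th(2)[OF \<kappa>k s1] .
    also have "\<dots> = appF (far F (far P2 k) \<cdot>\<^bsub>N\<^esub> lab w) (far F (far P2 s) \<cdot>\<^bsub>N\<^esub> lab w)"
      using lab_square[OF k] lab_square[OF s] c by (simp add: defs)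
    also have "\<dots> = far F (appE (far P2 k) (far P2 s)) \<cdot>\<^bsub>N\<^esub> lab w"
      using appF_comp[OF F.far_hom[OF k2] F.far_hom[OF s2] lab_hom[OF w]] appF_far[OF k2 s2] by simp
    finally have sq: "l' \<cdot>\<^bsub>N\<^esub> appA (pa \<cdot>\<^bsub>N\<^esub> far P1 k) (far P1 s)
      = far F (appE (far P2 k) (far P2 s)) \<cdot>\<^bsub>N\<^esub> lab w" .
    have "fst s = w" using s by (auto elim: hom_GE)
    then show "app k s \<in> hom G w y"
      using w y N.application_hom[OF A pk s1] H.application_hom[OF E k2 s2] sq by (simp add: app_def defs)
    fix z f assume f: "f \<in> hom G z w"
    have "fst (s \<cdot>\<^bsub>G\<^esub> f) = z" using f s by (auto elim!: hom_GE)
    moreover obtain f1 f2 where "f = (z, w, f1, f2)" using f by (rule hom_GE)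
    ultimately show "app (k \<cdot>\<^bsub>G\<^esub> f) (s \<cdot>\<^bsub>G\<^esub> f) = app k s \<cdot>\<^bsub>G\<^esub> f"
      using N.application_comp[OF A pk s1 pi1_hom[OF f]] H.application_comp[OF E k2 s2 pi2_hom[OF f]]
        N.Comp_assoc[OF pi1_hom[OF f] k1 pb(2)] pi1_Comp[OF f s] pi1_Comp[OF f k]
        pi2_Comp[OF f s] pi2_Comp[OF f k]
      by (simp add: app_def)
  next
    fix d w r s g assume prG: "is_product G d x w r s" and g: "g \<in> hom G w y"
    note rs = G.productE[OF prG]
    have d: "d \<in> Ob G" and w: "w \<in> Ob G" using G.hom_Ob[OF rs(2)] by auto
    have pr1: "is_product N (fob P1 d) n (fob P1 w) (far P1 r) (far P1 s)"
      and pr2: "is_product H (fob P2 d) h (fob P2 w) (far P2 r) (far P2 s)"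
      using lex_product[OF lex_pi1 One_G_terminal prG] lex_product[OF lex_pi2 One_G_terminal prG]
      by (simp_all add: defs)
    note rs1 = N.productE[OF pr1] and rs2 = H.productE[OF pr2]
    have g1: "far P1 g \<in> hom N (fob P1 w) n'" and g2: "far P2 g \<in> hom H (fob P2 w) h'"
      using pi1_hom[OF g] pi2_hom[OF g] by (simp_all add: defs)
    obtain a where a: "a \<in> hom N (fob P1 d) A" "appA (a \<cdot>\<^bsub>N\<^esub> far P1 r) (far P1 s) = far P1 g"
      using N.application_transpose[OF A pr1 g1] .
    obtain b where b: "b \<in> hom H (fob P2 d) e" "appE (b \<cdot>\<^bsub>H\<^esub> far P2 r) (far P2 s) = far P2 g"
      using H.application_transpose[OF E pr2 g2] .
    define k where "k = far F b \<cdot>\<^bsub>N\<^esub> lab d"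
    have k: "k \<in> hom N (fob P1 d) (fob F e)"
      unfolding k_def using N.Comp_hom[OF lab_hom[OF d] F.far_hom[OF b(1)]] .
    have ar: "a \<cdot>\<^bsub>N\<^esub> far P1 r \<in> hom N (fob P1 w) A" "k \<cdot>\<^bsub>N\<^esub> far P1 r \<in> hom N (fob P1 w) (fob F e)"
      using N.Comp_hom[OF rs1(2) a(1)] N.Comp_hom[OF rs1(2) k] by auto
    have kr: "k \<cdot>\<^bsub>N\<^esub> far P1 r = far F (b \<cdot>\<^bsub>H\<^esub> far P2 r) \<cdot>\<^bsub>N\<^esub> lab w"
      unfolding k_def far_F_Comp[OF rs2(2) b(1)]
      using N.Comp_assoc[OF rs1(2) lab_hom[OF d] F.far_hom[OF b(1)]] lab_square[OF rs(2)]
        N.Comp_assoc[OF lab_hom[OF w] F.far_hom[OF rs2(2)] F.far_hom[OF b(1)]] by simp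
    \<comment> \<open>The square of \<open>g\<close>, rewritten in terms of the transposes
      \<open>a\<close> and \<open>b\<close>. Both \<open>\<mu> a\<close> and
      \<open>\<theta> k\<close> thus have the same application to the generic element of
      \<open>n\<close>, which makes them equal.\<close>
    have "appB ((\<mu> \<cdot>\<^bsub>N\<^esub> a) \<cdot>\<^bsub>N\<^esub> far P1 r) (far P1 s) = l' \<cdot>\<^bsub>N\<^esub> far P1 g"
      unfolding N.Comp_assoc[OF rs1(2) a(1) lam(1)] lam(2)[OF ar(1) rs1(3)] a(2) ..
    also have "\<dots> = far F (far P2 g) \<cdot>\<^bsub>N\<^esub> lab w"
      using lab_square[OF g] by (simp add: defs)
    also have "\<dots> = appF (far F (b \<cdot>\<^bsub>H\<^esub> far P2 r) \<cdot>\<^bsub>N\<^esub> lab w) (far F (far P2 s) \<cdot>\<^bsub>N\<^esub> lab w)"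
      using appF_comp[OF F.far_hom[OF H.Comp_hom[OF rs2(2) b(1)]] F.far_hom[OF rs2(3)] lab_hom[OF w]]
        appF_far[OF H.Comp_hom[OF rs2(2) b(1)] rs2(3)] b(2) by simp
    also have "\<dots> = appF (k \<cdot>\<^bsub>N\<^esub> far P1 r) (l \<cdot>\<^bsub>N\<^esub> far P1 s)"
      using kr lab_square[OF rs(3)] by (simp add: defs)
    also have "\<dots> = appB ((\<theta> \<cdot>\<^bsub>N\<^esub> k) \<cdot>\<^bsub>N\<^esub> far P1 r) (far P1 s)"
      unfolding N.Comp_assoc[OF rs1(2) k th(1)] th(2)[OF ar(2) rs1(3)] ..
    finally have "\<mu> \<cdot>\<^bsub>N\<^esub> a = \<theta> \<cdot>\<^bsub>N\<^esub> k"
      by (rule N.application_inject[OF B pr1 N.Comp_hom[OF a(1) lam(1)] N.Comp_hom[OF k th(1)]])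
    then obtain f where f: "f \<in> hom N (fob P1 d) P" "pa \<cdot>\<^bsub>N\<^esub> f = a" "\<kappa> \<cdot>\<^bsub>N\<^esub> f = k"
      using N.pullback_lift[OF pb(1) lam(1) th(1) pb(2) a(1) k] by metis
    \<comment> \<open>Since \<open>k\<close> is \<open>far F b\<close> after the third component of
      \<open>d\<close>, the equation \<open>\<kappa> f = k\<close> is precisely the square of
      \<open>(f, b)\<close>.\<close>
    have u: "(d, c, f, b) \<in> hom G d c" using c d f b(1) by (simp add: k_def)
    have fst_s: "fst s = w" using rs(3) by (auto elim: hom_GE)
    have app_g: "app (t \<cdot>\<^bsub>G\<^esub> r) s = g \<longleftrightarrow> appA (pa \<cdot>\<^bsub>N\<^esub> far P1 t \<cdot>\<^bsub>N\<^esub> far P1 r) (far P1 s) = far P1 g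
        \<and> appE (far P2 t \<cdot>\<^bsub>H\<^esub> far P2 r) (far P2 s) = far P2 g" if t: "t \<in> hom G d c" for t
    proof -
      obtain g1 g2 where "g = (w, y, g1, g2)" using g by (rule hom_GE)
      then show ?thesis using pi1_Comp[OF rs(2) t] pi2_Comp[OF rs(2) t] fst_s by (simp add: app_def)
    qed
    show "\<exists>!t. t \<in> hom G d c \<and> app (t \<cdot>\<^bsub>G\<^esub> r) s = g"
    proof (intro ex1I conjI)
      show "(d, c, f, b) \<in> hom G d c" by fact
      show "app ((d, c, f, b) \<cdot>\<^bsub>G\<^esub> r) s = g"
        unfolding app_g[OF u] using N.Comp_assoc[OF rs1(2) f(1) pb(2)] f(2) a(2) b(2) by simp
      fix t assume "t \<in> hom G d c \<and> app (t \<cdot>\<^bsub>G\<^esub> r) s = g"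
      then have t: "t \<in> hom G d c" and tg: "app (t \<cdot>\<^bsub>G\<^esub> r) s = g" by auto
      have t1: "far P1 t \<in> hom N (fob P1 d) P" and t2: "far P2 t \<in> hom H (fob P2 d) e"
        using pi1_hom[OF t] pi2_hom[OF t] c by simp_all
      have e2: "far P2 t = b"
        using H.application_inject[OF E pr2 t2 b(1)] tg b(2) unfolding app_g[OF t] by simp
      have "appA ((pa \<cdot>\<^bsub>N\<^esub> far P1 t) \<cdot>\<^bsub>N\<^esub> far P1 r) (far P1 s) = appA (a \<cdot>\<^bsub>N\<^esub> far P1 r) (far P1 s)"
        using tg a(2) N.Comp_assoc[OF rs1(2) t1 pb(2)] unfolding app_g[OF t] by simp
      then have "pa \<cdot>\<^bsub>N\<^esub> far P1 t = pa \<cdot>\<^bsub>N\<^esub> f"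
        using N.application_inject[OF A pr1 N.Comp_hom[OF t1 pb(2)] a(1)] f(2) by simp
      \<comment> \<open>The square of \<open>t\<close> expresses \<open>\<kappa>\<close> after
        \<open>far P1 t\<close> through the second component, which is already known to be
        \<open>b\<close>.\<close>
      moreover have "\<kappa> \<cdot>\<^bsub>N\<^esub> far P1 t = \<kappa> \<cdot>\<^bsub>N\<^esub> f"
        using lab_square[OF t] c e2 f(3) by (simp add: k_def)
      ultimately have "far P1 t = f"
        by (rule N.pullback_unique[OF pb(1) lam(1) th(1) pb(2) t1 f(1)])
      then show "t = (d, c, f, b)" using hom_G_eqI[OF t u] e2 by simp
    qed
  qed
  moreover obtain w r s where "is_product G c x w r s"
    using G.product_exists[OF finite_limits_G One_G_terminal c(1) x] .
  ultimately show ?thesis using G.application_exponential by blast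
qed

text \<open>Two factorizations found separately always fit together: their square may be checked
  after \<open>far F (far P2 m)\<close>, which is a mono because \<open>pi2\<close> and
  \<open>F\<close> preserve finite limits.\<close>

lemma mono_factors_G:
  assumes m: "is_mono G m" "m \<in> hom G v w" and z: "z \<in> hom G x w"
  shows "factors G m z \<longleftrightarrow> factors N (far P1 m) (far P1 z) \<and> factors H (far P2 m) (far P2 z)"
proof (intro iffI conjI)
  assume "factors G m z"
  then obtain k where k: "k \<in> hom G x v" "z = m \<cdot>\<^bsub>G\<^esub> k" using G.factorsE m z by metis
  show "factors N (far P1 m) (far P1 z)" "factors H (far P2 m) (far P2 z)"
    using N.factorsI[OF pi1_hom[OF k(1)] pi1_hom[OF m(2)]] pi1_Comp[OF k(1) m(2)] k(2)
      H.factorsI[OF pi2_hom[OF k(1)] pi2_hom[OF m(2)]] pi2_Comp[OF k(1) m(2)] by simp_all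
next
  note m1 = pi1_hom[OF m(2)] and m2 = pi2_hom[OF m(2)]
  have v: "v \<in> Ob G" and w: "w \<in> Ob G" and x: "x \<in> Ob G" using G.hom_Ob m(2) z by blast+
  assume "factors N (far P1 m) (far P1 z) \<and> factors H (far P2 m) (far P2 z)"
  then obtain k1 k2 where k1: "k1 \<in> hom N (fob P1 x) (fob P1 v)" "far P1 z = far P1 m \<cdot>\<^bsub>N\<^esub> k1"
    and k2: "k2 \<in> hom H (fob P2 x) (fob P2 v)" "far P2 z = far P2 m \<cdot>\<^bsub>H\<^esub> k2"
    using N.factorsE[OF _ m1 pi1_hom[OF z]] H.factorsE[OF _ m2 pi2_hom[OF z]] by metis
  have "lab v \<cdot>\<^bsub>N\<^esub> k1 = far F k2 \<cdot>\<^bsub>N\<^esub> lab x"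
  proof (rule N.monoD[OF lex_mono[OF lex lex_mono[OF lex_pi2 m(1)]]])
    have "far F (far P2 m) \<cdot>\<^bsub>N\<^esub> (lab v \<cdot>\<^bsub>N\<^esub> k1) = lab w \<cdot>\<^bsub>N\<^esub> far P1 z"
      unfolding k1(2) using N.Comp_assoc[OF k1(1) lab_hom[OF v] F.far_hom[OF m2]]
        N.Comp_assoc[OF k1(1) m1 lab_hom[OF w]] lab_square[OF m(2)] by simp
    also have "\<dots> = far F (far P2 m) \<cdot>\<^bsub>N\<^esub> (far F k2 \<cdot>\<^bsub>N\<^esub> lab x)"
      unfolding lab_square[OF z] k2(2) far_F_Comp[OF k2(1) m2]
      using N.Comp_assoc[OF lab_hom[OF x] F.far_hom[OF k2(1)] F.far_hom[OF m2]] .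
    finally show "far F (far P2 m) \<cdot>\<^bsub>N\<^esub> (lab v \<cdot>\<^bsub>N\<^esub> k1) = far F (far P2 m) \<cdot>\<^bsub>N\<^esub> (far F k2 \<cdot>\<^bsub>N\<^esub> lab x)" .
  qed (use N.Comp_hom[OF k1(1) lab_hom[OF v]] N.Comp_hom[OF lab_hom[OF x] F.far_hom[OF k2(1)]]
      F.far_hom[OF m2] in \<open>simp_all add: hom_def[of N]\<close>)
  then have k: "(x, v, k1, k2) \<in> hom G x v" using x v k1(1) k2(1) by simp
  have "m \<cdot>\<^bsub>G\<^esub> (x, v, k1, k2) = z"
    using pi1_Comp[OF k m(2)] pi2_Comp[OF k m(2)] k1(2) k2(2)
    by (intro hom_G_eqI[OF G.Comp_hom[OF k m(2)] z]) simp_all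
  then show "factors G m z" using G.factorsI[OF k m(2)] by simp
qed

text \<open>The \<open>N\<close>-component of the classifier is the object of pairs \<open>u \<in> \<Omega>\<^sub>N\<close>, \<open>v \<in> F(\<Omega>\<^sub>H)\<close>
  such that \<open>u\<close> implies \<open>v = F(true)\<close>.\<close>

lemma subobject_classifier_G: "\<exists>\<Omega> \<tau>. is_subobject_classifier G (One G) \<Omega> \<tau>"
proof -
  obtain \<Omega>N \<tau>N where clN: "is_subobject_classifier N (One N) \<Omega>N \<tau>N"
    using N.subobject_classifier by blast
  obtain \<Omega>H \<tau>H where clH: "is_subobject_classifier H (One H) \<Omega>H \<tau>H"
    using H.subobject_classifier by blast
  note cN = N.classifierE[OF clN] and cH = H.classifierE[OF clH]
  define \<sigma> where "\<sigma> = far F \<tau>H"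
  have \<sigma>: "is_mono N \<sigma>" "\<sigma> \<in> hom N (fob F (One H)) (fob F \<Omega>H)"
    unfolding \<sigma>_def using lex_mono[OF lex H.terminal_source_mono[OF cH(1,3)]] F.far_hom[OF cH(3)] .
  obtain P p \<kappa> where p: "p \<in> hom N P \<Omega>N" and \<kappa>: "\<kappa> \<in> hom N P (fob F \<Omega>H)"
    and P: "\<forall>w. \<forall>z \<in> hom N w P. factors N \<tau>N (p \<cdot>\<^bsub>N\<^esub> z) \<longrightarrow> factors N \<sigma> (\<kappa> \<cdot>\<^bsub>N\<^esub> z)"
    "\<forall>w. \<forall>f \<in> hom N w P. \<forall>g \<in> hom N w P. p \<cdot>\<^bsub>N\<^esub> f = p \<cdot>\<^bsub>N\<^esub> g
      \<longrightarrow> \<kappa> \<cdot>\<^bsub>N\<^esub> f = \<kappa> \<cdot>\<^bsub>N\<^esub> g \<longrightarrow> f = g"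
    "\<forall>w. \<forall>u \<in> hom N w \<Omega>N. \<forall>v \<in> hom N w (fob F \<Omega>H).
       (\<forall>x. \<forall>z \<in> hom N x w. factors N \<tau>N (u \<cdot>\<^bsub>N\<^esub> z) \<longrightarrow> factors N \<sigma> (v \<cdot>\<^bsub>N\<^esub> z)) \<longrightarrow>
       (\<exists>f \<in> hom N w P. p \<cdot>\<^bsub>N\<^esub> f = u \<and> \<kappa> \<cdot>\<^bsub>N\<^esub> f = v)"
    using N.implication_object[OF N.finite_limits clN \<sigma>] .
  note P1 = P(1)[rule_format] and P2 = P(2)[rule_format]
  have P3: "\<exists>f \<in> hom N w P. p \<cdot>\<^bsub>N\<^esub> f = u \<and> \<kappa> \<cdot>\<^bsub>N\<^esub> f = v"
    if "u \<in> hom N w \<Omega>N" "v \<in> hom N w (fob F \<Omega>H)"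
      "\<And>x z. z \<in> hom N x w \<Longrightarrow> factors N \<tau>N (u \<cdot>\<^bsub>N\<^esub> z) \<Longrightarrow> factors N \<sigma> (v \<cdot>\<^bsub>N\<^esub> z)" for w u v
    using P(3) that by simp
  define a where "a = the_arrow N (One N) (fob F (One H))"
  have a: "a \<in> hom N (One N) (fob F (One H))"
    unfolding a_def using N.terminal_arrow[OF F_One] by simp
  have OneG: "fob P1 (One G) = One N" "fob P2 (One G) = One H" "lab (One G) = a" "One G \<in> Ob G"
    using One_G_terminal by (simp_all add: Gl_def a_def is_terminal_def)
  \<comment> \<open>The pair of truth in \<open>N\<close> and the image of truth in \<open>H\<close>
    lies in \<open>P\<close>, since its second entry factors through \<open>\<sigma>\<close> from
    the start.\<close>
  have "\<exists>f \<in> hom N (One N) P. p \<cdot>\<^bsub>N\<^esub> f = \<tau>N \<and> \<kappa> \<cdot>\<^bsub>N\<^esub> f = \<sigma> \<cdot>\<^bsub>N\<^esub> a"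
    using P3[OF cN(3) N.Comp_hom[OF a \<sigma>(2)]] N.factors_comp[OF N.factorsI[OF a \<sigma>(2)] \<sigma>(2) N.Comp_hom[OF a \<sigma>(2)]]
    by blast
  then obtain \<tau>P where \<tau>P: "\<tau>P \<in> hom N (One N) P" "p \<cdot>\<^bsub>N\<^esub> \<tau>P = \<tau>N" "\<kappa> \<cdot>\<^bsub>N\<^esub> \<tau>P = \<sigma> \<cdot>\<^bsub>N\<^esub> a" by blast
  define \<Omega> where "\<Omega> = (P, \<Omega>H, \<kappa>)"
  have \<Omega>: "\<Omega> \<in> Ob G" "fob P1 \<Omega> = P" "fob P2 \<Omega> = \<Omega>H" "lab \<Omega> = \<kappa>"
    using \<kappa> cH(2) by (simp_all add: \<Omega>_def)
  define \<tau> where "\<tau> = (One G, \<Omega>, \<tau>P, \<tau>H)"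
  have \<tau>: "\<tau> \<in> hom G (One G) \<Omega>"
    using \<tau>P cH(3) OneG \<Omega> by (simp add: \<tau>_def \<sigma>_def)
  \<comment> \<open>Once the \<open>H\<close>-component is true, the square of \<open>\<chi>\<close>
    and terminality of \<open>F(1)\<close> force the second entry of \<open>far P1 \<chi>\<close>.
    Only its first entry, seen by \<open>p\<close>, remains to be tested.\<close>
  have true_iff: "factors G \<tau> \<chi> \<longleftrightarrow> factors N \<tau>N (p \<cdot>\<^bsub>N\<^esub> far P1 \<chi>) \<and> factors H \<tau>H (far P2 \<chi>)"
    if \<chi>: "\<chi> \<in> hom G w \<Omega>" for w \<chi>
  proof -
    have \<chi>1: "far P1 \<chi> \<in> hom N (fob P1 w) P" and \<chi>2: "far P2 \<chi> \<in> hom H (fob P2 w) \<Omega>H"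
      using pi1_hom[OF \<chi>] pi2_hom[OF \<chi>] \<Omega> by simp_all
    have w: "w \<in> Ob G" using G.hom_Ob[OF \<chi>] by blast
    have \<tau>_mono: "is_mono G \<tau>" using G.terminal_source_mono[OF One_G_terminal \<tau>] .
    have "factors N \<tau>P (far P1 \<chi>) \<longleftrightarrow> factors N \<tau>N (p \<cdot>\<^bsub>N\<^esub> far P1 \<chi>)" if true2: "factors H \<tau>H (far P2 \<chi>)"
    proof
      assume "factors N \<tau>P (far P1 \<chi>)"
      then obtain k where k: "k \<in> hom N (fob P1 w) (One N)" "far P1 \<chi> = \<tau>P \<cdot>\<^bsub>N\<^esub> k"
        using N.factorsE \<tau>P(1) \<chi>1 by metis
      then show "factors N \<tau>N (p \<cdot>\<^bsub>N\<^esub> far P1 \<chi>)"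
        using N.Comp_assoc[OF k(1) \<tau>P(1) p] \<tau>P(2) N.factorsI[OF k(1) cN(3)] by simp
    next
      assume "factors N \<tau>N (p \<cdot>\<^bsub>N\<^esub> far P1 \<chi>)"
      then obtain k where k: "k \<in> hom N (fob P1 w) (One N)" "p \<cdot>\<^bsub>N\<^esub> far P1 \<chi> = \<tau>N \<cdot>\<^bsub>N\<^esub> k"
        using N.factorsE[OF _ cN(3) N.Comp_hom[OF \<chi>1 p]] by metis
      obtain b where b: "b \<in> hom H (fob P2 w) (One H)" "far P2 \<chi> = \<tau>H \<cdot>\<^bsub>H\<^esub> b"
        using H.factorsE[OF true2 cH(3) \<chi>2] .
      have "\<kappa> \<cdot>\<^bsub>N\<^esub> far P1 \<chi> = \<sigma> \<cdot>\<^bsub>N\<^esub> (far F b \<cdot>\<^bsub>N\<^esub> lab w)"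
        using lab_square[OF \<chi>] \<Omega> b(2) far_F_Comp[OF b(1) cH(3)]
          N.Comp_assoc[OF lab_hom[OF w] F.far_hom[OF b(1)] F.far_hom[OF cH(3)]]
        by (simp add: \<sigma>_def)
      also have "far F b \<cdot>\<^bsub>N\<^esub> lab w = a \<cdot>\<^bsub>N\<^esub> k"
        using N.terminal_unique[OF F_One N.Comp_hom[OF lab_hom[OF w] F.far_hom[OF b(1)]] N.Comp_hom[OF k(1) a]] .
      also have "\<sigma> \<cdot>\<^bsub>N\<^esub> (a \<cdot>\<^bsub>N\<^esub> k) = \<kappa> \<cdot>\<^bsub>N\<^esub> (\<tau>P \<cdot>\<^bsub>N\<^esub> k)"
        using N.Comp_assoc[OF k(1) a \<sigma>(2)] N.Comp_assoc[OF k(1) \<tau>P(1) \<kappa>] \<tau>P(3) by simp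
      finally have "far P1 \<chi> = \<tau>P \<cdot>\<^bsub>N\<^esub> k"
        using N.Comp_assoc[OF k(1) \<tau>P(1) p] \<tau>P(2) k(2)
        by (intro P2[OF \<chi>1 N.Comp_hom[OF k(1) \<tau>P(1)]]) simp_all
      then show "factors N \<tau>P (far P1 \<chi>)" using N.factorsI[OF k(1) \<tau>P(1)] by simp
    qed
    then show ?thesis
      unfolding mono_factors_G[OF \<tau>_mono \<tau> \<chi>] by (auto simp: \<tau>_def)
  qed
  have classify: "\<exists>!\<chi>. \<chi> \<in> hom G w \<Omega> \<and> (\<forall>x. \<forall>z \<in> hom G x w. factors G \<tau> (\<chi> \<cdot>\<^bsub>G\<^esub> z) \<longleftrightarrow> factors G m z)"
    if m: "is_mono G m" "m \<in> hom G v w" for m v w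
  proof -
    note m1 = pi1_hom[OF m(2)] and m2 = pi2_hom[OF m(2)]
    note mono1 = lex_mono[OF lex_pi1 m(1)] and mono2 = lex_mono[OF lex_pi2 m(1)]
    have v: "v \<in> Ob G" and w: "w \<in> Ob G" using G.hom_Ob m(2) by blast+
    have v2: "fob P2 v \<in> Ob H" using v by (simp add: Ob_G)
    have true_comp: "factors G \<tau> (\<chi> \<cdot>\<^bsub>G\<^esub> z) \<longleftrightarrow>
        factors N \<tau>N ((p \<cdot>\<^bsub>N\<^esub> far P1 \<chi>) \<cdot>\<^bsub>N\<^esub> far P1 z) \<and> factors H \<tau>H (far P2 \<chi> \<cdot>\<^bsub>H\<^esub> far P2 z)"
      if \<chi>: "\<chi> \<in> hom G w \<Omega>" and z: "z \<in> hom G x w" for \<chi> z x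
    proof -
      have "far P1 \<chi> \<in> hom N (fob P1 w) P" using pi1_hom[OF \<chi>] \<Omega> by simp
      from N.Comp_assoc[OF pi1_hom[OF z] this p] show ?thesis
        unfolding true_iff[OF G.Comp_hom[OF z \<chi>]] pi1_Comp[OF z \<chi>] pi2_Comp[OF z \<chi>] by simp
    qed
    obtain u where u: "u \<in> hom N (fob P1 w) \<Omega>N"
      "\<And>x f. f \<in> hom N x (fob P1 w) \<Longrightarrow> factors N \<tau>N (u \<cdot>\<^bsub>N\<^esub> f) \<longleftrightarrow> factors N (far P1 m) f"
      using N.classify[OF clN mono1 m1] by blast
    obtain c where c: "c \<in> hom H (fob P2 w) \<Omega>H"
      "\<And>x f. f \<in> hom H x (fob P2 w) \<Longrightarrow> factors H \<tau>H (c \<cdot>\<^bsub>H\<^esub> f) \<longleftrightarrow> factors H (far P2 m) f"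
      using H.classify[OF clH mono2 m2] by blast
    have m2_m2: "factors H (far P2 m) (far P2 m)"
      using H.factorsI[OF H.Ident_hom[OF v2] m2] H.Comp_Ident[OF m2] by simp
    \<comment> \<open>The second entry in \<open>P\<close> is dictated by the square of the
      characteristic arrow; the first entry is \<open>u\<close>.\<close>
    define b where "b = far F c \<cdot>\<^bsub>N\<^esub> lab w"
    have b: "b \<in> hom N (fob P1 w) (fob F \<Omega>H)"
      unfolding b_def using N.Comp_hom[OF lab_hom[OF w] F.far_hom[OF c(1)]] .
    \<comment> \<open>The pair \<open>(u, b)\<close> meets the constraint of \<open>P\<close>: where
      \<open>u\<close> holds, \<open>z\<close> comes from \<open>v\<close>, and the square of
      \<open>m\<close> carries it into \<open>F\<close> of the subobject that \<open>c\<close>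
      classifies.\<close>
    have "factors N \<sigma> (b \<cdot>\<^bsub>N\<^esub> z)" if z: "z \<in> hom N x (fob P1 w)" and uz: "factors N \<tau>N (u \<cdot>\<^bsub>N\<^esub> z)" for x z
    proof -
      obtain k where k: "k \<in> hom N x (fob P1 v)" "z = far P1 m \<cdot>\<^bsub>N\<^esub> k"
        using N.factorsE[OF _ m1 z] uz u(2)[OF z] by metis
      obtain i where i: "i \<in> hom H (fob P2 v) (One H)" "c \<cdot>\<^bsub>H\<^esub> far P2 m = \<tau>H \<cdot>\<^bsub>H\<^esub> i"
        using H.factorsE[OF _ cH(3) H.Comp_hom[OF m2 c(1)]] c(2)[OF m2] m2_m2 by metis
      have "b \<cdot>\<^bsub>N\<^esub> far P1 m = far F (c \<cdot>\<^bsub>H\<^esub> far P2 m) \<cdot>\<^bsub>N\<^esub> lab v"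
        unfolding b_def far_F_Comp[OF m2 c(1)]
        using N.Comp_assoc[OF m1 lab_hom[OF w] F.far_hom[OF c(1)]] lab_square[OF m(2)]
          N.Comp_assoc[OF lab_hom[OF v] F.far_hom[OF m2] F.far_hom[OF c(1)]] by simp
      also have "\<dots> = \<sigma> \<cdot>\<^bsub>N\<^esub> (far F i \<cdot>\<^bsub>N\<^esub> lab v)"
        unfolding i(2) far_F_Comp[OF i(1) cH(3)] \<sigma>_def
        using N.Comp_assoc[OF lab_hom[OF v] F.far_hom[OF i(1)] F.far_hom[OF cH(3)]] .
      finally have "factors N \<sigma> (b \<cdot>\<^bsub>N\<^esub> far P1 m)"
        using N.factorsI[OF N.Comp_hom[OF lab_hom[OF v] F.far_hom[OF i(1)]] \<sigma>(2)] by simp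
      from N.factors_comp[OF this \<sigma>(2) N.Comp_hom[OF m1 b] k(1)]
      show ?thesis using N.Comp_assoc[OF k(1) m1 b] k(2) by simp
    qed
    with P3[OF u(1) b] obtain f where f: "f \<in> hom N (fob P1 w) P" "p \<cdot>\<^bsub>N\<^esub> f = u" "\<kappa> \<cdot>\<^bsub>N\<^esub> f = b"
      by blast
    have \<chi>: "(w, \<Omega>, f, c) \<in> hom G w \<Omega>" using w \<Omega> f(1,3) c(1) by (simp add: b_def)
    \<comment> \<open>For uniqueness: each component of an arrow that classifies \<open>m\<close>
      must classify the corresponding component of \<open>m\<close>, and so is determined in
      \<open>N\<close> and in \<open>H\<close>.\<close>
    have classifies: "(\<forall>y. \<forall>z \<in> hom N y (fob P1 w).
          factors N \<tau>N ((p \<cdot>\<^bsub>N\<^esub> far P1 \<chi>) \<cdot>\<^bsub>N\<^esub> z) \<longleftrightarrow> factors N (far P1 m) z)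
        \<and> (\<forall>y. \<forall>z \<in> hom H y (fob P2 w).
          factors H \<tau>H (far P2 \<chi> \<cdot>\<^bsub>H\<^esub> z) \<longleftrightarrow> factors H (far P2 m) z)"
      if \<chi>: "\<chi> \<in> hom G w \<Omega>" and cl: "\<And>x z. z \<in> hom G x w \<Longrightarrow> factors G \<tau> (\<chi> \<cdot>\<^bsub>G\<^esub> z) \<longleftrightarrow> factors G m z"
      for \<chi>
    proof -
      have \<chi>1: "far P1 \<chi> \<in> hom N (fob P1 w) P" and \<chi>2: "far P2 \<chi> \<in> hom H (fob P2 w) \<Omega>H"
        using pi1_hom[OF \<chi>] pi2_hom[OF \<chi>] \<Omega> by simp_all
      note p\<chi>1 = N.Comp_hom[OF \<chi>1 p]
      have H_part: "factors H \<tau>H (far P2 \<chi> \<cdot>\<^bsub>H\<^esub> z) \<longleftrightarrow> factors H (far P2 m) z"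
        if z: "z \<in> hom H y (fob P2 w)" for y z
      proof -
        have y: "y \<in> Ob H" using H.hom_Ob[OF z] by blast
        \<comment> \<open>A test object that isolates \<open>H\<close>: an arrow out of
          \<open>Zero N\<close> extends every \<open>z\<close> to the gluing, and its
          \<open>N\<close>-component factors through any arrow with the right target.\<close>
        define o' where "o' = (Zero N, y, the_arrow N (Zero N) (fob F y))"
        define j where "j = the_arrow N (Zero N) (fob P1 w)"
        have j: "j \<in> hom N (Zero N) (fob P1 w)"
          unfolding j_def using N.initial_arrow[OF N.Zero_initial] w by (simp add: Ob_G)
        have o': "o' \<in> Ob G" using y Zero_arrow by (simp add: o'_def)
        have "lab w \<cdot>\<^bsub>N\<^esub> j = far F z \<cdot>\<^bsub>N\<^esub> lab o'"
          using N.Comp_hom[OF j lab_hom[OF w]] N.Comp_hom[OF Zero_arrow[OF y] F.far_hom[OF z]]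
          by (intro N.initial_unique[OF N.Zero_initial]) (simp_all add: o'_def)
        then have oz: "(o', w, j, z) \<in> hom G o' w" using o' w j z by (simp add: o'_def)
        have factors_j: "factors N n (q \<cdot>\<^bsub>N\<^esub> j)"
          if n: "n \<in> hom N d e" and q: "q \<in> hom N (fob P1 w) e" for d e n q
        proof -
          have i: "the_arrow N (Zero N) d \<in> hom N (Zero N) d"
            using N.initial_arrow[OF N.Zero_initial] N.hom_Ob[OF n] by blast
          have "q \<cdot>\<^bsub>N\<^esub> j = n \<cdot>\<^bsub>N\<^esub> the_arrow N (Zero N) d"
            using N.initial_unique[OF N.Zero_initial N.Comp_hom[OF j q] N.Comp_hom[OF i n]] .
          then show ?thesis using N.factorsI[OF i n] by simp
        qed
        have "factors N \<tau>N ((p \<cdot>\<^bsub>N\<^esub> far P1 \<chi>) \<cdot>\<^bsub>N\<^esub> j)"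
          using factors_j[OF cN(3) p\<chi>1] .
        moreover have "factors N (far P1 m) j"
          using factors_j[OF m1 N.Ident_hom] N.Ident_Comp[OF j] N.hom_Ob[OF j] by simp
        ultimately show ?thesis
          using cl[OF oz] true_comp[OF \<chi> oz] mono_factors_G[OF m oz] by simp
      qed
      have "factors N \<tau>N ((p \<cdot>\<^bsub>N\<^esub> far P1 \<chi>) \<cdot>\<^bsub>N\<^esub> z) \<longleftrightarrow> factors N (far P1 m) z"
        if z: "z \<in> hom N y (fob P1 w)" for y z
      proof
        assume "factors N (far P1 m) z"
        then obtain k where k: "k \<in> hom N y (fob P1 v)" "z = far P1 m \<cdot>\<^bsub>N\<^esub> k"
          using N.factorsE m1 z by metis
        have "factors G m m" using G.factorsI[OF G.Ident_hom[OF v] m(2)] G.Comp_Ident[OF m(2)] by simp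
        then have "factors N \<tau>N ((p \<cdot>\<^bsub>N\<^esub> far P1 \<chi>) \<cdot>\<^bsub>N\<^esub> far P1 m)"
          using cl[OF m(2)] true_comp[OF \<chi> m(2)] by simp
        from N.factors_comp[OF this cN(3) N.Comp_hom[OF m1 p\<chi>1] k(1)]
        show "factors N \<tau>N ((p \<cdot>\<^bsub>N\<^esub> far P1 \<chi>) \<cdot>\<^bsub>N\<^esub> z)"
          using N.Comp_assoc[OF k(1) m1 p\<chi>1] k(2) by simp
      next
        assume t: "factors N \<tau>N ((p \<cdot>\<^bsub>N\<^esub> far P1 \<chi>) \<cdot>\<^bsub>N\<^esub> z)"
        note lz = N.Comp_hom[OF z lab_hom[OF w]]
        \<comment> \<open>This is where the implication built into \<open>P\<close> is used: truth
          of the first entry yields information on the \<open>H\<close>-side.\<close>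
        have "factors N \<sigma> (\<kappa> \<cdot>\<^bsub>N\<^esub> (far P1 \<chi> \<cdot>\<^bsub>N\<^esub> z))"
          using P1[OF N.Comp_hom[OF z \<chi>1]] t N.Comp_assoc[OF z \<chi>1 p] by simp
        also have "\<kappa> \<cdot>\<^bsub>N\<^esub> (far P1 \<chi> \<cdot>\<^bsub>N\<^esub> z) = far F (far P2 \<chi>) \<cdot>\<^bsub>N\<^esub> (lab w \<cdot>\<^bsub>N\<^esub> z)"
          using N.Comp_assoc[OF z \<chi>1 \<kappa>] lab_square[OF \<chi>] \<Omega>
            N.Comp_assoc[OF z lab_hom[OF w] F.far_hom[OF \<chi>2]] by simp
        finally obtain i where i: "i \<in> hom N y (fob F (One H))"
            "far F (far P2 \<chi>) \<cdot>\<^bsub>N\<^esub> (lab w \<cdot>\<^bsub>N\<^esub> z) = far F \<tau>H \<cdot>\<^bsub>N\<^esub> i"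
          using N.factorsE[OF _ \<sigma>(2) N.Comp_hom[OF lz F.far_hom[OF \<chi>2]]] \<sigma>_def by metis
        \<comment> \<open>By \<open>H_part\<close> the second component classifies
          \<open>far P2 m\<close>; the image of this pullback under \<open>F\<close> lifts
          \<open>lab w\<close> after \<open>z\<close> to an element \<open>j\<close> of
          \<open>F\<close> of the subobject.\<close>
        obtain k where pb: "is_pullback H (far P2 \<chi>) \<tau>H (far P2 m) k"
          using H.pullback_of_truth[OF cH(1,3) mono2 m2 \<chi>2 H_part] .
        obtain j where j: "j \<in> hom N y (fob F (fob P2 v))" "far F (far P2 m) \<cdot>\<^bsub>N\<^esub> j = lab w \<cdot>\<^bsub>N\<^esub> z"
          using N.pullback_lift[OF lex_pullback[OF lex pb] F.far_hom[OF \<chi>2] F.far_hom[OF cH(3)]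
              F.far_hom[OF m2] lz i] .
        \<comment> \<open>A test object that isolates \<open>N\<close>: its arrow to
          \<open>w\<close> has \<open>far P2 m\<close> as second component, which is a member of the
          subobject, so that only \<open>z\<close> is tested.\<close>
        define o' where "o' = (y, fob P2 v, j)"
        have oz: "(o', w, z, far P2 m) \<in> hom G o' w"
          using j w z m2 v2 by (simp add: o'_def)
        have "factors G m (o', w, z, far P2 m)"
          using cl[OF oz] true_comp[OF \<chi> oz] t H_part[OF m2] m2_m2 by simp
        then show "factors N (far P1 m) z" using mono_factors_G[OF m oz] by simp
      qed
      then show ?thesis using H_part by blast
    qed
    show ?thesis
    proof (rule ex1I[of _ "(w, \<Omega>, f, c)"])
      have "factors G \<tau> ((w, \<Omega>, f, c) \<cdot>\<^bsub>G\<^esub> z) \<longleftrightarrow> factors G m z" if z: "z \<in> hom G x w" for x z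
        unfolding true_comp[OF \<chi> z] mono_factors_G[OF m z]
        using u(2)[OF pi1_hom[OF z]] c(2)[OF pi2_hom[OF z]] f(2) by simp
      then show *: "(w, \<Omega>, f, c) \<in> hom G w \<Omega> \<and>
          (\<forall>x. \<forall>z \<in> hom G x w. factors G \<tau> ((w, \<Omega>, f, c) \<cdot>\<^bsub>G\<^esub> z) \<longleftrightarrow> factors G m z)"
        using \<chi> by blast
      fix \<chi>' assume \<chi>': "\<chi>' \<in> hom G w \<Omega> \<and> (\<forall>x. \<forall>z \<in> hom G x w. factors G \<tau> (\<chi>' \<cdot>\<^bsub>G\<^esub> z) \<longleftrightarrow> factors G m z)"
      then have \<chi>'_hom: "\<chi>' \<in> hom G w \<Omega>" by blast
      have \<chi>1: "far P1 \<chi>' \<in> hom N (fob P1 w) P" and \<chi>2: "far P2 \<chi>' \<in> hom H (fob P2 w) \<Omega>H"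
        using pi1_hom[OF \<chi>'_hom] pi2_hom[OF \<chi>'_hom] \<Omega> by simp_all
      have cl: "factors N \<tau>N ((p \<cdot>\<^bsub>N\<^esub> far P1 \<chi>') \<cdot>\<^bsub>N\<^esub> z) \<longleftrightarrow> factors N (far P1 m) z"
        if "z \<in> hom N y (fob P1 w)" for y z
        using classifies[OF \<chi>'_hom] \<chi>' that by blast
      have cl': "factors H \<tau>H (far P2 \<chi>' \<cdot>\<^bsub>H\<^esub> z) \<longleftrightarrow> factors H (far P2 m) z"
        if "z \<in> hom H y (fob P2 w)" for y z
        using classifies[OF \<chi>'_hom] \<chi>' that by blast
      have eq2: "far P2 \<chi>' = c"
        by (rule H.classify_unique[OF clH mono2 m2 \<chi>2 c(1) cl' c(2)])
      have "p \<cdot>\<^bsub>N\<^esub> far P1 \<chi>' = u"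
        by (rule N.classify_unique[OF clN mono1 m1 N.Comp_hom[OF \<chi>1 p] u(1) cl u(2)])
      moreover have "\<kappa> \<cdot>\<^bsub>N\<^esub> far P1 \<chi>' = b" using lab_square[OF \<chi>'_hom] \<Omega> eq2 by (simp add: b_def)
      ultimately have "far P1 \<chi>' = f" using P2[OF \<chi>1 f(1)] f(2,3) by simp
      then show "\<chi>' = (w, \<Omega>, f, c)" using hom_G_eqI[OF \<chi>'_hom \<chi>] eq2 by simp
    qed
  qed
  have "is_subobject_classifier G (One G) \<Omega> \<tau>"
    unfolding G.subobject_classifier_iff
  proof (intro conjI allI impI One_G_terminal \<Omega>(1) \<tau>)
    fix m assume m: "is_mono G m"
    then have "m \<in> Ar G" by (simp add: is_mono_def)
    from classify[OF m Ar_G[OF this]]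
    show "\<exists>!\<chi>. \<chi> \<in> hom G (Cod G m) \<Omega>
        \<and> (\<forall>x. \<forall>z \<in> hom G x (Cod G m). factors G \<tau> (\<chi> \<cdot>\<^bsub>G\<^esub> z) \<longleftrightarrow> factors G m z)" .
  qed
  then show ?thesis by blast
qed

sublocale G: topos G
  using finite_limits_G One_G_terminal Zero_G_initial exponentials_G subobject_classifier_G
  by unfold_locales

section \<open>The adjoint split extension\<close>

definition unit :: "('no, 'na, 'ho) gl_ob \<Rightarrow> ('no, 'na, 'ho, 'ha) gl_ar" where
  "unit x = (x, fob R (fob P2 x), lab x, Ident H (fob P2 x))"

lemma unit_hom: "x \<in> Ob G \<Longrightarrow> unit x \<in> hom G x (fob R (fob P2 x))"
  using lab_hom[of x] N.Ident_Comp[of "lab x"] N.Ident_hom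
  by (simp add: unit_def fob_R_Ob Ob_G) (simp add: fob_R Ob_G H.Ident_hom)

lemma far_pi_unit: "far P1 (unit x) = lab x" "far P2 (unit x) = Ident H (fob P2 x)"
  by (simp_all add: unit_def)

text \<open>In \<open>N\<close> this equation is the square of \<open>u\<close>; in \<open>H\<close>
  both sides are \<open>far P2 u\<close>.\<close>

lemma unit_natural:
  assumes u: "u \<in> hom G x y"
  shows "unit y \<cdot>\<^bsub>G\<^esub> u = far R (far P2 u) \<cdot>\<^bsub>G\<^esub> unit x"
proof -
  note o = G.hom_Ob[OF u] and u2 = pi2_hom[OF u]
  note l = unit_hom[OF o(1)] and l' = unit_hom[OF o(2)] and r = far_R_hom[OF u2]
  have far: "far P1 (far R (far P2 u)) = far F (far P2 u)" "far P2 (far R (far P2 u)) = far P2 u"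
    by (simp_all add: pi2_star_def)
  show ?thesis
    using pi1_Comp[OF u l'] pi1_Comp[OF l r] pi2_Comp[OF u l'] pi2_Comp[OF l r] lab_square[OF u]
      H.Ident_Comp[OF u2] H.Comp_Ident[OF u2]
    by (intro hom_G_eqI[OF G.Comp_hom[OF u l'] G.Comp_hom[OF l r]]) (simp_all add: far far_pi_unit)
qed

text \<open>In \<open>N\<close> the legs \<open>p\<close> and \<open>g\<close> are identities, and
  in \<open>H\<close> the remaining two arrows are, so the square is a pullback in each
  component.\<close>

lemma unit_pullback:
  assumes x: "x \<in> Ob G"
  obtains g p where "g \<in> hom G (fob R (fob P2 x)) (fob K (fob F (fob P2 x)))"
    "is_pullback G (far K (lab x)) g p (unit x)"
proof -
  define n h l where "n = fob P1 x" and "h = fob P2 x" and "l = lab x"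
  note defs = n_def h_def l_def
  have n: "n \<in> Ob N" and h: "h \<in> Ob H" and l: "l \<in> hom N n (fob F h)"
    using x by (simp_all add: defs Ob_G)
  define b where "b = the_arrow H h (One H)"
  have b: "b \<in> hom H h (One H)" unfolding b_def using H.terminal_arrow[OF H.One_terminal h] .
  note a = N.terminal_arrow[OF F_One]
  define g where "g = (fob R h, fob K (fob F h), Ident N (fob F h), b)"
  define p where "p = (x, fob K n, Ident N n, b)"
  have sq: "f = f'" if "f \<in> hom N w (fob F (One H))" "f' \<in> hom N w (fob F (One H))" for f f' w
    using N.terminal_unique[OF F_One that] .
  have "the_arrow N (fob F h) (fob F (One H)) \<cdot>\<^bsub>N\<^esub> Ident N (fob F h) = far F b \<cdot>\<^bsub>N\<^esub> Ident N (fob F h)"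
    using N.Comp_hom[OF N.Ident_hom[OF F.fob_Ob[OF h]]] a[OF F.fob_Ob[OF h]] F.far_hom[OF b] sq by blast
  then have g: "g \<in> hom G (fob R h) (fob K (fob F h))"
    using fob_R_Ob[OF h] fob_K_Ob[OF F.fob_Ob[OF h]] b h by (simp add: g_def) (simp add: fob_R fob_K N.Ident_hom)
  have "the_arrow N n (fob F (One H)) \<cdot>\<^bsub>N\<^esub> Ident N n = far F b \<cdot>\<^bsub>N\<^esub> l"
    using N.Comp_hom[OF N.Ident_hom[OF n] a[OF n]] N.Comp_hom[OF l F.far_hom[OF b]] sq by blast
  then have p: "p \<in> hom G x (fob K n)"
    using x n fob_K_Ob[OF n] b by (simp add: p_def) (simp add: fob_K N.Ident_hom defs)
  note f = far_K_hom[OF l]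
  have q: "unit x \<in> hom G x (fob R h)" using unit_hom[OF x] by (simp add: defs)
  have far: "far P1 (far K l) = l" "far P2 (far K l) = Ident H (One H)" "far P1 g = Ident N (fob F h)"
      "far P2 g = b" "far P1 p = Ident N n" "far P2 p = b" "far P1 (unit x) = l" "far P2 (unit x) = Ident H h"
    by (simp_all add: pi1_star_def g_def p_def far_pi_unit defs)
  have ob: "fob P1 (fob K m) = m" "fob P2 (fob K m) = One H" "fob P1 (fob R k) = fob F k" "fob P2 (fob R k) = k" for m k
    by (simp_all add: fob_K fob_R)
  have one: "s = s'" if "s \<in> hom H k (One H)" "s' \<in> hom H k (One H)" for s s' k
    using H.terminal_unique[OF H.One_terminal that] .
  have "is_pullback G (far K l) g p (unit x)"
    unfolding G.pullback_iff[OF f g p q]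
  proof (intro conjI allI ballI impI)
    show "far K l \<cdot>\<^bsub>G\<^esub> p = g \<cdot>\<^bsub>G\<^esub> unit x"
      using pi1_Comp[OF p f] pi1_Comp[OF q g] pi2_Comp[OF p f] pi2_Comp[OF q g]
        N.Comp_Ident[OF l] N.Ident_Comp[OF l] H.Comp_Ident[OF b] H.Ident_Comp[OF b]
      by (intro hom_G_eqI[OF G.Comp_hom[OF p f] G.Comp_hom[OF q g]]) (simp_all add: far)
    fix w p' q' assume p': "p' \<in> hom G w (fob K n)" and q': "q' \<in> hom G w (fob R h)"
      and eq: "far K l \<cdot>\<^bsub>G\<^esub> p' = g \<cdot>\<^bsub>G\<^esub> q'"
    have w: "w \<in> Ob G" using G.hom_Ob[OF p'] by blast
    have p1: "far P1 p' \<in> hom N (fob P1 w) n" and p2: "far P2 p' \<in> hom H (fob P2 w) (One H)"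
      and q1: "far P1 q' \<in> hom N (fob P1 w) (fob F h)" and q2: "far P2 q' \<in> hom H (fob P2 w) h"
      using pi1_hom[OF p'] pi2_hom[OF p'] pi1_hom[OF q'] pi2_hom[OF q'] by (simp_all add: ob)
    \<comment> \<open>The lift takes its first component from \<open>p'\<close> and its second from
      \<open>q'\<close>. Its square holds because \<open>lq\<close> passes from \<open>p'\<close> to
      \<open>q'\<close> and objects \<open>fob R h\<close> have an identity as third
      component.\<close>
    have lq: "l \<cdot>\<^bsub>N\<^esub> far P1 p' = far P1 q'"
      using arg_cong[OF eq, of "far P1"] pi1_Comp[OF p' f] pi1_Comp[OF q' g] N.Ident_Comp[OF q1]
      by (simp add: far)
    also have "\<dots> = far F (far P2 q') \<cdot>\<^bsub>N\<^esub> lab w"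
      using lab_square[OF q'] N.Ident_Comp[OF q1] by (simp add: fob_R)
    finally have u: "(w, x, far P1 p', far P2 q') \<in> hom G w x"
      using w x p1 q2 by (simp add: defs)
    show "\<exists>!u. u \<in> hom G w x \<and> p \<cdot>\<^bsub>G\<^esub> u = p' \<and> unit x \<cdot>\<^bsub>G\<^esub> u = q'"
    proof (intro ex1I conjI)
      show "(w, x, far P1 p', far P2 q') \<in> hom G w x" by fact
      show "p \<cdot>\<^bsub>G\<^esub> (w, x, far P1 p', far P2 q') = p'"
        using pi1_Comp[OF u p] pi2_Comp[OF u p] N.Ident_Comp[OF p1] one[OF H.Comp_hom[OF q2 b] p2]
        by (intro hom_G_eqI[OF G.Comp_hom[OF u p] p']) (simp_all add: far)
      show "unit x \<cdot>\<^bsub>G\<^esub> (w, x, far P1 p', far P2 q') = q'"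
        using pi1_Comp[OF u q] pi2_Comp[OF u q] H.Ident_Comp[OF q2] lq
        by (intro hom_G_eqI[OF G.Comp_hom[OF u q] q']) (simp_all add: far)
      fix u' assume "u' \<in> hom G w x \<and> p \<cdot>\<^bsub>G\<^esub> u' = p' \<and> unit x \<cdot>\<^bsub>G\<^esub> u' = q'"
      then have u': "u' \<in> hom G w x" "p \<cdot>\<^bsub>G\<^esub> u' = p'" "unit x \<cdot>\<^bsub>G\<^esub> u' = q'" by auto
      have "far P1 u' = far P1 p'"
        using pi1_Comp[OF u'(1) p] u'(2) N.Ident_Comp[OF pi1_hom[OF u'(1)]] far(5) by (simp add: n_def)
      moreover have "far P2 u' = far P2 q'"
        using pi2_Comp[OF u'(1) q] u'(3) H.Ident_Comp[OF pi2_hom[OF u'(1)]] far(8) by (simp add: h_def)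
      ultimately show "u' = (w, x, far P1 p', far P2 q')" using hom_G_eqI[OF u'(1) u] by simp
    qed
  qed
  then show thesis using that g by (simp add: defs)
qed

lemma iso_G:
  assumes u: "(x, y, f, g) \<in> hom G x y" and iso: "is_iso N f" "is_iso H g"
  shows "is_iso G (x, y, f, g)"
proof -
  have xy: "x \<in> Ob G" "y \<in> Ob G" using G.hom_Ob[OF u] by auto
  have f: "f \<in> hom N (fob P1 x) (fob P1 y)" and g: "g \<in> hom H (fob P2 x) (fob P2 y)"
    using u by simp_all
  obtain f' where f': "f' \<in> hom N (fob P1 y) (fob P1 x)" "f' \<cdot>\<^bsub>N\<^esub> f = Ident N (fob P1 x)"
      "f \<cdot>\<^bsub>N\<^esub> f' = Ident N (fob P1 y)"
    using iso(1) f unfolding is_iso_def hom_def by auto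
  obtain g' where g': "g' \<in> hom H (fob P2 y) (fob P2 x)" "g' \<cdot>\<^bsub>H\<^esub> g = Ident H (fob P2 x)"
      "g \<cdot>\<^bsub>H\<^esub> g' = Ident H (fob P2 y)"
    using iso(2) g unfolding is_iso_def hom_def by auto
  note lx = lab_hom[OF xy(1)] and ly = lab_hom[OF xy(2)] and Fg = F.far_hom[OF g] and Fg' = F.far_hom[OF g'(1)]
  \<comment> \<open>The square of the inverse pair results from inserting \<open>far F g'\<close>
    after \<open>far F g\<close>, which is an identity, and applying the given square.\<close>
  have "lab x \<cdot>\<^bsub>N\<^esub> f' = (far F g' \<cdot>\<^bsub>N\<^esub> far F g) \<cdot>\<^bsub>N\<^esub> (lab x \<cdot>\<^bsub>N\<^esub> f')"
    using far_F_Comp[OF g g'(1)] g'(2) F.far_Ident xy N.Ident_Comp[OF N.Comp_hom[OF f'(1) lx]]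
    by (simp add: Ob_G)
  also have "\<dots> = far F g' \<cdot>\<^bsub>N\<^esub> ((far F g \<cdot>\<^bsub>N\<^esub> lab x) \<cdot>\<^bsub>N\<^esub> f')"
    using N.Comp_assoc[OF N.Comp_hom[OF f'(1) lx] Fg Fg'] N.Comp_assoc[OF f'(1) lx Fg] by simp
  also have "\<dots> = far F g' \<cdot>\<^bsub>N\<^esub> (lab y \<cdot>\<^bsub>N\<^esub> (f \<cdot>\<^bsub>N\<^esub> f'))"
    using lab_square[OF u] N.Comp_assoc[OF f'(1) f ly] by simp
  finally have "lab x \<cdot>\<^bsub>N\<^esub> f' = far F g' \<cdot>\<^bsub>N\<^esub> lab y"
    using f'(3) N.Comp_Ident[OF ly] by simp
  then have "(y, x, f', g') \<in> hom G y x" using xy f'(1) g'(1) by simp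
  then show ?thesis
    using u f' g' unfolding is_iso_def by (intro exI[of _ x] exI[of _ y] exI[of _ "(y, x, f', g')"]) (simp add: Ident_G)
qed

section \<open>The adjunction between \<open>pi2\<close> and \<open>R\<close>\<close>

lemma top_lex_GN: "top_lex G N pi1" and top_lex_K: "top_lex N G K"
  and top_lex_pi2: "top_lex G H pi2" and top_lex_R: "top_lex H G R"
  using N.topos_axioms H.topos_axioms G.topos_axioms lex_pi1 lex_pi2 lex_K lex_R
  by (simp_all add: top_lex_def)

lemma top_lex_comp:
  "top_lex A B f \<Longrightarrow> top_lex B C g \<Longrightarrow> top_lex A C (g \<odot> f)"
  by (auto simp: top_lex_def intro: lex_comp)

lemma zero_pi2_K: "is_zero N H (pi2 \<odot> K)"
  using top_lex_comp[OF top_lex_K top_lex_pi2] H.One_terminal by (simp add: is_zero_def fob_K)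

lemma top_lex_functor: "top_lex A B f \<Longrightarrow> is_functor A B f"
  by (simp add: top_lex_def lex_functor_def)

lemma nat_trans_counit: "nat_trans H H (P2 \<odot> R) id_functor (id_trans H)"
  unfolding nat_trans_def
proof (intro conjI ballI allI)
  show "is_functor H H (P2 \<odot> R)" using is_functor_comp[OF R_functor pi2_functor] .
  show "is_functor H H id_functor" using id_is_functor[OF H.category_axioms] .
  show "id_trans H \<in> extensional (Ob H)" by (simp add: id_trans_def)
  show "id_trans H x \<in> hom H (fob (P2 \<odot> R) x) (fob id_functor x)" if "x \<in> Ob H" for x
    using H.Ident_hom[OF that] that by (simp add: id_trans_def fob_R)
  show "id_trans H y \<cdot>\<^bsub>H\<^esub> far (P2 \<odot> R) f = far id_functor f \<cdot>\<^bsub>H\<^esub> id_trans H x" if f: "f \<in> hom H x y" for x y f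
    using H.hom_Ob[OF f] H.Ident_Comp[OF f] H.Comp_Ident[OF f] by (simp add: id_trans_def far_R[OF f])
qed

lemma adjunction: "right_adjoint_with_counit G H pi2 R (id_trans H)"
  unfolding right_adjoint_with_counit_def
proof (intro conjI exI[of _ "\<lambda>x \<in> Ob G. unit x"] ballI)
  show "nat_trans H H (pi2 \<odot> R) id_functor (id_trans H)" by (fact nat_trans_counit)
  show "nat_trans G G id_functor (R \<odot> P2) (\<lambda>x \<in> Ob G. unit x)"
    unfolding nat_trans_def
    using id_is_functor[OF G.category_axioms] is_functor_comp[OF pi2_functor R_functor]
      unit_hom unit_natural G.hom_Ob by auto
  show "id_trans H (fob P2 x) \<cdot>\<^bsub>H\<^esub> far P2 ((\<lambda>x \<in> Ob G. unit x) x) = Ident H (fob P2 x)"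
    if x: "x \<in> Ob G" for x
    using x H.Ident_Comp[OF H.Ident_hom] by (simp add: id_trans_def far_pi_unit Ob_G)
  show "far R (id_trans H y) \<cdot>\<^bsub>G\<^esub> (\<lambda>x \<in> Ob G. unit x) (fob R y) = Ident G (fob R y)"
    if y: "y \<in> Ob H" for y
    using y fob_R_Ob[OF y] far_R[OF H.Ident_hom[OF y]] H.Ident_Comp[OF H.Ident_hom[OF y]]
      N.Ident_Comp[OF N.Ident_hom[OF F.fob_Ob[OF y]]]
    by (simp add: id_trans_def unit_def fob_R Ident_G)
qed

text \<open>On 2-cells the property is that \<open>K\<close> is fully faithful: between objects of
  its image the second component is an endomorphism of a terminal object, so an arrow is determined
  by its first component.\<close>

lemma kernel_K: "is_2kernel TYPE(('xo, 'xa) topos) N G H K pi2"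
  unfolding is_2kernel_def
proof (intro conjI allI impI top_lex_K top_lex_pi2 zero_pi2_K)
  fix X :: "('xo, 'xa) topos" and t
  assume t: "top_lex X G t" and zero: "is_zero X H (pi2 \<odot> t)"
  interpret t: cat_functor X G t using top_lex_functor[OF t] by (simp add: functor_iff)
  define b where "b = (\<lambda>x. the_arrow H (fob P2 (fob t x)) (One H))"
  \<comment> \<open>The second component is the arrow to \<open>One H\<close>; it is invertible
    because \<open>pi2 \<odot> t\<close> is zero.\<close>
  define \<alpha> where "\<alpha> = (\<lambda>x \<in> Ob X. (fob t x, fob K (fob P1 (fob t x)), Ident N (fob P1 (fob t x)), b x))"
  have tx: "fob P1 (fob t x) \<in> Ob N" "fob P2 (fob t x) \<in> Ob H" if "x \<in> Ob X" for x
    using t.fob_Ob[OF that] by (simp_all add: Ob_G)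
  have b: "b x \<in> hom H (fob P2 (fob t x)) (One H)" if "x \<in> Ob X" for x
    unfolding b_def using H.terminal_arrow[OF H.One_terminal tx(2)[OF that]] .
  have \<alpha>: "\<alpha> x \<in> hom G (fob t x) (fob K (fob P1 (fob t x)))" if x: "x \<in> Ob X" for x
  proof -
    note l = lab_hom[OF t.fob_Ob[OF x]] and i = N.Ident_hom[OF tx(1)[OF x]]
    have "the_arrow N (fob P1 (fob t x)) (fob F (One H)) \<cdot>\<^bsub>N\<^esub> Ident N (fob P1 (fob t x))
        = far F (b x) \<cdot>\<^bsub>N\<^esub> lab (fob t x)"
      using N.terminal_unique[OF F_One N.Comp_hom[OF i N.terminal_arrow[OF F_One tx(1)[OF x]]]
          N.Comp_hom[OF l F.far_hom[OF b[OF x]]]] .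
    then show ?thesis
      using x t.fob_Ob[OF x] fob_K_Ob[OF tx(1)[OF x]] b[OF x] i
      by (simp add: \<alpha>_def) (simp add: fob_K)
  qed
  have comp: "is_functor X G (K \<odot> pi1 \<odot> t)"
    using is_functor_comp[OF is_functor_comp[OF t.functoriality pi1_functor] K_functor] .
  have "nat_iso X G t (K \<odot> pi1 \<odot> t) \<alpha>"
    unfolding nat_iso_def nat_trans_def
  proof (intro conjI ballI allI)
    show "is_functor X G t" "is_functor X G (K \<odot> pi1 \<odot> t)" by (fact t.functoriality comp)+
    show "\<alpha> \<in> extensional (Ob X)" by (simp add: \<alpha>_def)
    show "\<alpha> x \<in> hom G (fob t x) (fob (K \<odot> pi1 \<odot> t) x)" if "x \<in> Ob X" for x
      using \<alpha>[OF that] by simp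
    show "\<alpha> y \<cdot>\<^bsub>G\<^esub> far t u = far (K \<odot> pi1 \<odot> t) u \<cdot>\<^bsub>G\<^esub> \<alpha> x" if u: "u \<in> hom X x y" for x y u
    proof -
      note o = t.C.hom_Ob[OF u]
      note tu = t.far_hom[OF u] and ax = \<alpha>[OF o(1)] and ay = \<alpha>[OF o(2)]
      note ku = far_K_hom[OF pi1_hom[OF tu]]
      have "far P2 (\<alpha> y \<cdot>\<^bsub>G\<^esub> far t u) = far P2 (far K (far P1 (far t u)) \<cdot>\<^bsub>G\<^esub> \<alpha> x)"
        using pi2_hom[OF G.Comp_hom[OF tu ay]] pi2_hom[OF G.Comp_hom[OF ax ku]]
        by (intro H.terminal_unique[OF H.One_terminal]) (simp_all add: fob_K)
      moreover have "far P1 (\<alpha> y \<cdot>\<^bsub>G\<^esub> far t u) = far P1 (far K (far P1 (far t u)) \<cdot>\<^bsub>G\<^esub> \<alpha> x)"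
        using o pi1_Comp[OF tu ay] pi1_Comp[OF ax ku] N.Ident_Comp[OF pi1_hom[OF tu]]
          N.Comp_Ident[OF pi1_hom[OF tu]] far_K[OF pi1_hom[OF tu]] by (simp add: \<alpha>_def)
      ultimately show ?thesis
        using hom_G_eqI[OF G.Comp_hom[OF tu ay] G.Comp_hom[OF ax ku]] by simp
    qed
    show "is_iso G (\<alpha> x)" if x: "x \<in> Ob X" for x
    proof -
      have "is_terminal H (fob P2 (fob t x))" using zero x by (simp add: is_zero_def)
      then have "is_iso H (b x)" using H.terminal_arrow_iso[OF _ H.One_terminal b[OF x]] by blast
      then show ?thesis
        using iso_G[OF _ N.Ident_iso[OF tx(1)[OF x]]] \<alpha>[OF x] x by (simp add: \<alpha>_def)
    qed
  qed
  then show "\<exists>h \<alpha>. top_lex X N h \<and> nat_iso X G t (K \<odot> h) \<alpha>"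
    using top_lex_comp[OF t top_lex_GN] by blast
next
  fix X :: "('xo, 'xa) topos" and h h' \<alpha>
  assume h: "top_lex X N h" and h': "top_lex X N h'" and \<alpha>: "nat_trans X G (K \<odot> h) (K \<odot> h') \<alpha>"
  interpret h: cat_functor X N h using top_lex_functor[OF h] by (simp add: functor_iff)
  interpret h': cat_functor X N h' using top_lex_functor[OF h'] by (simp add: functor_iff)
  have \<alpha>x: "\<alpha> x \<in> hom G (fob K (fob h x)) (fob K (fob h' x))" if "x \<in> Ob X" for x
    using \<alpha> that by (simp add: nat_trans_def)
  have \<alpha>n: "\<alpha> y \<cdot>\<^bsub>G\<^esub> far K (far h u) = far K (far h' u) \<cdot>\<^bsub>G\<^esub> \<alpha> x" if "u \<in> hom X x y" for x y u
    using \<alpha> that by (simp add: nat_trans_def)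
  define \<gamma> where "\<gamma> = (\<lambda>x \<in> Ob X. far P1 (\<alpha> x))"
  have \<gamma>: "\<gamma> x \<in> hom N (fob h x) (fob h' x)" if "x \<in> Ob X" for x
    using pi1_hom[OF \<alpha>x[OF that]] that by (simp add: \<gamma>_def fob_K)
  show "\<exists>!\<gamma>. nat_trans X N h h' \<gamma> \<and> whisker_left X K \<gamma> = \<alpha>"
  proof (intro ex1I conjI)
    show "nat_trans X N h h' \<gamma>"
      unfolding nat_trans_def
    proof (intro conjI ballI allI)
      show "is_functor X N h" "is_functor X N h'" by (fact h.functoriality h'.functoriality)+
      show "\<gamma> \<in> extensional (Ob X)" by (simp add: \<gamma>_def)
      show "\<gamma> x \<in> hom N (fob h x) (fob h' x)" if "x \<in> Ob X" for x using \<gamma>[OF that] .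
      show "\<gamma> y \<cdot>\<^bsub>N\<^esub> far h u = far h' u \<cdot>\<^bsub>N\<^esub> \<gamma> x" if u: "u \<in> hom X x y" for x y u
      proof -
        note o = h.C.hom_Ob[OF u] and k = far_K_hom[OF h.far_hom[OF u]] and k' = far_K_hom[OF h'.far_hom[OF u]]
        show ?thesis
          using arg_cong[OF \<alpha>n[OF u], of "far P1"] pi1_Comp[OF k \<alpha>x[OF o(2)]] pi1_Comp[OF \<alpha>x[OF o(1)] k'] o
          by (simp add: \<gamma>_def far_K[OF h.far_hom[OF u]] far_K[OF h'.far_hom[OF u]])
      qed
    qed
    have "far K (\<gamma> x) = \<alpha> x" if x: "x \<in> Ob X" for x
    proof (rule hom_G_eqI[OF far_K_hom[OF \<gamma>[OF x]] \<alpha>x[OF x]])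
      show "far P1 (far K (\<gamma> x)) = far P1 (\<alpha> x)" using x far_K[OF \<gamma>[OF x]] by (simp add: \<gamma>_def)
      show "far P2 (far K (\<gamma> x)) = far P2 (\<alpha> x)"
        using pi2_hom[OF far_K_hom[OF \<gamma>[OF x]]] pi2_hom[OF \<alpha>x[OF x]]
        by (intro H.terminal_unique[OF H.One_terminal]) (simp_all add: fob_K)
    qed
    then show "whisker_left X K \<gamma> = \<alpha>"
      using \<alpha> by (intro extensionalityI[of _ "Ob X"]) (auto simp: whisker_left_def nat_trans_def)
    fix \<gamma>' assume \<gamma>': "nat_trans X N h h' \<gamma>' \<and> whisker_left X K \<gamma>' = \<alpha>"
    show "\<gamma>' = \<gamma>"
    proof (rule extensionalityI[of _ "Ob X"])
      fix x assume x: "x \<in> Ob X"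
      then have "far K (\<gamma>' x) = \<alpha> x" using \<gamma>' by (auto simp: whisker_left_def)
      moreover have "far P1 (far K (\<gamma>' x)) = \<gamma>' x" by (simp add: pi1_star_def)
      ultimately have "far P1 (\<alpha> x) = \<gamma>' x" by simp
      then show "\<gamma>' x = \<gamma> x" using x by (simp add: \<gamma>_def)
    qed (use \<gamma>' in \<open>auto simp: nat_trans_def \<gamma>_def\<close>)
  qed
qed

text \<open>A 2-cell from \<open>h \<odot> pi2\<close> to \<open>h' \<odot> pi2\<close> is
  determined by its components at the objects \<open>fob R y\<close>: naturality at the unit carries
  these to every other object.\<close>

lemma cokernel_pi2: "is_2cokernel TYPE(('xo, 'xa) topos) N G H K pi2"
  unfolding is_2cokernel_def
proof (intro conjI allI impI top_lex_K top_lex_pi2 zero_pi2_K)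
  fix X :: "('xo, 'xa) topos" and t
  assume t: "top_lex G X t" and zero: "is_zero N X (t \<odot> K)"
  interpret t: cat_functor G X t using top_lex_functor[OF t] by (simp add: functor_iff)
  define \<alpha> where "\<alpha> = (\<lambda>x \<in> Ob G. far t (unit x))"
  have comp: "is_functor G X ((t \<odot> R) \<odot> pi2)"
    using is_functor_comp[OF pi2_functor is_functor_comp[OF R_functor t.functoriality]] .
  have "nat_iso G X t ((t \<odot> R) \<odot> pi2) \<alpha>"
    unfolding nat_iso_def nat_trans_def
  proof (intro conjI ballI allI)
    show "is_functor G X t" "is_functor G X ((t \<odot> R) \<odot> pi2)" by (fact t.functoriality comp)+
    show "\<alpha> \<in> extensional (Ob G)" by (simp add: \<alpha>_def)
    show "\<alpha> x \<in> hom X (fob t x) (fob ((t \<odot> R) \<odot> pi2) x)" if "x \<in> Ob G" for x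
      using t.far_hom[OF unit_hom[OF that]] that by (simp add: \<alpha>_def)
    show "\<alpha> y \<cdot>\<^bsub>X\<^esub> far t u = far ((t \<odot> R) \<odot> pi2) u \<cdot>\<^bsub>X\<^esub> \<alpha> x" if u: "u \<in> hom G x y" for x y u
    proof -
      note o = G.hom_Ob[OF u]
      show ?thesis
        using o far_Comp_hom[OF t.functoriality u unit_hom[OF o(2)]] unit_natural[OF u]
          far_Comp_hom[OF t.functoriality unit_hom[OF o(1)] far_R_hom[OF pi2_hom[OF u]]]
        by (simp add: \<alpha>_def)
    qed
    show "is_iso X (\<alpha> x)" if x: "x \<in> Ob G" for x
    proof -
      obtain g p where g: "g \<in> hom G (fob R (fob P2 x)) (fob K (fob F (fob P2 x)))"
          and pb: "is_pullback G (far K (lab x)) g p (unit x)"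
        using unit_pullback[OF x] .
      note l = lab_hom[OF x]
      note tl = t.far_hom[OF far_K_hom[OF l]]
      \<comment> \<open>Source and target are values of the zero functor \<open>t \<odot> K\<close>,
        hence terminal; \<open>far t (unit x)\<close> is a pullback of this arrow and so invertible
        too.\<close>
      have "is_iso X (far t (far K (lab x)))"
        using zero N.hom_Ob[OF l] by (intro t.D.terminal_arrow_iso[OF _ _ tl]) (simp_all add: is_zero_def)
      then have "is_iso X (far t (unit x))"
        using t.D.pullback_of_iso[OF lex_pullback[OF _ pb] tl t.far_hom[OF g]] t
        by (simp add: top_lex_def)
      then show ?thesis using x by (simp add: \<alpha>_def)
    qed
  qed
  then show "\<exists>h \<alpha>. top_lex H X h \<and> nat_iso G X t (h \<odot> pi2) \<alpha>"
    using top_lex_comp[OF top_lex_R t] by blast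
next
  fix X :: "('xo, 'xa) topos" and h h' \<alpha>
  assume h: "top_lex H X h" and h': "top_lex H X h'" and \<alpha>: "nat_trans G X (h \<odot> pi2) (h' \<odot> pi2) \<alpha>"
  interpret h: cat_functor H X h using top_lex_functor[OF h] by (simp add: functor_iff)
  interpret h': cat_functor H X h' using top_lex_functor[OF h'] by (simp add: functor_iff)
  have \<alpha>x: "\<alpha> x \<in> hom X (fob h (fob P2 x)) (fob h' (fob P2 x))" if "x \<in> Ob G" for x
    using \<alpha> that by (simp add: nat_trans_def)
  have \<alpha>n: "\<alpha> y \<cdot>\<^bsub>X\<^esub> far h (far P2 u) = far h' (far P2 u) \<cdot>\<^bsub>X\<^esub> \<alpha> x" if "u \<in> hom G x y" for x y u
    using \<alpha> that unfolding nat_trans_def far_comp by blast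
  define \<gamma> where "\<gamma> = (\<lambda>y \<in> Ob H. \<alpha> (fob R y))"
  show "\<exists>!\<gamma>. nat_trans H X h h' \<gamma> \<and> whisker_right G \<gamma> pi2 = \<alpha>"
  proof (intro ex1I conjI)
    show "nat_trans H X h h' \<gamma>"
      unfolding nat_trans_def
    proof (intro conjI ballI allI)
      show "is_functor H X h" "is_functor H X h'" by (fact h.functoriality h'.functoriality)+
      show "\<gamma> \<in> extensional (Ob H)" by (simp add: \<gamma>_def)
      show "\<gamma> y \<in> hom X (fob h y) (fob h' y)" if "y \<in> Ob H" for y
        using \<alpha>x[OF fob_R_Ob[OF that]] that by (simp add: \<gamma>_def fob_R)
      show "\<gamma> y' \<cdot>\<^bsub>X\<^esub> far h g = far h' g \<cdot>\<^bsub>X\<^esub> \<gamma> y" if g: "g \<in> hom H y y'" for y y' g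
        using \<alpha>n[OF far_R_hom[OF g]] H.hom_Ob[OF g] by (simp add: \<gamma>_def far_R[OF g])
    qed
    \<comment> \<open>The second component of \<open>unit x\<close> is an identity, so naturality of
      \<open>\<alpha>\<close> at \<open>unit x\<close> equates the components at \<open>x\<close>
      and at \<open>fob R (fob P2 x)\<close>.\<close>
    have "\<gamma> (fob P2 x) = \<alpha> x" if x: "x \<in> Ob G" for x
    proof -
      have o: "fob P2 x \<in> Ob H" using x by (simp add: Ob_G)
      have "\<alpha> (fob R (fob P2 x)) \<in> hom X (fob h (fob P2 x)) (fob h' (fob P2 x))"
        using \<alpha>x[OF fob_R_Ob[OF o]] by (simp add: fob_R)
      then show ?thesis
        using \<alpha>n[OF unit_hom[OF x]] o \<alpha>x[OF x]
        by (simp add: \<gamma>_def far_pi_unit h.D.Comp_Ident h.D.Ident_Comp)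
    qed
    then show "whisker_right G \<gamma> pi2 = \<alpha>"
      using \<alpha> by (intro extensionalityI[of _ "Ob G"]) (auto simp: whisker_right_def nat_trans_def)
    fix \<gamma>' assume \<gamma>': "nat_trans H X h h' \<gamma>' \<and> whisker_right G \<gamma>' pi2 = \<alpha>"
    show "\<gamma>' = \<gamma>"
    proof (rule extensionalityI[of _ "Ob H"])
      fix y assume y: "y \<in> Ob H"
      \<comment> \<open>Every \<open>y\<close> is the second component of \<open>fob R y\<close>, so
        whiskering with \<open>pi2\<close> forgets nothing.\<close>
      have "whisker_right G \<gamma>' P2 (fob R y) = \<gamma>' y"
        using fob_R_Ob[OF y] by (simp add: whisker_right_def fob_R)
      then show "\<gamma>' y = \<gamma> y" using \<gamma>' y by (simp add: \<gamma>_def)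
    qed (use \<gamma>' in \<open>auto simp: nat_trans_def \<gamma>_def\<close>)
  qed
qed

end

theorem proposition3p12:
  fixes N :: "('no, 'na) topos" and H :: "('ho, 'ha) topos"
    and F :: "('ho, 'ha, 'no, 'na) functor_data"
  assumes "topos H" and "topos N" and "lex_functor H N F"
  shows "adjoint_split_extension TYPE(('xo, 'xa) topos)
           N (Gl N H F) H (pi1_star N H F) pi2 (pi2_star N H F) (id_trans H)"
proof -
  interpret gluing N H F
    using assms by (simp add: gluing_def gluing_axioms_def)
  have "nat_iso H H (pi2 \<odot> R) id_functor (id_trans H)"
    using nat_trans_counit H.Ident_iso by (simp add: nat_iso_def id_trans_def)
  then show ?thesis
    unfolding adjoint_split_extension_def
    using top_lex_K top_lex_pi2 top_lex_R kernel_K cokernel_pi2 adjunction by blast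
qed

end
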